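(* There exists a finite constant $C>0$ such that, for every $n\in S$, $$ d_{\rm W}\big(\widetilde{\mathcal Z}_n, Z\big)\le C\,\mathcal N_n^{-1/2}, $$ where $\widetilde{\mathcal Z}_n := (\mathcal Z_n-\mathbb E[\mathcal Z_n])/\sqrt{\mathrm{Var}(\mathcal Z_n)}$ is the normalized Leray measure of the arithmetic random wave $T_n$, and $Z\sim\mathcal N(0,1)$ is a standard Gaussian random variable. In particular, if $\{n_j\}\subset S$ is such that $\mathcal N_{n_j}\to+\infty$, then $\widetilde{\mathcal Z}_{n_j}$ converges in distribution to $Z$.
   Context: Let $\mathbb T=\mathbb R^2/\mathbb Z^2$ be the flat torus and let $S$ be the set of integers $n\ge 1$ of the form $n=a^2+b^2$ with $a,b\in\mathbb Z$. For $n\in S$ let $\Lambda_n=\{\lambda=(\lambda_1,\lambda_2)\in\mathbb Z^2:\lambda_1^2+\lambda_2^2=n\}$ and $\mathcal N_n=|\Lambda_n|$. For $\lambda\in\Lambda_n$ set $e_\lambda(x)=\exp(2\pi i\langle\lambda,x\rangle)$, $x\in\mathbb T$. All random objects are defined on a common probability space $(\Omega,\mathcal F,\mathbb P)$. Let $a_\lambda$ be identically distributed standard complex Gaussian random variables ($a_\lambda=b_\lambda+ic_\lambda$ with $b_\lambda,c_\lambda$ i.i.d. real centered Gaussian of variance $1/2$), independent except for the relations $\overline{a_\lambda}=a_{-\lambda}$. The arithmetic random wave of order $n\in S$ is the real centered Gaussian field $$T_n(x)=\frac1{\sqrt{\mathcal N_n}}\sum_{\lambda\in\Lambda_n}a_\lambda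 e_\lambda(x),\quad x\in\mathbb T.$$ The Leray measure of $T_n$ is $$\mathcal Z_n=\lim_{\varepsilon\to0}\frac1{2\varepsilon}\,\mathrm{meas}\{x\in\mathbb T:|T_n(x)|<\varepsilon\},$$ where $\mathrm{meas}$ is Lebesgue measure on $\mathbb T$ and the limit is in probability; $\mathcal Z_n$ has finite variance. The 1-Wasserstein distance between the laws of two (integrable) real random variables is $d_{\rm W}(X,Y)=\sup_{h}|\mathbb E[h(X)]-\mathbb E[h(Y)]|$, the supremum being over all functions $h:\mathbb R\to\mathbb R$ with Lipschitz constant at most $1$. *)

theory Defs
  imports "HOL-Probability.Probability"
begin

definition sums_of_two_squares :: "nat set" where
  "sums_of_two_squares = {n. n \<ge> 1 \<and> (\<exists>a b :: int. int n = a\<^sup>2 + b\<^sup>2)}"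

definition Freq :: "nat \<Rightarrow> (int \<times> int) set" where
  "Freq n = {l. (fst l)\<^sup>2 + (snd l)\<^sup>2 = int n}"

definition e_freq :: "int \<times> int \<Rightarrow> real \<times> real \<Rightarrow> complex" where
  "e_freq l x = exp (2 * complex_of_real pi * \<i> *
     complex_of_real (of_int (fst l) * fst x + of_int (snd l) * snd x))"

definition std_complex_gaussian :: "'w measure \<Rightarrow> ('w \<Rightarrow> complex) \<Rightarrow> bool" where
  "std_complex_gaussian M X \<longleftrightarrow>
     distributed M lborel (\<lambda>\<omega>. Re (X \<omega>)) (\<lambda>t. ennreal (normal_density 0 (sqrt (1/2)) t)) \<and>
     distributed M lborel (\<lambda>\<omega>. Im (X \<omega>)) (\<lambda>t. ennreal (normal_density 0 (sqrt (1/2)) t)) \<and>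
     prob_space.indep_var M borel (\<lambda>\<omega>. Re (X \<omega>)) borel (\<lambda>\<omega>. Im (X \<omega>))"

text \<open>Independence ``except for the relations'' between opposite frequencies: any subfamily
  that contains no two opposite frequencies is independent.\<close>

definition wave_coefficients ::
    "'w measure \<Rightarrow> nat \<Rightarrow> (int \<times> int \<Rightarrow> 'w \<Rightarrow> complex) \<Rightarrow> bool" where
  "wave_coefficients M n a \<longleftrightarrow>
     (\<forall>l\<in>Freq n. std_complex_gaussian M (a l)) \<and>
     (\<forall>l\<in>Freq n. \<forall>\<omega>\<in>space M. cnj (a l \<omega>) = a (- l) \<omega>) \<and>
     (\<forall>P \<subseteq> Freq n. (\<forall>l\<in>P. - l \<notin> P) \<longrightarrow> prob_space.indep_vars M (\<lambda>_. borel) a P)"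

text \<open>The real part only serves to obtain a real-valued field: the sum is already real
  (\<open>arith_random_wave_eq\<close> below).\<close>

definition arith_random_wave ::
    "nat \<Rightarrow> (int \<times> int \<Rightarrow> 'w \<Rightarrow> complex) \<Rightarrow> real \<times> real \<Rightarrow> 'w \<Rightarrow> real" where
  "arith_random_wave n a x \<omega> =
     Re (1 / complex_of_real (sqrt (real (card (Freq n)))) * (\<Sum>l\<in>Freq n. a l \<omega> * e_freq l x))"

text \<open>A fundamental domain: functions on the flat torus are regarded as \<open>\<int>\<^sup>2\<close>-periodic functions
  on the plane, and the Lebesgue measure of the torus is the planar one on this square.\<close>

definition torus :: "(real \<times> real) set" where
  "torus = {0..<1} \<times> {0..<1}"

definition leray_approx :: "(real \<times> real \<Rightarrow> 'w \<Rightarrow> real) \<Rightarrow> real \<Rightarrow> 'w \<Rightarrow> real" where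
  "leray_approx T \<epsilon> \<omega> = 1 / (2 * \<epsilon>) * measure lborel {x \<in> torus. \<bar>T x \<omega>\<bar> < \<epsilon>}"

definition tendsto_in_probability ::
    "'w measure \<Rightarrow> ('i \<Rightarrow> 'w \<Rightarrow> real) \<Rightarrow> ('w \<Rightarrow> real) \<Rightarrow> 'i filter \<Rightarrow> bool" where
  "tendsto_in_probability M X Y F \<longleftrightarrow>
     (\<forall>\<delta>>0. ((\<lambda>i. measure M {\<omega> \<in> space M. \<bar>X i \<omega> - Y \<omega>\<bar> > \<delta>}) \<longlongrightarrow> 0) F)"

text \<open>The limit in probability is determined only almost surely, so this is a predicate that
  holds for every version of the Leray measure.\<close>

definition is_leray_measure ::
    "'w measure \<Rightarrow> (real \<times> real \<Rightarrow> 'w \<Rightarrow> real) \<Rightarrow> ('w \<Rightarrow> real) \<Rightarrow> bool" where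
  "is_leray_measure M T Z \<longleftrightarrow>
     Z \<in> borel_measurable M \<and> tendsto_in_probability M (leray_approx T) Z (at_right 0)"

definition normalized :: "'w measure \<Rightarrow> ('w \<Rightarrow> real) \<Rightarrow> 'w \<Rightarrow> real" where
  "normalized M X \<omega> = (X \<omega> - prob_space.expectation M X) / sqrt (prob_space.variance M X)"

text \<open>Meaningful for laws with finite first moment, under which all the integrals exist. The
  supremum is taken in the extended reals, so it is never a default value.\<close>

definition wasserstein1 :: "real measure \<Rightarrow> real measure \<Rightarrow> ereal" where
  "wasserstein1 \<mu> \<nu> =
     (SUP h \<in> {h :: real \<Rightarrow> real. 1-lipschitz_on UNIV h}. ereal \<bar>(\<integral>x. h x \<partial>\<mu>) - (\<integral>x. h x \<partial>\<nu>)\<bar>)"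


lemma finite_Freq: "finite (Freq n)"
proof (rule finite_subset)
  show "Freq n \<subseteq> {- int n..int n} \<times> {- int n..int n}"
  proof
    fix l assume "l \<in> Freq n"
    then have eq: "(fst l)\<^sup>2 + (snd l)\<^sup>2 = int n" by (simp add: Freq_def)
    have *: "\<bar>k\<bar> \<le> k\<^sup>2" for k :: int
      by (metis abs_ge_self abs_le_square_iff abs_mult_self_eq abs_of_nonneg abs_power2
          int_one_le_iff_zero_less mult_left_mono mult_1_right power2_eq_square zero_less_abs_iff
          abs_ge_zero abs_zero order_refl)
    have "\<bar>fst l\<bar> \<le> int n" "\<bar>snd l\<bar> \<le> int n"
      using *[of "fst l"] *[of "snd l"] eq
        zero_le_power2[of "fst l"] zero_le_power2[of "snd l"] by linarith+
    then show "l \<in> {- int n..int n} \<times> {- int n..int n}"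
      by (cases l) auto
  qed
qed simp

lemma arith_random_wave_eq:
  assumes "wave_coefficients M n a" and "\<omega> \<in> space M"
  shows "complex_of_real (arith_random_wave n a x \<omega>) =
     1 / complex_of_real (sqrt (real (card (Freq n)))) * (\<Sum>l\<in>Freq n. a l \<omega> * e_freq l x)"
proof -
  let ?s = "\<Sum>l\<in>Freq n. a l \<omega> * e_freq l x"
  have e: "cnj (e_freq l x) = e_freq (- l) x" for l
    by (simp add: e_freq_def exp_cnj algebra_simps)
  have "cnj ?s = (\<Sum>l\<in>Freq n. a (- l) \<omega> * e_freq (- l) x)"
    using assms unfolding wave_coefficients_def cnj_sum by (intro sum.cong) (auto simp: e)
  also have "\<dots> = ?s"
    by (rule sum.reindex_bij_witness[of _ uminus uminus]) (auto simp: Freq_def)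
  finally have "?s \<in> \<real>"
    by (simp add: Reals_cnj_iff)
  then have "1 / complex_of_real (sqrt (real (card (Freq n)))) * ?s \<in> \<real>"
    by (intro Reals_mult Reals_divide) auto
  then show ?thesis
    unfolding arith_random_wave_def by (rule of_real_Re)
qed

lemma arith_random_wave_periodic:
  "arith_random_wave n a (x + (of_int j, of_int k)) \<omega> = arith_random_wave n a x \<omega>"
proof -
  have "e_freq l (x + (of_int j, of_int k)) = e_freq l x" for l
  proof -
    have "e_freq l (x + (of_int j, of_int k)) =
        e_freq l x * exp (complex_of_real (2 * of_int (fst l * j + snd l * k) * pi) * \<i>)"
      unfolding e_freq_def by (simp add: exp_add[symmetric] algebra_simps)
    also have "exp (complex_of_real (2 * of_int (fst l * j + snd l * k) * pi) * \<i>) = 1"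
      by (subst exp_eq_1) (auto intro: exI[of _ "fst l * j + snd l * k"])
    finally show ?thesis by simp
  qed
  then show ?thesis by (simp add: arith_random_wave_def)
qed

end

theory Submission
  imports Defs
begin

text \<open>
  Write \<open>N\<close> for the number of frequencies, \<open>m = N / 2\<close>, and \<open>r\<close> for the covariance function
  \<open>wave_cov n\<close> of the wave. The Leray measure is a function of a Gaussian field; its projection on
  the second Wiener chaos carries the limit law, and everything of higher order is negligible:

  \<open>Z = peak + (peak / 2) (1 - energy / m) + R\<close>,  with \<open>peak = 1 / sqrt (2 \<pi>)\<close>.

  By Parseval's identity (\<open>integral_wave_square\<close>) the second projection depends on the coefficients
  through their energy alone, and its standard deviation is \<open>peak / (2 sqrt m)\<close>. The theorem follows
  from two facts.

  The remainder satisfies \<open>E R\<^sup>2 = O(1 / N\<^sup>2)\<close> (\<open>leray_residual_second_moment\<close>). Replace the delta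
  function by the window \<open>indicator {-\<epsilon><..<\<epsilon>} / (2 \<epsilon>)\<close> and subtract its projections on the Hermite
  polynomials of degree 0 and 2. Expanding the bivariate Gaussian density
  (\<open>bivariate_kernel_bound\<close>) bounds the correlation of the residuals at two points of covariance \<open>r\<close> by
  \<open>3 r\<^sup>4 / sqrt (1 - r\<^sup>2)\<close>, uniformly in \<open>\<epsilon>\<close> (\<open>resid_pair\<close>); Fatou's lemma then lets \<open>\<epsilon>\<close> tend to 0.
  It remains to see that the integral of \<open>r\<^sup>4 / sqrt (1 - r\<^sup>2)\<close> over the torus is \<open>O(1 / N\<^sup>2)\<close>
  (\<open>wave_cov_singular_integral\<close>). Without the singular factor this would be a count of quadruples of
  frequencies with vanishing sum: since two circles meet in at most two points, there are at most
  \<open>3 N\<^sup>2\<close> of them (\<open>card_quadruples\<close>). The singular factor is at most a mean over the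
  frequencies \<open>l\<close> of the integrable weights \<open>1 / sqrt \<bar>sin (2 \<pi> \<langle>l, x\<rangle>) sin (2 \<pi> \<langle>l', x\<rangle>)\<bar>\<close>, where
  \<open>l'\<close> is \<open>l\<close> turned by a right angle (\<open>one_minus_wave_cov_sq_ge\<close>, \<open>inverse_sqrt_mean_le\<close>). Such a weight is
  invariant under a lattice of \<open>n\<^sup>2\<close> points of the torus, so that \<open>r\<^sup>4\<close> may be averaged over this
  lattice; the average is \<open>O(1 / N\<^sup>2)\<close> at every point, by the same count of quadruples
  (\<open>dual_average_wave_cov_power4_le\<close>).

  The energy is a sum of \<open>m\<close> independent exponential variables, so it obeys the Stein identity of a
  Gamma law (\<open>energy_stein\<close>), which Gaussian integration by parts yields directly. Tested against a
  solution of Stein's equation with derivative bounded by 2 (\<open>stein_solution\<close>), it shows that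
  \<open>(m - energy) / sqrt m\<close> is within \<open>2 / sqrt m\<close> of the standard normal law in the Wasserstein distance
  (\<open>normalized_energy_wasserstein\<close>).

  The remainder is smaller than the main term by a factor of order \<open>N powr (- 1 / 2)\<close>, so normalising costs
  an error of this order only (\<open>normalized_near\<close>), and the bound for \<open>Z\<close> follows. As
  convergence in law can be tested on Lipschitz step functions, the bound implies the limit theorem.
\<close>

section \<open>Frequencies on a circle\<close>

abbreviation phase :: "int \<times> int \<Rightarrow> real \<times> real \<Rightarrow> real" where
  "phase l x \<equiv> of_int (fst l) * fst x + of_int (snd l) * snd x"

abbreviation iprod :: "int \<times> int \<Rightarrow> int \<times> int \<Rightarrow> int" where
  "iprod l v \<equiv> fst l * fst v + snd l * snd v"

definition quarter_turn :: "int \<times> int \<Rightarrow> int \<times> int" where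
  "quarter_turn l = (- snd l, fst l)"

lemma Freq_uminus [simp]: "- l \<in> Freq n \<longleftrightarrow> l \<in> Freq n"
  by (simp add: Freq_def)

lemma Freq_quarter_turn [simp]: "quarter_turn l \<in> Freq n \<longleftrightarrow> l \<in> Freq n"
  by (simp add: Freq_def quarter_turn_def add.commute)

lemma Freq_nonempty: "n \<in> sums_of_two_squares \<Longrightarrow> Freq n \<noteq> {}"
  unfolding sums_of_two_squares_def Freq_def by force

lemma abs_mult_le_mean_squares: "\<bar>x * y\<bar> \<le> (x\<^sup>2 + y\<^sup>2) / 2" for x y :: real
  using zero_le_power2[of "\<bar>x\<bar> - \<bar>y\<bar>"] by (simp add: power2_diff abs_mult)

lemma four_square_roots: "finite {w::int. 4 * w\<^sup>2 = c}" "card {w::int. 4 * w\<^sup>2 = c} \<le> 2"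
proof -
  obtain w0 where sub: "{w::int. 4 * w\<^sup>2 = c} \<subseteq> {w0, - w0}"
  proof (cases "\<exists>w0::int. 4 * w0\<^sup>2 = c")
    case True
    then obtain w0 :: int where w0: "4 * w0\<^sup>2 = c" by blast
    have "{w. 4 * w\<^sup>2 = c} \<subseteq> {w0, - w0}" unfolding w0[symmetric] by (auto simp: power2_eq_iff)
    then show ?thesis by (rule that)
  next
    case False
    then show ?thesis by (intro that[of 0]) blast
  qed
  then show "finite {w::int. 4 * w\<^sup>2 = c}" by (rule finite_subset) simp
  have "card {w::int. 4 * w\<^sup>2 = c} \<le> card {w0, - w0}" using sub by (rule card_mono[rotated]) simp
  then show "card {w::int. 4 * w\<^sup>2 = c} \<le> 2" by (rule order.trans) (simp add: card_insert_if)
qed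

text \<open>The points \<open>l\<close> lie on two circles of equal radii with the distinct centres \<open>0\<close> and \<open>v\<close>. All
  of them have the same component along \<open>v\<close>, and that determines the square of the component
  orthogonal to \<open>v\<close>.\<close>

lemma card_circle_intersection:
  assumes "v \<noteq> 0"
  shows "card {l \<in> Freq n. v - l \<in> Freq n} \<le> 2"
proof -
  obtain p q where v: "v = (p, q)" by (cases v)
  define D where "D = p\<^sup>2 + q\<^sup>2"
  have D: "D > 0" using assms unfolding D_def v by (auto simp: zero_prod_def sum_power2_gt_zero_iff)
  define f where "f = (\<lambda>l::int\<times>int. p * snd l - q * fst l)"
  let ?S = "{l \<in> Freq n. v - l \<in> Freq n}"
  have dot: "2 * (p * fst l + q * snd l) = D" if "l \<in> ?S" for l
  proof -
    have "(fst l)\<^sup>2 + (snd l)\<^sup>2 = int n" "(p - fst l)\<^sup>2 + (q - snd l)\<^sup>2 = int n"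
      using that by (auto simp: Freq_def v)
    then show ?thesis by (simp add: D_def power2_eq_square algebra_simps)
  qed
  have "inj_on f ?S"
  proof (rule inj_onI)
    fix k l assume k: "k \<in> ?S" and l: "l \<in> ?S" and eq: "f k = f l"
    have 1: "p * fst k + q * snd k = p * fst l + q * snd l"
      using dot[OF k] dot[OF l] by (metis mult_left_cancel zero_neq_numeral)
    have 2: "p * snd k - q * fst k = p * snd l - q * fst l" using eq by (simp add: f_def)
    have "D * fst k = p * (p * fst k + q * snd k) - q * (p * snd k - q * fst k)"
      by (simp add: D_def power2_eq_square algebra_simps)
    also have "\<dots> = D * fst l"
      unfolding 1 2 by (simp add: D_def power2_eq_square algebra_simps)
    finally have a: "fst k = fst l" using D by simp
    have "D * snd k = q * (p * fst k + q * snd k) + p * (p * snd k - q * fst k)"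
      by (simp add: D_def power2_eq_square algebra_simps)
    also have "\<dots> = D * snd l"
      unfolding 1 2 by (simp add: D_def power2_eq_square algebra_simps)
    finally have "snd k = snd l" using D by simp
    with a show "k = l" by (simp add: prod_eq_iff)
  qed
  then have "card ?S = card (f ` ?S)" by (simp add: card_image)
  also have "\<dots> \<le> card {w::int. 4 * w\<^sup>2 = 4 * D * int n - D\<^sup>2}"
  proof (rule card_mono[OF four_square_roots(1)], safe)
    fix l assume l: "l \<in> Freq n" "v - l \<in> Freq n"
    have "4 * (f l)\<^sup>2 = 4 * (D * ((fst l)\<^sup>2 + (snd l)\<^sup>2)) - (2 * (p * fst l + q * snd l))\<^sup>2"
      unfolding f_def D_def by (simp add: power2_eq_square algebra_simps)
    also have "\<dots> = 4 * D * int n - D\<^sup>2"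
      using dot[of l] l by (simp add: Freq_def)
    finally show "4 * (f l)\<^sup>2 = 4 * D * int n - D\<^sup>2" .
  qed
  also have "\<dots> \<le> 2" by (rule four_square_roots(2))
  finally show ?thesis .
qed

text \<open>If \<open>l\<^sub>1 + l\<^sub>2 \<noteq> v\<close>, the pair \<open>(l\<^sub>3, l\<^sub>4)\<close> has a given nonzero sum, so that there are at most two
  of them. If \<open>l\<^sub>1 + l\<^sub>2 = v\<close>, both pairs are determined by their first entries.\<close>

lemma card_quadruples:
  "card {((l1, l2), (l3, l4)). l1 \<in> Freq n \<and> l2 \<in> Freq n \<and> l3 \<in> Freq n \<and> l4 \<in> Freq n \<and>
      l1 + l2 + l3 + l4 = v} \<le> 3 * (card (Freq n))\<^sup>2"
proof -
  let ?F = "Freq n" and ?N = "card (Freq n)"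
  let ?Q = "{((l1, l2), (l3, l4)). l1 \<in> ?F \<and> l2 \<in> ?F \<and> l3 \<in> ?F \<and> l4 \<in> ?F \<and>
      l1 + l2 + l3 + l4 = v}"
  define A where "A = (SIGMA p : ?F \<times> ?F. {l \<in> ?F. fst p + snd p \<noteq> v \<and> v - fst p - snd p - l \<in> ?F})"
  define B where "B = ?F \<times> ?F"
  have [simp]: "finite ?F" by (rule finite_Freq)
  have "?Q \<subseteq> (\<lambda>(p, l). (p, (l, v - fst p - snd p - l))) ` A \<union>
      (\<lambda>(k, l). ((k, v - k), (l, - l))) ` B"
  proof (rule subsetI)
    fix z assume "z \<in> ?Q"
    then obtain l1 l2 l3 l4 where z: "z = ((l1, l2), (l3, l4))"
      and mem: "l1 \<in> ?F" "l2 \<in> ?F" "l3 \<in> ?F" "l4 \<in> ?F" and s: "l1 + l2 + l3 + l4 = v"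
      by blast
    have l4: "l4 = v - l1 - l2 - l3" using s by (auto simp: algebra_simps)
    show "z \<in> (\<lambda>(p, l). (p, (l, v - fst p - snd p - l))) ` A \<union>
        (\<lambda>(k, l). ((k, v - k), (l, - l))) ` B"
    proof (cases "l1 + l2 = v")
      case True
      then have "z = (\<lambda>(k, l). ((k, v - k), (l, - l))) (l1, l3)"
        unfolding z l4 by (auto simp: algebra_simps)
      moreover have "(l1, l3) \<in> B" using mem by (simp add: B_def)
      ultimately show ?thesis by blast
    next
      case False
      have "((l1, l2), l3) \<in> A"
        using mem False unfolding A_def by (simp add: l4[symmetric])
      moreover have "z = (\<lambda>(p, l). (p, (l, v - fst p - snd p - l))) ((l1, l2), l3)"
        unfolding z l4 by simp
      ultimately show ?thesis by blast
    qed
  qed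
  then have "card ?Q \<le> card ((\<lambda>(p, l). (p, (l, v - fst p - snd p - l))) ` A \<union>
      (\<lambda>(k, l). ((k, v - k), (l, - l))) ` B)"
    by (intro card_mono finite_UnI finite_imageI) (auto simp: A_def B_def)
  also have "\<dots> \<le> card A + card B"
    by (intro order.trans[OF card_Un_le] add_mono card_image_le) (auto simp: A_def B_def)
  also have "card A \<le> (\<Sum>p\<in>?F \<times> ?F. 2)"
    unfolding A_def
  proof (subst card_SigmaI; (intro sum_mono)?)
    fix p assume "p \<in> ?F \<times> ?F"
    show "card {l \<in> ?F. fst p + snd p \<noteq> v \<and> v - fst p - snd p - l \<in> ?F} \<le> 2"
    proof (cases "fst p + snd p = v")
      case False
      then have "v - fst p - snd p \<noteq> 0" by (simp add: algebra_simps)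
      from card_circle_intersection[OF this, of n] False show ?thesis by simp
    qed simp
  qed auto
  finally show ?thesis by (simp add: B_def card_cartesian_product power2_eq_square)
qed

lemma e_freq_cis: "e_freq l x = cis (2 * pi * phase l x)"
  by (simp add: e_freq_def cis_conv_exp mult_ac)

lemma norm_e_freq [simp]: "norm (e_freq l x) = 1"
  by (simp add: e_freq_cis)

lemma e_freq_add_left: "e_freq (k + l) x = e_freq k x * e_freq l x"
  by (simp add: e_freq_cis cis_mult algebra_simps)

lemma e_freq_add_right: "e_freq l (x + y) = e_freq l x * e_freq l y"
  by (simp add: e_freq_cis cis_mult algebra_simps)

definition wave_cov :: "nat \<Rightarrow> real \<times> real \<Rightarrow> real" where
  "wave_cov n x = (\<Sum>l\<in>Freq n. cos (2 * pi * phase l x)) / real (card (Freq n))"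

lemma sum_sin_phase: "(\<Sum>l\<in>Freq n. sin (2 * pi * phase l x)) = 0"
proof -
  have "(\<Sum>l\<in>Freq n. sin (2 * pi * phase l x)) = (\<Sum>l\<in>Freq n. sin (2 * pi * phase (- l) x))"
    by (rule sum.reindex_bij_witness[of _ uminus uminus]) auto
  also have "\<dots> = (\<Sum>l\<in>Freq n. - sin (2 * pi * phase l x))"
  proof (rule sum.cong[OF refl])
    fix l :: "int \<times> int"
    have "2 * pi * phase (- l) x = - (2 * pi * phase l x)" by (simp add: algebra_simps)
    then show "sin (2 * pi * phase (- l) x) = - sin (2 * pi * phase l x)" by (simp only: sin_minus)
  qed
  also have "\<dots> = - (\<Sum>l\<in>Freq n. sin (2 * pi * phase l x))" by (rule sum_negf)
  finally show ?thesis by simp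
qed

lemma wave_cov_complex:
  "complex_of_real (wave_cov n x) = (\<Sum>l\<in>Freq n. e_freq l x) / of_nat (card (Freq n))"
proof -
  have "(\<Sum>l\<in>Freq n. e_freq l x) = complex_of_real (\<Sum>l\<in>Freq n. cos (2 * pi * phase l x))"
    by (rule complex_eqI) (simp_all add: e_freq_cis sum_sin_phase)
  then show ?thesis by (simp add: wave_cov_def)
qed

lemma sum_roots_of_unity_eq_0:
  assumes "\<not> int n dvd m" "n > 0"
  shows "(\<Sum>j<n. cis (2 * pi * (real j * of_int m / real n))) = 0"
proof -
  define z where "z = cis (2 * pi * (of_int m / real n))"
  have pow: "z ^ j = cis (2 * pi * (real j * of_int m / real n))" for j
    unfolding z_def Complex.DeMoivre by (rule arg_cong[where f = cis]) (simp add: field_simps)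
  have "z ^ n = cis (2 * pi * of_int m)" using assms(2) by (simp add: pow)
  then have zn: "z ^ n = 1" by simp
  have "z \<noteq> 1"
  proof
    assume "z = 1"
    then have "cos (2 * pi * (of_int m / real n)) = 1" by (simp add: z_def complex_eq_iff)
    then obtain i :: int where "2 * pi * (of_int m / real n) = of_int i * 2 * pi"
      using cos_one_2pi_int by metis
    then have "real_of_int m = real_of_int (i * int n)" using assms(2) by (simp add: field_simps)
    then have "m = i * int n" by (simp only: of_int_eq_iff)
    then show False using assms(1) by simp
  qed
  then have "(\<Sum>j<n. z ^ j) = 0" using geometric_sum[of z n] zn by simp
  then show ?thesis by (simp add: pow)
qed

text \<open>Periods of both \<open>sin (2 \<pi> \<langle>l, x\<rangle>)\<close> and \<open>sin (2 \<pi> \<langle>quarter_turn l, x\<rangle>)\<close>: at these points the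
  phase of \<open>l\<close> is \<open>j\<close> and that of its quarter turn is \<open>k\<close>.\<close>

definition dual_point :: "nat \<Rightarrow> int \<times> int \<Rightarrow> nat \<Rightarrow> nat \<Rightarrow> real \<times> real" where
  "dual_point n l j k = ((real j * of_int (fst l) - real k * of_int (snd l)) / real n,
                         (real j * of_int (snd l) + real k * of_int (fst l)) / real n)"

lemma phase_dual_point:
  "phase v (dual_point n l j k) =
     real j * of_int (iprod l v) / real n + real k * of_int (iprod (quarter_turn l) v) / real n"
  by (cases "n = 0") (simp_all add: dual_point_def quarter_turn_def field_simps)

lemma phase_dual_point_self:
  assumes "l \<in> Freq n" "n > 0"
  shows "phase l (dual_point n l j k) = real j"
    and "phase (quarter_turn l) (dual_point n l j k) = real k"
proof -
  have "fst l * fst l + snd l * snd l = int n"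
    using assms(1) by (simp add: Freq_def power2_eq_square)
  then have *: "iprod l l = int n" "iprod (quarter_turn l) (quarter_turn l) = int n"
    by (auto simp: quarter_turn_def algebra_simps)
  have **: "iprod (quarter_turn l) l = 0" "iprod l (quarter_turn l) = 0"
    by (auto simp: quarter_turn_def)
  show "phase l (dual_point n l j k) = real j"
    unfolding phase_dual_point * ** using assms(2) by simp
  show "phase (quarter_turn l) (dual_point n l j k) = real k"
    unfolding phase_dual_point * ** using assms(2) by simp
qed

lemma norm_sum_e_freq_dual_le:
  assumes "n > 0"
  shows "norm (\<Sum>j<n. \<Sum>k<n. e_freq v (dual_point n l j k)) \<le>
    (if int n dvd iprod l v \<and> int n dvd iprod (quarter_turn l) v then (real n)\<^sup>2 else 0)"
proof -
  define c where "c m = (\<Sum>j<n. cis (2 * pi * (real j * of_int m / real n)))" for m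
  have eq: "(\<Sum>j<n. \<Sum>k<n. e_freq v (dual_point n l j k)) =
      c (iprod l v) * c (iprod (quarter_turn l) v)"
    unfolding c_def sum_product e_freq_cis cis_mult phase_dual_point
    by (simp add: distrib_left)
  have le: "norm (c m) \<le> real n" for m
    unfolding c_def by (rule order.trans[OF norm_sum]) simp
  have zero: "c m = 0" if "\<not> int n dvd m" for m
    unfolding c_def by (rule sum_roots_of_unity_eq_0[OF that assms])
  have "norm (c m * c m') \<le> (real n)\<^sup>2" for m m'
    unfolding norm_mult power2_eq_square by (intro mult_mono le) auto
  then show ?thesis
    unfolding eq by (simp del: of_int_add of_int_mult) (use zero in blast)
qed

lemma abs_iprod_Freq_le:
  assumes "k \<in> Freq n" "l \<in> Freq n"
  shows "\<bar>iprod k l\<bar> \<le> int n"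
proof -
  have "(fst k)\<^sup>2 + (snd k)\<^sup>2 = int n" "(fst l)\<^sup>2 + (snd l)\<^sup>2 = int n"
    using assms by (auto simp: Freq_def)
  moreover have "2 * (a * b) \<le> a\<^sup>2 + b\<^sup>2" "- (2 * (a * b)) \<le> a\<^sup>2 + b\<^sup>2" for a b :: int
    using zero_le_power2[of "a - b"] zero_le_power2[of "a + b"]
    by (simp_all add: power2_eq_square algebra_simps)
  note this[of "fst k" "fst l"] this[of "snd k" "snd l"]
  ultimately show ?thesis by linarith
qed

text \<open>The sum of four frequencies has inner products of absolute value at most \<open>4 n\<close> with \<open>l\<close> and its
  quarter turn. If \<open>n\<close> divides both, the sum is one of \<open>9\<^sup>2\<close> integer combinations of \<open>l\<close> and its quarter
  turn, each of them attained by at most \<open>3 N\<^sup>2\<close> quadruples.\<close>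

lemma card_dual_quadruples:
  assumes "l \<in> Freq n" "n > 0"
  shows "card {q \<in> (Freq n \<times> Freq n) \<times> (Freq n \<times> Freq n).
      int n dvd iprod l (fst (fst q) + snd (fst q) + fst (snd q) + snd (snd q)) \<and>
      int n dvd iprod (quarter_turn l) (fst (fst q) + snd (fst q) + fst (snd q) + snd (snd q))}
    \<le> 243 * (card (Freq n))\<^sup>2" (is "card ?S \<le> _")
proof -
  let ?F = "Freq n"
  define Q where "Q v = {((l1, l2), (l3, l4)). l1 \<in> ?F \<and> l2 \<in> ?F \<and> l3 \<in> ?F \<and> l4 \<in> ?F \<and>
      l1 + l2 + l3 + l4 = v}" for v :: "int \<times> int"
  define I where "I = {-4..4::int} \<times> {-4..4::int}"
  define w where "w p = (fst p * fst l - snd p * snd l, fst p * snd l + snd p * fst l)" for p :: "int \<times> int"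
  have finQ: "finite (Q v)" for v
    by (rule finite_subset[of _ "(?F \<times> ?F) \<times> (?F \<times> ?F)"]) (auto simp: Q_def finite_Freq)
  have ql: "quarter_turn l \<in> ?F" using assms(1) by simp
  have sub: "?S \<subseteq> (\<Union>p\<in>I. Q (w p))"
  proof
    fix q assume q: "q \<in> ?S"
    obtain l1 l2 l3 l4 where qeq: "q = ((l1, l2), (l3, l4))" by (metis prod.exhaust)
    define v where "v = l1 + l2 + l3 + l4"
    have mem: "l1 \<in> ?F" "l2 \<in> ?F" "l3 \<in> ?F" "l4 \<in> ?F" using q qeq by auto
    obtain i j where i: "iprod l v = int n * i" and j: "iprod (quarter_turn l) v = int n * j"
      using q unfolding qeq v_def by (auto simp: dvd_def)
    have small: "\<bar>iprod k v\<bar> \<le> int n * 4" if "k \<in> ?F" for k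
    proof -
      have "iprod k v = iprod k l1 + iprod k l2 + iprod k l3 + iprod k l4"
        by (simp add: v_def algebra_simps)
      then show ?thesis
        using mem[THEN abs_iprod_Freq_le[OF that]] by linarith
    qed
    have "\<bar>int n * i\<bar> \<le> int n * 4" "\<bar>int n * j\<bar> \<le> int n * 4"
      using small[OF assms(1)] small[OF ql] i j by auto
    then have "\<bar>i\<bar> \<le> 4" "\<bar>j\<bar> \<le> 4" using assms(2) by (auto simp: abs_mult)
    then have ij: "(i, j) \<in> I" by (auto simp: I_def)
    have nl: "(fst l)\<^sup>2 + (snd l)\<^sup>2 = int n" using assms(1) by (simp add: Freq_def)
    have "int n * fst v = fst l * iprod l v - snd l * iprod (quarter_turn l) v"
      unfolding nl[symmetric] by (simp add: quarter_turn_def power2_eq_square algebra_simps)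
    also have "\<dots> = int n * fst (w (i, j))" unfolding i j by (simp add: w_def algebra_simps)
    finally have "fst v = fst (w (i, j))" using assms(2) by simp
    moreover have "int n * snd v = snd l * iprod l v + fst l * iprod (quarter_turn l) v"
      unfolding nl[symmetric] by (simp add: quarter_turn_def power2_eq_square algebra_simps)
    then have "int n * snd v = int n * snd (w (i, j))" unfolding i j by (simp add: w_def algebra_simps)
    then have "snd v = snd (w (i, j))" using assms(2) by simp
    ultimately have "v = w (i, j)" by (simp add: prod_eq_iff)
    then have "q \<in> Q (w (i, j))" using mem by (auto simp: Q_def qeq v_def)
    with ij show "q \<in> (\<Union>p\<in>I. Q (w p))" by blast
  qed
  have "card ?S \<le> card (\<Union>p\<in>I. Q (w p))"
    by (rule card_mono[OF _ sub]) (auto simp: I_def finQ)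
  also have "\<dots> \<le> (\<Sum>p\<in>I. card (Q (w p)))" by (rule card_UN_le) (simp add: I_def)
  also have "\<dots> \<le> (\<Sum>p\<in>I. 3 * (card ?F)\<^sup>2)"
    unfolding Q_def by (intro sum_mono card_quadruples)
  also have "\<dots> = 243 * (card ?F)\<^sup>2" by (simp add: I_def card_cartesian_product)
  finally show ?thesis .
qed

text \<open>Expanding the fourth power into quadruples of frequencies, the average over the points
  \<open>dual_point n l j k\<close> kills all the quadruples except those counted in \<open>card_dual_quadruples\<close>.\<close>

lemma dual_average_wave_cov_power4_le:
  assumes "l \<in> Freq n" "n > 0"
  shows "(\<Sum>j<n. \<Sum>k<n. wave_cov n (x + dual_point n l j k) ^ 4)
    \<le> 243 * (real n)\<^sup>2 / (real (card (Freq n)))\<^sup>2"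
proof -
  let ?F = "Freq n" let ?N = "real (card ?F)"
  let ?Q = "(?F \<times> ?F) \<times> (?F \<times> ?F)"
  define v where "v q = fst (fst q) + snd (fst q) + fst (snd q) + snd (snd q)" for q :: "((int\<times>int)\<times>(int\<times>int))\<times>((int\<times>int)\<times>(int\<times>int))"
  have N: "?N > 0" using assms finite_Freq by (auto simp: card_gt_0_iff)
  have pow4: "(\<Sum>k\<in>?F. e_freq k y) ^ 4 = (\<Sum>q\<in>?Q. e_freq (v q) y)" for y
  proof -
    have sq: "(\<Sum>k\<in>?F. e_freq k y)\<^sup>2 = (\<Sum>p\<in>?F\<times>?F. e_freq (fst p + snd p) y)"
      unfolding power2_eq_square sum_product sum.cartesian_product
      by (rule sum.cong) (auto simp: e_freq_add_left)
    have "(\<Sum>k\<in>?F. e_freq k y) ^ 4 = ((\<Sum>k\<in>?F. e_freq k y)\<^sup>2)\<^sup>2" by simp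
    also have "\<dots> = (\<Sum>q\<in>?Q. e_freq (v q) y)"
      unfolding sq unfolding power2_eq_square sum_product sum.cartesian_product
      by (rule sum.cong) (auto simp: e_freq_add_left v_def mult_ac)
    finally show ?thesis .
  qed
  let ?L = "\<Sum>j<n. \<Sum>k<n. wave_cov n (x + dual_point n l j k) ^ 4"
  have "complex_of_real (?L * ?N ^ 4) =
      (\<Sum>j<n. \<Sum>k<n. (\<Sum>m\<in>?F. e_freq m (x + dual_point n l j k)) ^ 4)"
    using N unfolding of_real_mult of_real_sum of_real_power wave_cov_complex
    by (simp add: sum_distrib_right power_divide)
  also have "\<dots> = (\<Sum>j<n. \<Sum>k<n. \<Sum>q\<in>?Q. e_freq (v q) x * e_freq (v q) (dual_point n l j k))"
    by (simp only: pow4) (simp only: e_freq_add_right)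
  also have "\<dots> = (\<Sum>q\<in>?Q. e_freq (v q) x * (\<Sum>j<n. \<Sum>k<n. e_freq (v q) (dual_point n l j k)))"
    by (simp only: sum_distrib_left sum.swap[of _ ?Q])
  finally have "norm (complex_of_real (?L * ?N ^ 4)) =
    norm (\<Sum>q\<in>?Q. e_freq (v q) x * (\<Sum>j<n. \<Sum>k<n. e_freq (v q) (dual_point n l j k)))" by simp
  also have "\<dots> \<le> (\<Sum>q\<in>?Q. norm (\<Sum>j<n. \<Sum>k<n. e_freq (v q) (dual_point n l j k)))"
    by (rule order.trans[OF norm_sum]) (simp add: norm_mult)
  also have "\<dots> \<le> (\<Sum>q\<in>?Q. if int n dvd iprod l (v q) \<and> int n dvd iprod (quarter_turn l) (v q) then (real n)\<^sup>2 else 0)"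
    by (intro sum_mono norm_sum_e_freq_dual_le assms)
  also have "\<dots> = (\<Sum>q\<in>{q\<in>?Q. int n dvd iprod l (v q) \<and> int n dvd iprod (quarter_turn l) (v q)}. (real n)\<^sup>2)"
    by (rule sum.inter_filter[symmetric]) (simp add: finite_Freq)
  also have "\<dots> = real (card {q\<in>?Q. int n dvd iprod l (v q) \<and> int n dvd iprod (quarter_turn l) (v q)}) * (real n)\<^sup>2"
    by simp
  also have "\<dots> \<le> real (243 * (card ?F)\<^sup>2) * (real n)\<^sup>2"
    using card_dual_quadruples[OF assms] unfolding v_def
    by (intro mult_right_mono) (simp_all only: of_nat_le_iff zero_le_power2)
  finally have "\<bar>?L * ?N ^ 4\<bar> \<le> 243 * ?N\<^sup>2 * (real n)\<^sup>2" by (simp only: norm_of_real) simp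
  then have "?L * ?N ^ 4 \<le> 243 * ?N\<^sup>2 * (real n)\<^sup>2" by linarith
  then have "?L * ?N\<^sup>2 * ?N\<^sup>2 \<le> 243 * (real n)\<^sup>2 * ?N\<^sup>2" by (simp add: power_def eval_nat_numeral mult_ac)
  then have "?L * ?N\<^sup>2 \<le> 243 * (real n)\<^sup>2" using N by (simp add: mult_le_cancel_right)
  then show ?thesis using N by (simp add: field_simps)
qed

section \<open>The torus\<close>

definition circle_measure :: "real measure" where
  "circle_measure = density lborel (indicator {0..<1})"

definition torus_measure :: "(real \<times> real) measure" where
  "torus_measure = density lborel (indicator torus)"

lemma sets_circle_measure [measurable_cong, simp]: "sets circle_measure = sets borel"
  and space_circle_measure [simp]: "space circle_measure = UNIV"
  by (simp_all add: circle_measure_def)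

lemma sets_torus_measure [measurable_cong, simp]: "sets torus_measure = sets borel"
  and space_torus_measure [simp]: "space torus_measure = UNIV"
  by (simp_all add: torus_measure_def)

lemma torus_measurable [measurable]: "torus \<in> sets borel"
  unfolding torus_def by (intro borel_Times) auto

interpretation circle: prob_space circle_measure
  by standard (simp add: circle_measure_def emeasure_density)

interpretation torus: pair_prob_space circle_measure circle_measure ..

lemma torus_measure_eq: "circle_measure \<Otimes>\<^sub>M circle_measure = torus_measure"
proof -
  have "circle_measure \<Otimes>\<^sub>M circle_measure =
      density (lborel \<Otimes>\<^sub>M lborel) (\<lambda>(x, y). indicator {0..<1::real} x * indicator {0..<1::real} y)"
    unfolding circle_measure_def
    by (rule pair_measure_density)
       (auto simp: lborel.sigma_finite_measure_axioms circle_measure_def[symmetric]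
          circle.sigma_finite_measure_axioms)
  also have "\<dots> = torus_measure"
    unfolding lborel_prod torus_measure_def torus_def
    by (rule arg_cong[where f = "density lborel"]) (auto simp: indicator_def)
  finally show ?thesis .
qed

interpretation torus_measure: prob_space torus_measure
  unfolding torus_measure_eq[symmetric] by (rule torus.prob_space_axioms)

lemma nn_integral_torus_iterated:
  assumes "F \<in> borel_measurable borel"
  shows "(\<integral>\<^sup>+x. F x \<partial>torus_measure) = (\<integral>\<^sup>+u. \<integral>\<^sup>+v. F (u, v) \<partial>circle_measure \<partial>circle_measure)"
proof -
  have "F \<in> borel_measurable (circle_measure \<Otimes>\<^sub>M circle_measure)"
    using assms unfolding torus_measure_eq by simp
  then show ?thesis unfolding torus_measure_eq[symmetric]
    by (rule circle.nn_integral_fst[symmetric])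
qed

lemma nn_integral_circle_shift:
  assumes [measurable]: "f \<in> borel_measurable borel" and per: "\<And>x k::int. f (x + of_int k) = f x"
  shows "(\<integral>\<^sup>+x. f (x + z) \<partial>circle_measure) = (\<integral>\<^sup>+x. f x \<partial>circle_measure)"
proof -
  define w where "w = frac z"
  have w: "0 \<le> w" "w < 1" by (simp_all add: w_def frac_lt_1)
  have "f (x + z) = f (x + w)" for x
    using per[of "x + w" "\<lfloor>z\<rfloor>"] by (simp add: w_def frac_def)
  then have "(\<integral>\<^sup>+x. f (x + z) \<partial>circle_measure) = (\<integral>\<^sup>+x. indicator {0..<1} x * f (x + w) \<partial>lborel)"
    by (simp add: circle_measure_def nn_integral_density)
  also have "\<dots> = (\<integral>\<^sup>+x. indicator {w..<1+w} x * f x \<partial>lborel)"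
    by (subst nn_integral_real_affine[where c = 1 and t = "-w"]) (auto intro!: nn_integral_cong simp: indicator_def)
  also have "\<dots> = (\<integral>\<^sup>+x. indicator {w..<1} x * f x + indicator {1..<1+w} x * f x \<partial>lborel)"
    using w by (intro nn_integral_cong) (auto simp: indicator_def)
  also have "\<dots> = (\<integral>\<^sup>+x. indicator {w..<1} x * f x \<partial>lborel) + (\<integral>\<^sup>+x. indicator {1..<1+w} x * f x \<partial>lborel)"
    by (rule nn_integral_add) auto
  also have "(\<integral>\<^sup>+x. indicator {1..<1+w} x * f x \<partial>lborel) = (\<integral>\<^sup>+x. indicator {0..<w} x * f x \<partial>lborel)"
    using per[of _ 1]
    by (subst nn_integral_real_affine[where c = 1 and t = 1])
       (auto intro!: nn_integral_cong simp: indicator_def add.commute)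
  also have "(\<integral>\<^sup>+x. indicator {w..<1} x * f x \<partial>lborel) + (\<integral>\<^sup>+x. indicator {0..<w} x * f x \<partial>lborel)
      = (\<integral>\<^sup>+x. indicator {w..<1} x * f x + indicator {0..<w} x * f x \<partial>lborel)"
    by (rule nn_integral_add[symmetric]) auto
  also have "\<dots> = (\<integral>\<^sup>+x. indicator {0..<1} x * f x \<partial>lborel)"
    using w by (intro nn_integral_cong) (auto simp: indicator_def)
  finally show ?thesis by (simp add: circle_measure_def nn_integral_density)
qed

definition torus_periodic :: "(real \<times> real \<Rightarrow> 'b) \<Rightarrow> bool" where
  "torus_periodic F \<longleftrightarrow> (\<forall>x (j::int) (k::int). F (x + (of_int j, of_int k)) = F x)"

lemma nn_integral_torus_shift:
  assumes [measurable]: "F \<in> borel_measurable borel" and per: "torus_periodic F"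
  shows "(\<integral>\<^sup>+x. F (x + z) \<partial>torus_measure) = (\<integral>\<^sup>+x. F x \<partial>torus_measure)"
proof -
  have per1: "F (a + of_int k, b) = F (a, b)" for a b and k :: int
    using per[unfolded torus_periodic_def, rule_format, of "(a, b)" k 0] by simp
  have per2: "F (a, b + of_int k) = F (a, b)" for a b and k :: int
    using per[unfolded torus_periodic_def, rule_format, of "(a, b)" 0 k] by simp
  have [measurable]: "(\<lambda>x. F (fst x, snd x)) \<in> borel_measurable (borel \<Otimes>\<^sub>M borel)"
    by (simp add: borel_prod)
  obtain p q where z: "z = (p, q)" by (cases z)
  have "sets (borel \<Otimes>\<^sub>M circle_measure) = sets (borel :: (real \<times> real) measure)"
    unfolding borel_prod[symmetric] by (rule sets_pair_measure_cong) auto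
  then have [measurable]: "(\<lambda>u. \<integral>\<^sup>+v. F (u, v) \<partial>circle_measure) \<in> borel_measurable borel"
    by (intro circle.borel_measurable_nn_integral) (simp add: split_def cong: measurable_cong_sets)
  have "(\<integral>\<^sup>+x. F (x + z) \<partial>torus_measure) =
      (\<integral>\<^sup>+u. \<integral>\<^sup>+v. F (u + p, v + q) \<partial>circle_measure \<partial>circle_measure)"
    by (subst nn_integral_torus_iterated) (auto simp: z)
  also have "\<dots> = (\<integral>\<^sup>+u. \<integral>\<^sup>+v. F (u + p, v) \<partial>circle_measure \<partial>circle_measure)"
  proof (rule nn_integral_cong)
    fix u
    show "(\<integral>\<^sup>+v. F (u + p, v + q) \<partial>circle_measure) = (\<integral>\<^sup>+v. F (u + p, v) \<partial>circle_measure)"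
      by (rule nn_integral_circle_shift[where f = "\<lambda>v. F (u + p, v)"]) (auto simp: per2)
  qed
  also have "\<dots> = (\<integral>\<^sup>+u. \<integral>\<^sup>+v. F (u, v) \<partial>circle_measure \<partial>circle_measure)"
    by (rule nn_integral_circle_shift[where f = "\<lambda>u. \<integral>\<^sup>+v. F (u, v) \<partial>circle_measure"]) (auto simp: per1)
  finally show ?thesis by (simp add: nn_integral_torus_iterated)
qed

text \<open>The coordinates of \<open>x\<close> along \<open>l\<close> and its quarter turn, up to the factor \<open>\<bar>l\<bar>\<close>.\<close>

definition frame :: "int \<times> int \<Rightarrow> real \<times> real \<Rightarrow> real \<times> real" where
  "frame l x = (phase l x, phase (quarter_turn l) x)"

lemma frame_add: "frame l (x + y) = frame l x + frame l y"
  by (simp add: frame_def algebra_simps)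

lemma frame_measurable [measurable]: "frame l \<in> borel_measurable borel"
  unfolding frame_def by (intro borel_measurable_continuous_onI continuous_intros)

lemma frame_surj:
  assumes "l \<in> Freq n" "n > 0" shows "\<exists>y. frame l y = z"
proof
  define p q where "p = fst z" and "q = snd z"
  have z: "z = (p, q)" by (simp add: p_def q_def)
  have nl: "real_of_int (fst l) * of_int (fst l) + of_int (snd l) * of_int (snd l) = real n"
    using assms(1) by (simp add: Freq_def power2_eq_square flip: of_int_mult of_int_add)
  let ?y = "((p * of_int (fst l) - q * of_int (snd l)) / real n, (p * of_int (snd l) + q * of_int (fst l)) / real n)"
  have "real n * fst (frame l ?y) = (of_int (fst l) * of_int (fst l) + of_int (snd l) * of_int (snd l)) * p"
    "real n * snd (frame l ?y) = (of_int (fst l) * of_int (fst l) + of_int (snd l) * of_int (snd l)) * q"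
    using assms(2) by (simp_all add: frame_def quarter_turn_def field_simps)
  then show "frame l ?y = z" unfolding nl using assms(2) by (simp add: z prod_eq_iff)
qed

lemma torus_periodic_frame: "torus_periodic F \<Longrightarrow> torus_periodic (\<lambda>x. F (frame l x))"
proof -
  assume F: "torus_periodic F"
  have "frame l (x + (of_int j, of_int k)) = frame l x +
      (of_int (fst l * j + snd l * k), of_int (- snd l * j + fst l * k))" for x j k
    by (simp add: frame_def quarter_turn_def algebra_simps)
  then have "F (frame l (x + (of_int j, of_int k))) = F (frame l x)" for x j k
    using F unfolding torus_periodic_def by metis
  then show ?thesis unfolding torus_periodic_def by blast
qed

text \<open>Since \<open>frame l\<close> is onto, translating its argument realises every translation of its
  value; averaging over all of them leaves the mean of \<open>F\<close>.\<close>

lemma nn_integral_torus_frame: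
  assumes [measurable]: "F \<in> borel_measurable borel" and per: "torus_periodic F"
    and l: "l \<in> Freq n" "n > 0"
  shows "(\<integral>\<^sup>+x. F (frame l x) \<partial>torus_measure) = (\<integral>\<^sup>+x. F x \<partial>torus_measure)"
proof -
  interpret TT: pair_prob_space torus_measure torus_measure ..
  have [measurable]: "(\<lambda>(x, z). F (frame l x + z)) \<in> borel_measurable (torus_measure \<Otimes>\<^sub>M torus_measure)"
    by measurable
  have shift: "(\<integral>\<^sup>+x. F (frame l x + z) \<partial>torus_measure) = (\<integral>\<^sup>+x. F (frame l x) \<partial>torus_measure)" for z
  proof -
    obtain y where "frame l y = z" using frame_surj[OF l] by blast
    then have "(\<integral>\<^sup>+x. F (frame l x + z) \<partial>torus_measure) = (\<integral>\<^sup>+x. F (frame l (x + y)) \<partial>torus_measure)"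
      by (simp add: frame_add)
    also have "\<dots> = (\<integral>\<^sup>+x. F (frame l x) \<partial>torus_measure)"
      by (rule nn_integral_torus_shift) (auto intro: torus_periodic_frame per)
    finally show ?thesis .
  qed
  have "(\<integral>\<^sup>+x. F (frame l x) \<partial>torus_measure) =
      (\<integral>\<^sup>+z. \<integral>\<^sup>+x. F (frame l x + z) \<partial>torus_measure \<partial>torus_measure)"
    using torus_measure.emeasure_space_1 by (simp add: shift)
  also have "\<dots> = (\<integral>\<^sup>+x. \<integral>\<^sup>+z. F (frame l x + z) \<partial>torus_measure \<partial>torus_measure)"
    by (rule TT.Fubini') (simp add: split_def)
  also have "\<dots> = (\<integral>\<^sup>+x. \<integral>\<^sup>+z. F z \<partial>torus_measure \<partial>torus_measure)"
    unfolding add.commute[of "frame l _"] nn_integral_torus_shift[OF assms(1) per] ..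
  finally show ?thesis using torus_measure.emeasure_space_1 by simp
qed

section \<open>The singular integral\<close>

lemma abs_sin_ge_dist:
  assumes "0 \<le> d" "d \<le> 1/4" shows "d \<le> sin (2 * pi * d)"
proof -
  have le: "pi * d \<le> pi / 3" using assms(2) pi_gt_zero by (simp add: field_simps)
  have cosge: "1/2 \<le> cos t" if "0 \<le> t" "t \<le> pi/3" for t
    using cos_monotone_0_pi_le[OF that] cos_60 pi_gt_zero by auto
  have "sin 0 - 0 / 2 \<le> sin (pi * d) - (pi * d) / 2"
  proof (rule DERIV_nonneg_imp_nondecreasing[where f = "\<lambda>t. sin t - t / 2"])
    show "0 \<le> pi * d" using assms(1) pi_gt_zero by simp
    fix t assume t: "0 \<le> t" "t \<le> pi * d"
    have "((\<lambda>t. sin t - t / 2) has_real_derivative (cos t - 1/2)) (at t)"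
      by (auto intro!: derivative_eq_intros)
    moreover have "0 \<le> cos t - 1/2" using cosge[of t] t le by auto
    ultimately show "\<exists>y. ((\<lambda>t. sin t - t / 2) has_real_derivative y) (at t) \<and> 0 \<le> y" by blast
  qed
  then have s: "pi * d / 2 \<le> sin (pi * d)" by simp
  have c: "1/2 \<le> cos (pi * d)" using cosge[of "pi * d"] le assms(1) pi_gt_zero by auto
  have "2 * d \<le> pi * d" using pi_gt3 assms(1) by (intro mult_right_mono) auto
  then have "d \<le> sin (pi * d)" using s by simp
  moreover have "sin (pi * d) * 1 \<le> sin (pi * d) * (2 * cos (pi * d))"
    using c \<open>d \<le> sin (pi * d)\<close> assms(1) by (intro mult_left_mono) auto
  moreover have "sin (2 * pi * d) = 2 * sin (pi * d) * cos (pi * d)"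
    using sin_double[of "pi * d"] by (simp add: mult.assoc)
  ultimately show ?thesis by simp
qed

lemma nn_integral_inverse_sqrt_abs_finite:
  "(\<integral>\<^sup>+u. ennreal (1 / sqrt \<bar>u - c\<bar>) * indicator {c - 1..c + 1} u \<partial>lborel) < \<infinity>"
proof -
  have *: "(\<integral>\<^sup>+u. ennreal (1 / sqrt \<bar>u\<bar>) * indicator {0..1} u \<partial>lborel) = 2"
  proof -
    have "((\<lambda>x. x powr (-1/2)) has_integral (1 powr ((-1/2)+1) / ((-1/2)+1))) {0..1::real}"
      by (rule has_integral_powr_from_0) auto
    then have "(\<integral>\<^sup>+u. ennreal (u powr (-1/2)) * indicator {0..1} u \<partial>lborel) = ennreal 2"
      by (subst nn_integral_has_integral_lebesgue') auto
    also have "(\<integral>\<^sup>+u. ennreal (u powr (-1/2)) * indicator {0..1} u \<partial>lborel) =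
        (\<integral>\<^sup>+u. ennreal (1 / sqrt \<bar>u\<bar>) * indicator {0..1} u \<partial>lborel)"
    proof (rule nn_integral_cong)
      fix u :: real
      have "u powr (-1/2) = 1 / sqrt u" if "0 \<le> u"
        using powr_minus_divide[of u "1/2"] powr_half_sqrt[OF that] by simp
      then show "ennreal (u powr (-1/2)) * indicator {0..1} u = ennreal (1 / sqrt \<bar>u\<bar>) * indicator {0..1} u"
        by (cases "u \<in> {0..1}") auto
    qed
    finally show ?thesis by simp
  qed
  have "(\<integral>\<^sup>+u. ennreal (1 / sqrt \<bar>u - c\<bar>) * indicator {c - 1..c + 1} u \<partial>lborel)
    = (\<integral>\<^sup>+u. ennreal (1 / sqrt \<bar>u\<bar>) * indicator {-1..1} u \<partial>lborel)"
    by (subst nn_integral_real_affine[where c = 1 and t = c]) (auto intro!: nn_integral_cong simp: indicator_def)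
  also have "\<dots> \<le> (\<integral>\<^sup>+u. ennreal (1 / sqrt \<bar>u\<bar>) * indicator {0..1} u
       + ennreal (1 / sqrt \<bar>u\<bar>) * indicator {-1..0} u \<partial>lborel)"
    by (rule nn_integral_mono) (auto simp: indicator_def)
  also have "\<dots> = 2 + (\<integral>\<^sup>+u. ennreal (1 / sqrt \<bar>u\<bar>) * indicator {-1..0} u \<partial>lborel)"
    by (subst nn_integral_add) (auto simp: *)
  also have "(\<integral>\<^sup>+u. ennreal (1 / sqrt \<bar>u\<bar>) * indicator {-1..0} u \<partial>lborel) =
     (\<integral>\<^sup>+u. ennreal (1 / sqrt \<bar>u\<bar>) * indicator {0..1} u \<partial>lborel)"
    by (subst nn_integral_real_affine[where c = "-1" and t = 0]) (auto intro!: nn_integral_cong simp: indicator_def)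
  also have "\<dots> = 2" by (rule *)
  finally show ?thesis by (simp add: order.strict_trans1)
qed

lemma sin_integral_finite:
  "(\<integral>\<^sup>+u. ennreal (1 / sqrt \<bar>sin (2 * pi * u)\<bar>) \<partial>circle_measure) < \<infinity>"
proof -
  define h where "h c u = ennreal (1 / sqrt \<bar>u - c\<bar>) * indicator {c - 1..c + 1} u" for c u :: real
  have [measurable]: "h c \<in> borel_measurable borel" for c unfolding h_def by measurable
  have fin: "(\<integral>\<^sup>+u. h c u \<partial>lborel) < \<infinity>" for c
    unfolding h_def by (rule nn_integral_inverse_sqrt_abs_finite)
  have pt: "indicator {0..<1} u * ennreal (1 / sqrt \<bar>sin (2 * pi * u)\<bar>) \<le> h 0 u + (h (1/2) u + h 1 u)"
    (is "?l \<le> _") for u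
  proof (cases "u \<in> {0..<1}")
    case True
    have key: "?l \<le> h c u" if c: "\<bar>u - c\<bar> \<le> 1/4" "\<bar>sin (2 * pi * u)\<bar> = \<bar>sin (2 * pi * (u - c))\<bar>" for c
    proof -
      have "\<bar>u - c\<bar> \<le> sin (2 * pi * \<bar>u - c\<bar>)" using c(1) by (intro abs_sin_ge_dist) auto
      also have "\<dots> \<le> \<bar>sin (2 * pi * (u - c))\<bar>"
      proof (cases "u \<ge> c")
        case False
        then have "2 * pi * \<bar>u - c\<bar> = - (2 * pi * (u - c))" by (simp add: algebra_simps)
        then show ?thesis by (simp only: sin_minus)
      qed simp
      finally have le: "\<bar>u - c\<bar> \<le> \<bar>sin (2 * pi * u)\<bar>" using c(2) by simp
      have "1 / sqrt \<bar>sin (2 * pi * u)\<bar> \<le> 1 / sqrt \<bar>u - c\<bar>"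
      proof (cases "u = c")
        case False
        then show ?thesis using le by (intro divide_left_mono) auto
      next
        case True
        then show ?thesis using c(2) by simp
      qed
      then show ?thesis using c(1) \<open>u \<in> {0..<1}\<close> by (auto simp: h_def indicator_def intro!: ennreal_leI)
    qed
    have s1: "\<bar>sin (2 * pi * u)\<bar> = \<bar>sin (2 * pi * (u - 1/2))\<bar>"
      by (simp add: sin_diff right_diff_distrib)
    have s2: "\<bar>sin (2 * pi * u)\<bar> = \<bar>sin (2 * pi * (u - 1))\<bar>"
      by (simp add: sin_diff right_diff_distrib)
    consider "\<bar>u - 0\<bar> \<le> 1/4" | "\<bar>u - 1/2\<bar> \<le> 1/4" | "\<bar>u - 1\<bar> \<le> 1/4"
      using True unfolding atLeastLessThan_iff by linarith
    then show ?thesis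
    proof cases
      case 1
      have "?l \<le> h 0 u" by (rule key[OF 1]) simp
      also have "\<dots> \<le> h 0 u + (h (1/2) u + h 1 u)" by simp
      finally show ?thesis .
    next
      case 2
      have "?l \<le> h (1/2) u" by (rule key[OF 2 s1])
      also have "\<dots> \<le> h 0 u + (h (1/2) u + h 1 u)" by (simp add: add_increasing)
      finally show ?thesis .
    next
      case 3
      have "?l \<le> h 1 u" by (rule key[OF 3 s2])
      also have "\<dots> \<le> h 0 u + (h (1/2) u + h 1 u)" by (simp add: add_increasing)
      finally show ?thesis .
    qed
  qed simp
  have "(\<integral>\<^sup>+u. ennreal (1 / sqrt \<bar>sin (2 * pi * u)\<bar>) \<partial>circle_measure) \<le>
      (\<integral>\<^sup>+u. h 0 u + (h (1/2) u + h 1 u) \<partial>lborel)"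
    unfolding circle_measure_def by (subst nn_integral_density) (auto intro!: nn_integral_mono pt)
  also have "\<dots> = (\<integral>\<^sup>+u. h 0 u \<partial>lborel) + ((\<integral>\<^sup>+u. h (1/2) u \<partial>lborel) + (\<integral>\<^sup>+u. h 1 u \<partial>lborel))"
    by (simp add: nn_integral_add)
  also have "\<dots> < \<infinity>"
    using fin[of 0] fin[of "1/2"] fin[of 1] by (simp add: ennreal_add_eq_top less_top)
  finally show ?thesis .
qed

lemma quarter_turn_twice [simp]: "quarter_turn (quarter_turn l) = - l"
  by (simp add: quarter_turn_def prod_eq_iff)

lemma quarter_turn_uminus [simp]: "quarter_turn (- l) = - quarter_turn l"
  by (simp add: quarter_turn_def)

lemma inverse_sqrt_mean_le:
  fixes u :: "'b \<Rightarrow> real"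
  assumes "finite A" "A \<noteq> {}" and pos: "\<And>i. i \<in> A \<Longrightarrow> u i > 0"
  shows "1 / sqrt ((\<Sum>i\<in>A. u i) / card A) \<le> (\<Sum>i\<in>A. 1 / sqrt (u i)) / card A"
proof -
  define m where "m = (\<Sum>i\<in>A. u i) / card A"
  have cA: "real (card A) > 0" using assms(1,2) by (simp add: card_gt_0_iff)
  have m: "m > 0" unfolding m_def by (intro divide_pos_pos sum_pos assms cA)
  have tangent: "1 / sqrt m - (u i - m) / (2 * m * sqrt m) \<le> 1 / sqrt (u i)" if i: "i \<in> A" for i
  proof -
    define a b where "a = sqrt (u i)" and "b = sqrt m"
    have ab: "a > 0" "b > 0" "u i = a\<^sup>2" "m = b\<^sup>2"
      using pos[OF i] m by (auto simp: a_def b_def)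
    have "0 \<le> (a - b)\<^sup>2 * (a + 2 * b)" using ab by simp
    then have "3 * a * b\<^sup>2 - a ^ 3 \<le> 2 * b ^ 3"
      by (simp add: power2_eq_square power3_eq_cube algebra_simps)
    then have "(3 * a * b\<^sup>2 - a ^ 3) / (2 * a * b ^ 3) \<le> 2 * b ^ 3 / (2 * a * b ^ 3)"
      using ab by (intro divide_right_mono) auto
    moreover have "(3 * a * b\<^sup>2 - a ^ 3) / (2 * a * b ^ 3) = 1 / b - (a\<^sup>2 - b\<^sup>2) / (2 * b\<^sup>2 * b)"
      using ab by (simp add: field_simps power2_eq_square power3_eq_cube)
    moreover have "2 * b ^ 3 / (2 * a * b ^ 3) = 1 / a" using ab by simp
    ultimately show ?thesis unfolding ab(3,4) using ab(1,2) by simp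
  qed
  have "(\<Sum>i\<in>A. 1 / sqrt m - (u i - m) / (2 * m * sqrt m)) \<le> (\<Sum>i\<in>A. 1 / sqrt (u i))"
    by (intro sum_mono tangent)
  moreover have "(\<Sum>i\<in>A. u i - m) = 0"
    using cA by (simp add: sum_subtractf m_def)
  then have "(\<Sum>i\<in>A. 1 / sqrt m - (u i - m) / (2 * m * sqrt m)) = card A * (1 / sqrt m)"
    by (simp add: sum_subtractf sum_divide_distrib[symmetric])
  ultimately show ?thesis unfolding m_def[symmetric] using cA by (simp add: field_simps)
qed

abbreviation freq_sin :: "int \<times> int \<Rightarrow> real \<times> real \<Rightarrow> real" where
  "freq_sin l x \<equiv> sin (2 * pi * phase l x)"

lemma wave_cov_le_1: "\<bar>wave_cov n x\<bar> \<le> 1"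
proof -
  have "\<bar>\<Sum>l\<in>Freq n. cos (2 * pi * phase l x)\<bar> \<le> (\<Sum>l\<in>Freq n. \<bar>cos (2 * pi * phase l x)\<bar>)"
    by (rule sum_abs)
  also have "\<dots> \<le> (\<Sum>l\<in>Freq n. 1)" by (intro sum_mono) simp
  finally show ?thesis by (auto simp: wave_cov_def divide_le_eq abs_divide)
qed

text \<open>Cauchy--Schwarz bounds \<open>1 - r\<^sup>2\<close> from below by a mean of squared sines; pairing each
  frequency with its quarter turn turns them into products of sines of independent phases,
  whose inverse square roots are integrable.\<close>

lemma one_minus_wave_cov_sq_ge:
  assumes "Freq n \<noteq> {}"
  shows "(\<Sum>l\<in>Freq n. \<bar>freq_sin l x * freq_sin (quarter_turn l) x\<bar>) / real (card (Freq n))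
    \<le> 1 - (wave_cov n x)\<^sup>2"
proof -
  let ?F = "Freq n" let ?N = "real (card ?F)"
  have N: "?N > 0" using assms finite_Freq by (simp add: card_gt_0_iff)
  have "(\<Sum>l\<in>?F. cos (2 * pi * phase l x) * 1)\<^sup>2 \<le> (\<Sum>l\<in>?F. (cos (2 * pi * phase l x))\<^sup>2) * (\<Sum>l\<in>?F. 1\<^sup>2)"
    by (rule Cauchy_Schwarz_ineq_sum)
  then have "(wave_cov n x)\<^sup>2 \<le> (\<Sum>l\<in>?F. (cos (2 * pi * phase l x))\<^sup>2) / ?N"
    using N by (simp add: wave_cov_def power_divide field_simps power2_eq_square)
  also have "(\<Sum>l\<in>?F. (cos (2 * pi * phase l x))\<^sup>2) = ?N - (\<Sum>l\<in>?F. (freq_sin l x)\<^sup>2)"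
    by (simp add: cos_squared_eq sum_subtractf)
  finally have "(\<Sum>l\<in>?F. (freq_sin l x)\<^sup>2) / ?N \<le> 1 - (wave_cov n x)\<^sup>2"
    using N by (simp add: diff_divide_distrib)
  note lower = this
  have rot: "(\<Sum>l\<in>?F. (freq_sin (quarter_turn l) x)\<^sup>2) = (\<Sum>l\<in>?F. (freq_sin l x)\<^sup>2)"
    by (rule sum.reindex_bij_witness[of _ "\<lambda>l. - quarter_turn l" quarter_turn]) auto
  have "(\<Sum>l\<in>?F. \<bar>freq_sin l x * freq_sin (quarter_turn l) x\<bar>) \<le>
      (\<Sum>l\<in>?F. ((freq_sin l x)\<^sup>2 + (freq_sin (quarter_turn l) x)\<^sup>2) / 2)"
    by (intro sum_mono abs_mult_le_mean_squares)
  also have "\<dots> = (\<Sum>l\<in>?F. (freq_sin l x)\<^sup>2)"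
    unfolding sum_divide_distrib[symmetric] sum.distrib rot by simp
  finally have "(\<Sum>l\<in>?F. \<bar>freq_sin l x * freq_sin (quarter_turn l) x\<bar>) / ?N \<le> (\<Sum>l\<in>?F. (freq_sin l x)\<^sup>2) / ?N"
    using N by (intro divide_right_mono) auto
  with lower show ?thesis by linarith
qed

definition inv_sin :: "real \<times> real \<Rightarrow> real" where
  "inv_sin x = 1 / sqrt \<bar>sin (2 * pi * fst x) * sin (2 * pi * snd x)\<bar>"

lemma inv_sin_measurable [measurable]: "inv_sin \<in> borel_measurable borel"
proof -
  have [measurable]: "(\<lambda>x::real\<times>real. sin (2 * pi * fst x) * sin (2 * pi * snd x)) \<in> borel_measurable borel"
    by (intro borel_measurable_continuous_onI continuous_intros)
  show ?thesis unfolding inv_sin_def by measurable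
qed

lemma sin_add_of_int: "\<bar>sin (2 * pi * (u + of_int j))\<bar> = \<bar>sin (2 * pi * u)\<bar>"
proof -
  have "2 * pi * (u + of_int j) = 2 * pi * u + 2 * pi * of_int j" by (simp add: distrib_left)
  then show ?thesis by (simp only: sin_add cos_int_2pin sin_int_2pin mult_1_right mult_zero_right add_0_right)
qed

lemma inv_sin_periodic: "torus_periodic inv_sin"
  unfolding torus_periodic_def inv_sin_def abs_mult
  by (simp only: fst_add snd_add fst_conv snd_conv sin_add_of_int) auto

lemma inv_sin_integral_finite: "(\<integral>\<^sup>+x. ennreal (inv_sin x) \<partial>torus_measure) < \<infinity>"
proof -
  let ?h = "\<lambda>u. ennreal (1 / sqrt \<bar>sin (2 * pi * u)\<bar>)"
  have "inv_sin (u, v) = 1 / sqrt \<bar>sin (2 * pi * u)\<bar> * (1 / sqrt \<bar>sin (2 * pi * v)\<bar>)" for u v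
    by (simp add: inv_sin_def abs_mult real_sqrt_mult)
  then have "ennreal (inv_sin (u, v)) = ?h u * ?h v" for u v
    by (simp only:) (rule ennreal_mult, auto)
  then have "(\<integral>\<^sup>+x. ennreal (inv_sin x) \<partial>torus_measure) =
      (\<integral>\<^sup>+u. ?h u \<partial>circle_measure) * (\<integral>\<^sup>+u. ?h u \<partial>circle_measure)"
    by (subst nn_integral_torus_iterated) (simp_all add: nn_integral_cmult nn_integral_multc)
  then show ?thesis using sin_integral_finite by (simp add: ennreal_mult_less_top)
qed

lemma AE_sin_frequency_nonzero:
  assumes l: "l \<in> Freq n" "n > 0"
  shows "AE x in torus_measure. freq_sin l x \<noteq> 0"
proof -
  define F :: "real \<times> real \<Rightarrow> ennreal" where "F x = of_bool (sin (2 * pi * fst x) = 0)" for x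
  have [measurable]: "(\<lambda>x::real\<times>real. sin (2 * pi * fst x)) \<in> borel_measurable borel"
    by (intro borel_measurable_continuous_onI continuous_intros)
  have [measurable]: "F \<in> borel_measurable borel" unfolding F_def of_bool_def by measurable
  have perF: "torus_periodic F"
  proof -
    have "sin (2 * pi * (u + of_int j)) = 0 \<longleftrightarrow> sin (2 * pi * u) = 0" for u and j :: int
      using sin_add_of_int[of u j] by (metis abs_eq_0)
    then show ?thesis unfolding torus_periodic_def F_def by simp
  qed
  have "AE u in circle_measure. sin (2 * pi * u) \<noteq> 0"
  proof -
    have "{u \<in> {0..<1}. sin (2 * pi * u) = 0} \<subseteq> {0, 1/2}"
    proof safe
      fix u :: real assume u: "u \<in> {0..<1}" "sin (2 * pi * u) = 0" "u \<noteq> 0"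
      from u(2) obtain i :: int where "2 * pi * u = of_int i * pi" using sin_zero_iff_int2 by blast
      then have i: "2 * u = of_int i" using pi_gt_zero by simp
      then have "0 < i" "i < 2" using u(1,3) by auto
      then have "i = 1" by simp
      then show "u = 1/2" using i by simp
    qed
    moreover have "{0, 1/2::real} \<in> null_sets lborel" by (intro finite_imp_null_set_lborel) simp
    ultimately have "AE u in lborel. \<not> (u \<in> {0..<1} \<and> sin (2 * pi * u) = 0)"
      by (intro AE_I'[where N = "{0, 1/2::real}"]) auto
    then show ?thesis unfolding circle_measure_def by (subst AE_density) (auto simp: indicator_def)
  qed
  then have "(\<integral>\<^sup>+u. \<integral>\<^sup>+v. F (u, v) \<partial>circle_measure \<partial>circle_measure) = (\<integral>\<^sup>+u. 0 \<partial>circle_measure)"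
    using circle.emeasure_space_1 by (intro nn_integral_cong_AE) (auto elim!: eventually_mono simp: F_def)
  then have "(\<integral>\<^sup>+x. F x \<partial>torus_measure) = 0" by (simp add: nn_integral_torus_iterated)
  then have "(\<integral>\<^sup>+x. F (frame l x) \<partial>torus_measure) = 0"
    using nn_integral_torus_frame[OF _ perF l] by simp
  then have "AE x in torus_measure. F (frame l x) = 0" by (simp add: nn_integral_0_iff_AE)
  then show ?thesis by (auto simp: F_def frame_def)
qed

lemma wave_cov_measurable [measurable]: "wave_cov n \<in> borel_measurable borel"
  unfolding wave_cov_def divide_inverse by (intro borel_measurable_continuous_onI continuous_intros)

lemma wave_cov_periodic: "torus_periodic (wave_cov n)"
proof -
  have "cos (2 * pi * phase l (x + (of_int j, of_int k))) = cos (2 * pi * phase l x)" for l x j k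
  proof -
    have "2 * pi * phase l (x + (of_int j, of_int k)) = 2 * pi * phase l x + 2 * pi * of_int (fst l * j + snd l * k)"
      by (simp add: algebra_simps)
    then show ?thesis by (simp only: cos_add cos_int_2pin sin_int_2pin mult_1_right mult_zero_right diff_0_right)
  qed
  then show ?thesis unfolding torus_periodic_def wave_cov_def by simp
qed

text \<open>The weight is invariant under the points \<open>dual_point n l j k\<close>, so that the fourth power
  may be replaced by its average over them.\<close>

lemma wave_cov_power4_weighted_le:
  assumes l: "l \<in> Freq n" "n > 0"
  shows "(\<integral>\<^sup>+x. ennreal (wave_cov n x ^ 4 * inv_sin (frame l x)) \<partial>torus_measure)
    \<le> ennreal (243 / (real (card (Freq n)))\<^sup>2) * (\<integral>\<^sup>+x. ennreal (inv_sin x) \<partial>torus_measure)"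
    (is "?I \<le> ennreal ?c * ?J")
proof -
  have shift: "(\<integral>\<^sup>+x. ennreal (wave_cov n (x + dual_point n l j k) ^ 4 * inv_sin (frame l x)) \<partial>torus_measure) = ?I" for j k
  proof -
    have "frame l (x + dual_point n l j k) = frame l x + (of_int (int j), of_int (int k))" for x
      unfolding frame_add using phase_dual_point_self[OF l] by (simp add: frame_def)
    then have "inv_sin (frame l x) = inv_sin (frame l (x + dual_point n l j k))" for x
      using inv_sin_periodic[unfolded torus_periodic_def] by metis
    then have "(\<integral>\<^sup>+x. ennreal (wave_cov n (x + dual_point n l j k) ^ 4 * inv_sin (frame l x)) \<partial>torus_measure)
      = (\<integral>\<^sup>+x. ennreal (wave_cov n (x + dual_point n l j k) ^ 4 * inv_sin (frame l (x + dual_point n l j k))) \<partial>torus_measure)"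
      by simp
    also have "\<dots> = ?I"
    proof (rule nn_integral_torus_shift[where F = "\<lambda>x. ennreal (wave_cov n x ^ 4 * inv_sin (frame l x))"])
      show "torus_periodic (\<lambda>x. ennreal (wave_cov n x ^ 4 * inv_sin (frame l x)))"
        using wave_cov_periodic[of n] torus_periodic_frame[OF inv_sin_periodic, of l]
        unfolding torus_periodic_def by metis
    qed measurable
    finally show ?thesis .
  qed
  have nn: "0 \<le> inv_sin x" for x by (simp add: inv_sin_def)
  have "ennreal ((real n)\<^sup>2) * ?I = (\<Sum>j<n. \<Sum>k<n. ?I)"
    by (simp add: power2_eq_square ennreal_mult mult.assoc ennreal_of_nat_eq_real_of_nat)
  also have "\<dots> = (\<integral>\<^sup>+x. (\<Sum>j<n. \<Sum>k<n. ennreal (wave_cov n (x + dual_point n l j k) ^ 4 * inv_sin (frame l x))) \<partial>torus_measure)"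
    by (simp add: nn_integral_sum shift)
  also have "\<dots> \<le> (\<integral>\<^sup>+x. ennreal (?c * (real n)\<^sup>2) * ennreal (inv_sin (frame l x)) \<partial>torus_measure)"
  proof (rule nn_integral_mono)
    fix x
    have "(\<Sum>j<n. \<Sum>k<n. wave_cov n (x + dual_point n l j k) ^ 4) * inv_sin (frame l x)
      \<le> (?c * (real n)\<^sup>2) * inv_sin (frame l x)"
      using dual_average_wave_cov_power4_le[OF l, of x] by (intro mult_right_mono nn) simp
    then have "(\<Sum>j<n. \<Sum>k<n. wave_cov n (x + dual_point n l j k) ^ 4 * inv_sin (frame l x))
      \<le> (?c * (real n)\<^sup>2) * inv_sin (frame l x)"
      by (simp only: sum_distrib_right)
    then show "(\<Sum>j<n. \<Sum>k<n. ennreal (wave_cov n (x + dual_point n l j k) ^ 4 * inv_sin (frame l x)))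
      \<le> ennreal (?c * (real n)\<^sup>2) * ennreal (inv_sin (frame l x))"
      using nn by (simp add: sum_ennreal sum_nonneg ennreal_mult[symmetric] ennreal_leI del: ennreal_mult)
  qed
  also have "\<dots> = ennreal (?c * (real n)\<^sup>2) * (\<integral>\<^sup>+x. ennreal (inv_sin (frame l x)) \<partial>torus_measure)"
    by (simp add: nn_integral_cmult)
  also have "(\<integral>\<^sup>+x. ennreal (inv_sin (frame l x)) \<partial>torus_measure) = ?J"
    using inv_sin_periodic by (intro nn_integral_torus_frame[OF _ _ l]) (auto simp: torus_periodic_def)
  also have "ennreal (?c * (real n)\<^sup>2) * ?J = ennreal ((real n)\<^sup>2) * (ennreal ?c * ?J)"
    by (subst ennreal_mult) (auto simp: mult_ac)
  finally show ?thesis using l(2) by (subst (asm) ennreal_mult_le_mult_iff) auto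
qed

text \<open>Convexity of the inverse square root turns the lower bound for \<open>1 - r\<^sup>2\<close> into an upper bound
  by a mean of the weights.\<close>

lemma wave_cov_bounds_AE:
  assumes "n \<in> sums_of_two_squares"
  shows "AE x in torus_measure. \<bar>wave_cov n x\<bar> < 1 \<and>
    wave_cov n x ^ 4 / sqrt (1 - (wave_cov n x)\<^sup>2) \<le>
      (\<Sum>l\<in>Freq n. wave_cov n x ^ 4 * inv_sin (frame l x)) / real (card (Freq n))"
proof -
  let ?F = "Freq n" let ?N = "real (card ?F)"
  have n: "n > 0" using assms by (simp add: sums_of_two_squares_def)
  have ne: "?F \<noteq> {}" using Freq_nonempty[OF assms] .
  have N: "?N > 0" using ne finite_Freq by (simp add: card_gt_0_iff)
  have "AE x in torus_measure. \<forall>l\<in>?F. freq_sin l x \<noteq> 0"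
    by (intro AE_finite_allI finite_Freq AE_sin_frequency_nonzero[OF _ n])
  then show ?thesis
  proof (eventually_elim)
    case (elim x)
    let ?u = "\<lambda>l. \<bar>freq_sin l x * freq_sin (quarter_turn l) x\<bar>"
    have pos: "?u l > 0" if "l \<in> ?F" for l using elim that by simp
    define q where "q = (\<Sum>l\<in>?F. ?u l) / ?N"
    have q: "q > 0" unfolding q_def by (intro divide_pos_pos sum_pos finite_Freq ne N pos)
    have le: "q \<le> 1 - (wave_cov n x)\<^sup>2" unfolding q_def by (rule one_minus_wave_cov_sq_ge[OF ne])
    have "\<bar>wave_cov n x\<bar> < 1" using le q by (subst abs_square_less_1[symmetric]) linarith
    moreover have "1 / sqrt (1 - (wave_cov n x)\<^sup>2) \<le> 1 / sqrt q"
      using le q by (intro divide_left_mono mult_pos_pos) auto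
    moreover have "1 / sqrt q \<le> (\<Sum>l\<in>?F. 1 / sqrt (?u l)) / ?N"
      unfolding q_def by (rule inverse_sqrt_mean_le[OF finite_Freq ne pos])
    ultimately have res: "\<bar>wave_cov n x\<bar> < 1" "1 / sqrt (1 - (wave_cov n x)\<^sup>2) \<le> (\<Sum>l\<in>?F. inv_sin (frame l x)) / ?N"
      by (auto simp: inv_sin_def frame_def)
    show ?case
      using res(1) mult_left_mono[OF res(2), of "wave_cov n x ^ 4"] by (simp add: sum_distrib_left)
  qed
qed

text \<open>The only singularity in the second moment of the residual, and the source of its order
  \<open>1 / N\<^sup>2\<close>.\<close>

lemma wave_cov_singular_integral:
  "\<exists>K\<ge>0. \<forall>n\<in>sums_of_two_squares.
    (\<integral>\<^sup>+x. ennreal (wave_cov n x ^ 4 / sqrt (1 - (wave_cov n x)\<^sup>2)) \<partial>torus_measure)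
      \<le> ennreal (K / (real (card (Freq n)))\<^sup>2)"
proof -
  obtain J where J: "J \<ge> 0" "(\<integral>\<^sup>+x. ennreal (inv_sin x) \<partial>torus_measure) = ennreal J"
    using inv_sin_integral_finite by (cases "\<integral>\<^sup>+x. ennreal (inv_sin x) \<partial>torus_measure") auto
  show ?thesis
  proof (intro exI[of _ "243 * J"] conjI ballI)
    show "0 \<le> 243 * J" using J by simp
    fix n assume n: "n \<in> sums_of_two_squares"
    let ?F = "Freq n" let ?N = "real (card ?F)"
    have n0: "n > 0" using n by (simp add: sums_of_two_squares_def)
    have N: "?N > 0" using Freq_nonempty[OF n] finite_Freq by (simp add: card_gt_0_iff)
    have nn: "0 \<le> wave_cov n x ^ 4 * inv_sin y" for x y by (simp add: inv_sin_def)
    have "(\<integral>\<^sup>+x. ennreal (wave_cov n x ^ 4 / sqrt (1 - (wave_cov n x)\<^sup>2)) \<partial>torus_measure)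
      \<le> (\<integral>\<^sup>+x. ennreal (1 / ?N) * (\<Sum>l\<in>?F. ennreal (wave_cov n x ^ 4 * inv_sin (frame l x))) \<partial>torus_measure)"
    proof (rule nn_integral_mono_AE, use wave_cov_bounds_AE[OF n] in eventually_elim)
      case (elim x)
      then have "wave_cov n x ^ 4 / sqrt (1 - (wave_cov n x)\<^sup>2) \<le>
          1 / ?N * (\<Sum>l\<in>?F. wave_cov n x ^ 4 * inv_sin (frame l x))" by simp
      then show ?case
        using nn by (subst sum_ennreal) (auto simp: ennreal_mult[symmetric] sum_nonneg simp del: ennreal_mult intro!: ennreal_leI)
    qed
    also have "\<dots> = ennreal (1 / ?N) * (\<Sum>l\<in>?F. (\<integral>\<^sup>+x. ennreal (wave_cov n x ^ 4 * inv_sin (frame l x)) \<partial>torus_measure))"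
      by (subst nn_integral_cmult) (auto simp: nn_integral_sum)
    also have "\<dots> \<le> ennreal (1 / ?N) * (\<Sum>l\<in>?F. ennreal (243 / ?N\<^sup>2) * ennreal J)"
      using wave_cov_power4_weighted_le[OF _ n0] unfolding J(2)
      by (intro mult_left_mono sum_mono) auto
    also have "\<dots> = ennreal (1 / ?N * (?N * (243 / ?N\<^sup>2 * J)))"
      using J(1) N by (simp add: ennreal_mult ennreal_of_nat_eq_real_of_nat del: times_divide_eq_left times_divide_eq_right)
    also have "1 / ?N * (?N * (243 / ?N\<^sup>2 * J)) = 243 * J / ?N\<^sup>2"
      using N by simp
    finally show "(\<integral>\<^sup>+x. ennreal (wave_cov n x ^ 4 / sqrt (1 - (wave_cov n x)\<^sup>2)) \<partial>torus_measure)
      \<le> ennreal (243 * J / ?N\<^sup>2)" .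
  qed
qed

section \<open>Gaussian pairs\<close>

text \<open>Divided by their common mean, the weights are probability densities; this reduces the claim to
  the uniqueness of characteristic functions on the line. The bounds 1 and 3 are those of the weight
  \<open>2 + cos\<close>.\<close>

lemma weighted_char_unique:
  fixes X :: "'a \<Rightarrow> real" and Y :: "'b \<Rightarrow> real"
  assumes "prob_space M" "prob_space N"
    and [measurable]: "X \<in> borel_measurable M" "Y \<in> borel_measurable N"
      "w \<in> borel_measurable M" "v \<in> borel_measurable N"
    and w: "\<And>x. 1 \<le> w x \<and> w x \<le> 3" and v: "\<And>x. 1 \<le> v x \<and> v x \<le> 3"
    and eq: "\<And>t. (\<integral>x. complex_of_real (w x) * iexp (t * X x) \<partial>M) = (\<integral>x. complex_of_real (v x) * iexp (t * Y x) \<partial>N)"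
    and A: "A \<in> sets borel"
  shows "(\<integral>x. w x * indicator A (X x) \<partial>M) = (\<integral>x. v x * indicator A (Y x) \<partial>N)"
proof -
  interpret M: prob_space M by fact
  interpret N: prob_space N by fact
  have bw: "\<bar>w x\<bar> \<le> 3" for x using w[of x] by linarith
  have bv: "\<bar>v x\<bar> \<le> 3" for x using v[of x] by linarith
  have iw: "integrable M w" by (rule M.integrable_const_bound[where B = 3]) (use bw in auto)
  have iv: "integrable N v" by (rule N.integrable_const_bound[where B = 3]) (use bv in auto)
  define c where "c = (\<integral>x. w x \<partial>M)"
  have "complex_of_real c = complex_of_real (\<integral>x. v x \<partial>N)" using eq[of 0] by (simp add: c_def)
  then have cv: "c = (\<integral>x. v x \<partial>N)" by (simp only: of_real_eq_iff)
  have "(\<integral>x. 1 \<partial>M) \<le> c" unfolding c_def by (rule integral_mono[OF _ iw]) (use w in auto)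
  then have c: "c \<ge> 1" by (simp add: M.prob_space)
  define M' where "M' = density M (\<lambda>x. ennreal (w x / c))"
  define N' where "N' = density N (\<lambda>x. ennreal (v x / c))"
  have posw: "0 \<le> w x / c" for x using w[of x] c by auto
  have posv: "0 \<le> v x / c" for x using v[of x] c by auto
  have "emeasure M' (space M') = (\<integral>\<^sup>+x. ennreal (w x / c) \<partial>M)"
    unfolding M'_def by (subst emeasure_density) (auto intro!: nn_integral_cong)
  also have "\<dots> = ennreal (\<integral>x. w x / c \<partial>M)"
    using iw posw by (intro nn_integral_eq_integral) auto
  also have "\<dots> = 1" using c by (simp add: c_def)
  finally interpret M': prob_space M' by (rule prob_spaceI)
  have "emeasure N' (space N') = (\<integral>\<^sup>+x. ennreal (v x / c) \<partial>N)"
    unfolding N'_def by (subst emeasure_density) (auto intro!: nn_integral_cong)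
  also have "\<dots> = ennreal (\<integral>x. v x / c \<partial>N)"
    using iv posv by (intro nn_integral_eq_integral) auto
  also have "\<dots> = 1" using c by (simp add: cv)
  finally interpret N': prob_space N' by (rule prob_spaceI)
  have mX: "X \<in> borel_measurable M'" and mY: "Y \<in> borel_measurable N'" by (auto simp: M'_def N'_def)
  have "char (distr M' borel X) = char (distr N' borel Y)"
  proof
    fix t
    have "char (distr M' borel X) t = (\<integral>x. (w x / c) *\<^sub>R iexp (t * X x) \<partial>M)"
      using mX posw unfolding char_def by (simp add: integral_distr M'_def integral_density)
    also have "\<dots> = (\<integral>x. complex_of_real (w x) * iexp (t * X x) \<partial>M) / c"
      by (simp add: scaleR_conv_of_real)
    also have "\<dots> = (\<integral>x. complex_of_real (v x) * iexp (t * Y x) \<partial>N) / c" by (simp only: eq)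
    also have "\<dots> = (\<integral>x. (v x / c) *\<^sub>R iexp (t * Y x) \<partial>N)"
      by (simp add: scaleR_conv_of_real)
    also have "\<dots> = char (distr N' borel Y) t"
      using mY posv unfolding char_def by (simp add: integral_distr N'_def integral_density)
    finally show "char (distr M' borel X) t = char (distr N' borel Y) t" .
  qed
  then have "distr M' borel X = distr N' borel Y"
    using mX mY by (intro Levy_uniqueness M'.real_distribution_distr N'.real_distribution_distr) auto
  then have "(\<integral>x. indicator A x \<partial>distr M' borel X) = (\<integral>x. indicator A x \<partial>distr N' borel Y :: real)" by simp
  moreover have "(\<integral>x. indicator A x \<partial>distr M' borel X) = (\<integral>x. indicator A (X x) \<partial>M' :: real)"
    using mX A by (intro integral_distr) auto
  moreover have "(\<integral>x. indicator A x \<partial>distr N' borel Y) = (\<integral>x. indicator A (Y x) \<partial>N' :: real)"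
    using mY A by (intro integral_distr) auto
  moreover note A[measurable]
  have "(\<integral>x. indicator A (X x) \<partial>M') = (\<integral>x. (w x / c) *\<^sub>R indicator A (X x) \<partial>M :: real)"
    unfolding M'_def by (rule integral_density) (measurable, simp add: posw)
  moreover have "(\<integral>x. indicator A (Y x) \<partial>N') = (\<integral>x. (v x / c) *\<^sub>R indicator A (Y x) \<partial>N :: real)"
    unfolding N'_def by (rule integral_density) (measurable, simp add: posv)
  ultimately have "(\<integral>x. (w x / c) *\<^sub>R indicator A (X x) \<partial>M) = (\<integral>x. (v x / c) *\<^sub>R indicator A (Y x) \<partial>N :: real)"
    by metis
  then show ?thesis using c by simp
qed

text \<open>Trigonometric weights reduce the plane to the line: the joint characteristic function
  determines the mean of \<open>cos (t Y)\<close> and \<open>sin (t Y)\<close> on every event \<open>X \<in> A\<close>, hence the law of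
  \<open>Y\<close> weighted by that event.\<close>

lemma char_pair_unique:
  fixes X Y :: "'a \<Rightarrow> real" and X' Y' :: "'b \<Rightarrow> real"
  assumes "prob_space M" "prob_space N"
    and [measurable]: "X \<in> borel_measurable M" "Y \<in> borel_measurable M"
      "X' \<in> borel_measurable N" "Y' \<in> borel_measurable N"
    and eq: "\<And>s t. (\<integral>x. iexp (s * X x + t * Y x) \<partial>M) = (\<integral>x. iexp (s * X' x + t * Y' x) \<partial>N)"
  shows "distr M (borel \<Otimes>\<^sub>M borel) (\<lambda>x. (X x, Y x)) = distr N (borel \<Otimes>\<^sub>M borel) (\<lambda>x. (X' x, Y' x))"
proof -
  interpret M: prob_space M by fact
  interpret N: prob_space N by fact
  have iM: "integrable M (\<lambda>x. iexp (f x))" if [measurable]: "f \<in> borel_measurable M" for f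
    by (intro M.integrable_const_bound[where B = 1] AE_I2) (simp, measurable)
  have iN: "integrable N (\<lambda>x. iexp (f x))" if [measurable]: "f \<in> borel_measurable N" for f
    by (intro N.integrable_const_bound[where B = 1] AE_I2) (simp, measurable)
  have iMr: "integrable M f" if [measurable]: "f \<in> borel_measurable M" and "\<And>x. \<bar>f x\<bar> \<le> 1" for f :: "'a \<Rightarrow> real"
    by (intro M.integrable_const_bound[where B = 1] AE_I2) (simp add: that, measurable)
  have iNr: "integrable N f" if [measurable]: "f \<in> borel_measurable N" and "\<And>x. \<bar>f x\<bar> \<le> 1" for f :: "'b \<Rightarrow> real"
    by (intro N.integrable_const_bound[where B = 1] AE_I2) (simp add: that, measurable)
  have iexp_cis: "iexp a = cis a" for a by (simp only: cis_conv_exp)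
  have cosw: "complex_of_real (2 + cos (b + \<theta>)) * iexp a = 2 * iexp a + (cis \<theta> * iexp (a + b) + cis (- \<theta>) * iexp (a - b)) / 2" for a b \<theta>
  proof -
    have 1: "complex_of_real (cos (b + \<theta>)) = (cis b * cis \<theta> + cis (- b) * cis (- \<theta>)) / 2"
    proof -
      have "complex_of_real (cos c) = (cis c + cis (- c)) / 2" for c by (simp add: complex_eq_iff)
      moreover have "cis (b + \<theta>) = cis b * cis \<theta>" "cis (- (b + \<theta>)) = cis (- b) * cis (- \<theta>)" by (simp_all add: cis_mult)
      ultimately show ?thesis by (simp only:)
    qed
    have 2: "cis (a + b) = cis a * cis b" "cis (a - b) = cis a * cis (- b)" by (simp_all add: cis_mult)
    have "(2 + (u * p + v * q) / 2) * z = 2 * z + (p * (z * u) + q * (z * v)) / 2" for u v p q z :: complex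
      by (simp add: distrib_left distrib_right add_divide_distrib mult_ac)
    then show ?thesis unfolding iexp_cis unfolding 2 of_real_add of_real_numeral 1 .
  qed
  have eqX: "(\<integral>x. iexp (s * X x) \<partial>M) = (\<integral>x. iexp (s * X' x) \<partial>N)" for s using eq[of s 0] by simp
  have eqY: "(\<integral>x. iexp (t * Y x) \<partial>M) = (\<integral>x. iexp (t * Y' x) \<partial>N)" for t using eq[of 0 t] by simp
  have eqm: "(\<integral>x. iexp (s * X x - t * Y x) \<partial>M) = (\<integral>x. iexp (s * X' x - t * Y' x) \<partial>N)" for s t
    using eq[of s "- t"] by simp
  have PX: "(\<integral>x. indicator A (X x) \<partial>M) = (\<integral>x. indicator A (X' x) \<partial>N :: real)" if "A \<in> sets borel" for A
  proof -
    have "(\<integral>x. 1 * indicator A (X x) \<partial>M) = (\<integral>x. 1 * indicator A (X' x) \<partial>N :: real)"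
      by (rule weighted_char_unique[where w = "\<lambda>_. 1" and v = "\<lambda>_. 1", OF assms(1,2,3,5)])
         (simp_all only: of_real_1 mult_1 eqX that, simp_all)
    then show ?thesis by (simp only: mult_1)
  qed
  have PY: "(\<integral>x. indicator A (Y x) \<partial>M) = (\<integral>x. indicator A (Y' x) \<partial>N :: real)" if "A \<in> sets borel" for A
  proof -
    have "(\<integral>x. 1 * indicator A (Y x) \<partial>M) = (\<integral>x. 1 * indicator A (Y' x) \<partial>N :: real)"
      by (rule weighted_char_unique[where w = "\<lambda>_. 1" and v = "\<lambda>_. 1", OF assms(1,2,4,6)])
         (simp_all only: of_real_1 mult_1 eqY that, simp_all)
    then show ?thesis by (simp only: mult_1)
  qed
  have cos1: "1 \<le> 2 + cos x \<and> 2 + cos x \<le> 3" for x :: real using cos_ge_minus_one[of x] cos_le_one[of x] by linarith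
  have split_cos: "(\<integral>x. 2 * f x + (p * g x + q * h x) / 2 \<partial>Q) = 2 * (\<integral>x. f x \<partial>Q) + (p * (\<integral>x. g x \<partial>Q) + q * (\<integral>x. h x \<partial>Q)) / 2"
    if "integrable Q f" "integrable Q g" "integrable Q h" for f g h :: "'z \<Rightarrow> complex" and p q Q
    using that by simp
  have ind1: "\<bar>c * indicator B y\<bar> \<le> 1" if "\<bar>c\<bar> \<le> 1" for c :: real and B and y :: real
    using that by (simp add: indicator_def)
  have ind2: "\<bar>indicator B y\<bar> \<le> (1::real)" for B and y :: real
    by (simp add: indicator_def)
  have expand: "(\<integral>x. (c + f x) * g x \<partial>Q) = c * (\<integral>x. g x \<partial>Q) + (\<integral>x. f x * g x \<partial>Q)"
    if "integrable Q g" "integrable Q (\<lambda>x. f x * g x)" for c :: real and f g :: "'z \<Rightarrow> real" and Q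
    unfolding distrib_right using that by simp
  note expand1 = expand[of _ _ _ 1, unfolded mult_1]
  have C: "(\<integral>x. cos (t * Y x + \<theta>) * indicator A (X x) \<partial>M) = (\<integral>x. cos (t * Y' x + \<theta>) * indicator A (X' x) \<partial>N)"
    if A[measurable]: "A \<in> sets borel" for A t \<theta>
  proof -
    have "(\<integral>x. (2 + cos (t * Y x + \<theta>)) * indicator A (X x) \<partial>M) = (\<integral>x. (2 + cos (t * Y' x + \<theta>)) * indicator A (X' x) \<partial>N)"
    proof -
      have e: "(\<integral>x. complex_of_real (2 + cos (t * Y x + \<theta>)) * iexp (s * X x) \<partial>M) = (\<integral>x. complex_of_real (2 + cos (t * Y' x + \<theta>)) * iexp (s * X' x) \<partial>N)" for s
      proof -
        have Meq: "(\<integral>x. 2 * iexp (s * X x) + (cis \<theta> * iexp (s * X x + t * Y x) + cis (- \<theta>) * iexp (s * X x - t * Y x)) / 2 \<partial>M) =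
          2 * (\<integral>x. iexp (s * X x) \<partial>M) + (cis \<theta> * (\<integral>x. iexp (s * X x + t * Y x) \<partial>M) + cis (- \<theta>) * (\<integral>x. iexp (s * X x - t * Y x) \<partial>M)) / 2"
          by (intro split_cos iM; measurable)
        have Neq: "(\<integral>x. 2 * iexp (s * X' x) + (cis \<theta> * iexp (s * X' x + t * Y' x) + cis (- \<theta>) * iexp (s * X' x - t * Y' x)) / 2 \<partial>N) =
          2 * (\<integral>x. iexp (s * X' x) \<partial>N) + (cis \<theta> * (\<integral>x. iexp (s * X' x + t * Y' x) \<partial>N) + cis (- \<theta>) * (\<integral>x. iexp (s * X' x - t * Y' x) \<partial>N)) / 2"
          by (intro split_cos iN; measurable)
        show ?thesis unfolding cosw Meq Neq eqX eq eqm ..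
      qed
      have mw: "(\<lambda>x. 2 + cos (t * Y x + \<theta>)) \<in> borel_measurable M" and mv: "(\<lambda>x. 2 + cos (t * Y' x + \<theta>)) \<in> borel_measurable N"
        by measurable
      show ?thesis
        by (rule weighted_char_unique[where w = "\<lambda>x. 2 + cos (t * Y x + \<theta>)" and v = "\<lambda>x. 2 + cos (t * Y' x + \<theta>)"])
           (rule assms mw mv cos1 e A)+
    qed
    moreover have "(\<integral>x. (2 + cos (t * Y x + \<theta>)) * indicator A (X x) \<partial>M) = 2 * (\<integral>x. indicator A (X x) \<partial>M) + (\<integral>x. cos (t * Y x + \<theta>) * indicator A (X x) \<partial>M)"
      by (intro expand iMr; ((rule ind1 ind2 abs_cos_le_one)+ | measurable))
    moreover have "(\<integral>x. (2 + cos (t * Y' x + \<theta>)) * indicator A (X' x) \<partial>N) = 2 * (\<integral>x. indicator A (X' x) \<partial>N) + (\<integral>x. cos (t * Y' x + \<theta>) * indicator A (X' x) \<partial>N)"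
      by (intro expand iNr; ((rule ind1 ind2 abs_cos_le_one)+ | measurable))
    ultimately show ?thesis using PX[OF A] by simp
  qed
  have S: "(\<integral>x. sin (t * Y x) * indicator A (X x) \<partial>M) = (\<integral>x. sin (t * Y' x) * indicator A (X' x) \<partial>N)"
    if A: "A \<in> sets borel" for A t
  proof -
    have "cos (b + - (pi / 2)) = sin b" for b :: real by (simp add: cos_diff)
    with C[OF A, of t "- (pi / 2)"] show ?thesis by (simp only:)
  qed
  have C0: "(\<integral>x. cos (t * Y x) * indicator A (X x) \<partial>M) = (\<integral>x. cos (t * Y' x) * indicator A (X' x) \<partial>N)"
    if A: "A \<in> sets borel" for A t
    using C[OF A, of t 0] by simp
  have euler: "complex_of_real (1 + i) * iexp a = iexp a + (complex_of_real (cos a * i) + \<i> * complex_of_real (sin a * i))" for a i :: real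
    unfolding iexp_cis by (simp add: complex_eq_iff algebra_simps)
  have P: "(\<integral>x. indicator A (X x) * indicator B (Y x) \<partial>M) = (\<integral>x. indicator A (X' x) * indicator B (Y' x) \<partial>N :: real)"
    if A[measurable]: "A \<in> sets borel" and B[measurable]: "B \<in> sets borel" for A B
  proof -
    have linM: "(\<integral>x. f x + (complex_of_real (g x) + \<i> * complex_of_real (h x)) \<partial>M) =
        (\<integral>x. f x \<partial>M) + (complex_of_real (\<integral>x. g x \<partial>M) + \<i> * complex_of_real (\<integral>x. h x \<partial>M))"
      if "integrable M f" "integrable M g" "integrable M h" for f g h
      using that by simp
    have linN: "(\<integral>x. f x + (complex_of_real (g x) + \<i> * complex_of_real (h x)) \<partial>N) =
        (\<integral>x. f x \<partial>N) + (complex_of_real (\<integral>x. g x \<partial>N) + \<i> * complex_of_real (\<integral>x. h x \<partial>N))"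
      if "integrable N f" "integrable N g" "integrable N h" for f g h
      using that by simp
    have "(\<integral>x. (1 + indicator A (X x)) * indicator B (Y x) \<partial>M) = (\<integral>x. (1 + indicator A (X' x)) * indicator B (Y' x) \<partial>N :: real)"
    proof (rule weighted_char_unique[OF assms(1,2,4,6)])
      fix t
      have "(\<integral>x. complex_of_real (1 + indicator A (X x)) * iexp (t * Y x) \<partial>M) =
        (\<integral>x. iexp (t * Y x) \<partial>M) + (complex_of_real (\<integral>x. cos (t * Y x) * indicator A (X x) \<partial>M) + \<i> * complex_of_real (\<integral>x. sin (t * Y x) * indicator A (X x) \<partial>M))"
        unfolding euler by (rule linM[OF iM iMr iMr]) (auto simp: indicator_def)
      moreover have "(\<integral>x. complex_of_real (1 + indicator A (X' x)) * iexp (t * Y' x) \<partial>N) =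
        (\<integral>x. iexp (t * Y' x) \<partial>N) + (complex_of_real (\<integral>x. cos (t * Y' x) * indicator A (X' x) \<partial>N) + \<i> * complex_of_real (\<integral>x. sin (t * Y' x) * indicator A (X' x) \<partial>N))"
        unfolding euler by (rule linN[OF iN iNr iNr]) (auto simp: indicator_def)
      ultimately show "(\<integral>x. complex_of_real (1 + indicator A (X x)) * iexp (t * Y x) \<partial>M) = (\<integral>x. complex_of_real (1 + indicator A (X' x)) * iexp (t * Y' x) \<partial>N)"
        by (simp only: eqY C0[OF A] S[OF A])
    qed (use A B in \<open>auto simp: indicator_def\<close>)
    moreover have "(\<integral>x. (1 + indicator A (X x)) * indicator B (Y x) \<partial>M) = (\<integral>x. indicator B (Y x) \<partial>M) + (\<integral>x. indicator A (X x) * indicator B (Y x) \<partial>M :: real)"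
      by (intro expand1 iMr; ((rule ind1 ind2 abs_cos_le_one)+ | measurable))
    moreover have "(\<integral>x. (1 + indicator A (X' x)) * indicator B (Y' x) \<partial>N) = (\<integral>x. indicator B (Y' x) \<partial>N) + (\<integral>x. indicator A (X' x) * indicator B (Y' x) \<partial>N :: real)"
      by (intro expand1 iNr; ((rule ind1 ind2 abs_cos_le_one)+ | measurable))
    ultimately show ?thesis using PY[OF B] by simp
  qed
  let ?D = "distr M (borel \<Otimes>\<^sub>M borel) (\<lambda>x. (X x, Y x))" let ?D' = "distr N (borel \<Otimes>\<^sub>M borel) (\<lambda>x. (X' x, Y' x))"
  interpret D: prob_space ?D by (rule M.prob_space_distr) simp
  interpret D': prob_space ?D' by (rule N.prob_space_distr) simp
  have meas: "emeasure ?D (A \<times> B) = emeasure ?D' (A \<times> B)" if A[measurable]: "A \<in> sets borel" and B[measurable]: "B \<in> sets borel" for A B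
  proof -
    have "measure ?D (A \<times> B) = (\<integral>z. indicator (A \<times> B) z \<partial>?D)" by simp
    also have "\<dots> = (\<integral>x. indicator A (X x) * indicator B (Y x) \<partial>M)"
      by (subst integral_distr) (auto simp: indicator_times)
    also have "\<dots> = (\<integral>x. indicator A (X' x) * indicator B (Y' x) \<partial>N)" by (rule P[OF A B])
    also have "\<dots> = (\<integral>z. indicator (A \<times> B) z \<partial>?D')"
      by (subst integral_distr) (auto simp: indicator_times)
    also have "\<dots> = measure ?D' (A \<times> B)" by simp
    finally show ?thesis by (simp add: D.emeasure_eq_measure D'.emeasure_eq_measure)
  qed
  show ?thesis
  proof (rule measure_eqI_generator_eq[where A = "\<lambda>_. UNIV" and \<Omega> = UNIV])
    show "Int_stable {a \<times> b |a b. a \<in> sets (borel :: real measure) \<and> b \<in> sets (borel :: real measure)}"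
      by (rule Int_stable_pair_measure_generator)
    show "sets ?D = sigma_sets UNIV {a \<times> b |a b. a \<in> sets borel \<and> b \<in> sets borel}"
      by (simp add: sets_pair_measure)
    show "sets ?D' = sigma_sets UNIV {a \<times> b |a b. a \<in> sets borel \<and> b \<in> sets borel}"
      by (simp add: sets_pair_measure)
    show "range (\<lambda>_. UNIV) \<subseteq> {a \<times> b |a b. a \<in> sets (borel :: real measure) \<and> b \<in> sets (borel :: real measure)}"
      by (auto intro!: exI[of _ UNIV])
    show "emeasure ?D UNIV \<noteq> \<infinity>" using D.emeasure_finite by (simp add: top_unique)
  qed (use meas in auto)
qed

interpretation std_normal: real_distribution std_normal_distribution
  by (rule real_dist_normal_dist)

lemma gaussian_pair_law:
  fixes X Y :: "'a \<Rightarrow> real"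
  assumes "prob_space M" and [measurable]: "X \<in> borel_measurable M" "Y \<in> borel_measurable M"
    and r: "\<bar>r\<bar> \<le> 1"
    and char: "\<And>s t. (\<integral>x. iexp (s * X x + t * Y x) \<partial>M) = complex_of_real (exp (- (s\<^sup>2 + 2 * r * s * t + t\<^sup>2) / 2))"
  shows "distr M (borel \<Otimes>\<^sub>M borel) (\<lambda>x. (X x, Y x)) =
    distr (std_normal_distribution \<Otimes>\<^sub>M std_normal_distribution) (borel \<Otimes>\<^sub>M borel)
      (\<lambda>z. (fst z, r * fst z + sqrt (1 - r\<^sup>2) * snd z))"
proof -
  interpret SS: pair_prob_space std_normal_distribution std_normal_distribution ..
  let ?q = "sqrt (1 - r\<^sup>2)"
  have q: "?q\<^sup>2 = 1 - r\<^sup>2" using r by (simp add: abs_square_le_1)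
  show ?thesis
  proof (rule char_pair_unique[OF assms(1) SS.prob_space_axioms])
    fix s t
    have "(\<integral>z. iexp (s * fst z + t * (r * fst z + ?q * snd z)) \<partial>(std_normal_distribution \<Otimes>\<^sub>M std_normal_distribution))
      = (\<integral>z. iexp ((s + t * r) * fst z) * iexp ((t * ?q) * snd z) \<partial>(std_normal_distribution \<Otimes>\<^sub>M std_normal_distribution))"
      by (simp add: exp_add[symmetric] algebra_simps)
    also have "\<dots> = (\<integral>x. \<integral>y. iexp ((s + t * r) * x) * iexp ((t * ?q) * y) \<partial>std_normal_distribution \<partial>std_normal_distribution)"
      by (subst SS.integral_fst'[symmetric])
         (auto intro!: SS.integrable_const_bound[where B = 1] simp: norm_mult simp del: of_real_mult of_real_add)
    also have "\<dots> = char std_normal_distribution (s + t * r) * char std_normal_distribution (t * ?q)"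
      unfolding char_def by simp
    also have "\<dots> = complex_of_real (exp (- (s + t * r)\<^sup>2 / 2 + - (t * ?q)\<^sup>2 / 2))"
      by (simp only: char_std_normal_distribution exp_add of_real_mult)
    also have "- (s + t * r)\<^sup>2 / 2 + - (t * ?q)\<^sup>2 / 2 = - (s\<^sup>2 + 2 * r * s * t + t\<^sup>2) / 2"
      unfolding power_mult_distrib q by (simp add: power2_eq_square field_simps)
    finally show "(\<integral>x. iexp (s * X x + t * Y x) \<partial>M) = (\<integral>z. iexp (s * fst z + t * (r * fst z + ?q * snd z)) \<partial>(std_normal_distribution \<Otimes>\<^sub>M std_normal_distribution))"
      by (simp only: char)
  qed measurable
qed

section \<open>Expansion of the bivariate Gaussian density\<close>

lemma cosh_le_exp_half_square: "cosh v \<le> exp (v\<^sup>2 / 2)" for v :: real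
proof -
  have "cosh v \<le> exp (v\<^sup>2 / 2)" if "v \<ge> 0" for v :: real
  proof -
    have "ln (cosh v) - v\<^sup>2 / 2 \<le> ln (cosh 0) - 0\<^sup>2 / 2"
    proof (rule DERIV_nonpos_imp_nonincreasing[where f = "\<lambda>v. ln (cosh v) - v\<^sup>2 / 2"])
      fix x :: real assume x: "0 \<le> x"
      have d: "((\<lambda>v. ln (cosh v) - v\<^sup>2 / 2) has_real_derivative (sinh x / cosh x - x)) (at x)"
        by (auto intro!: derivative_eq_intros simp: cosh_real_pos)
      have "sinh x * 1 - x * cosh x \<le> sinh 0 * 1 - 0 * cosh 0"
      proof (rule DERIV_nonpos_imp_nonincreasing[where f = "\<lambda>x. sinh x * 1 - x * cosh x", OF x])
        fix y :: real assume "0 \<le> y"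
        then show "\<exists>d. ((\<lambda>x. sinh x * 1 - x * cosh x) has_real_derivative d) (at y) \<and> d \<le> 0"
          by (intro exI[of _ "- y * sinh y"] conjI) (auto intro!: derivative_eq_intros)
      qed
      then have "sinh x / cosh x - x \<le> 0" by (simp add: field_simps cosh_real_pos)
      with d show "\<exists>y. ((\<lambda>v. ln (cosh v) - v\<^sup>2 / 2) has_real_derivative y) (at x) \<and> y \<le> 0" by blast
    qed (use that in auto)
    then have "ln (cosh v) \<le> v\<^sup>2 / 2" by simp
    then show ?thesis by (metis cosh_real_pos exp_le_cancel_iff exp_ln)
  qed
  from this[of v] this[of "-v"] show ?thesis by (cases "v \<ge> 0") auto
qed

lemma cosh_le_exp_abs: "cosh v \<le> exp \<bar>v\<bar>" for v :: real
proof -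
  have "exp v \<le> exp \<bar>v\<bar>" "exp (- v) \<le> exp \<bar>v\<bar>" by auto
  then have "exp v + exp (- v) \<le> exp \<bar>v\<bar> + exp \<bar>v\<bar>" by (rule add_mono)
  then show ?thesis unfolding cosh_def by simp
qed

text \<open>After symmetrisation only even powers of \<open>r\<close> survive in the bivariate density; those of
  order 0 and 2 are the projections on constants and on the second Hermite polynomial. For
  \<open>r\<^sup>2 > 1/4\<close> the last term alone suffices, as \<open>16 r\<^sup>4 \<ge> 1\<close> and the exponents are nonpositive.\<close>

lemma bivariate_kernel_bound:
  fixes x y r :: real
  assumes x: "\<bar>x\<bar> \<le> 1" and y: "\<bar>y\<bar> \<le> 1" and r: "\<bar>r\<bar> < 1"
  defines "s \<equiv> 1 - r\<^sup>2"
  shows "exp (- (x\<^sup>2 + y\<^sup>2) / (2 * s)) * cosh (r * x * y / s) / sqrt s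
    \<le> exp (- (x\<^sup>2 + y\<^sup>2) / 2) * (1 + r\<^sup>2 / 2 * ((1 - x\<^sup>2) * (1 - y\<^sup>2))) + 16 * (r ^ 4 / sqrt s)"
proof -
  define q a b where "q = r\<^sup>2" and "a = x\<^sup>2" and "b = y\<^sup>2"
  have q: "0 \<le> q" "q < 1" using r by (auto simp: q_def abs_square_less_1)
  have a: "0 \<le> a" "a \<le> 1" and b: "0 \<le> b" "b \<le> 1" using x y by (auto simp: a_def b_def abs_square_le_1)
  have s: "s = 1 - q" "0 < s" "s \<le> 1" using q by (auto simp: s_def q_def)
  have r4: "r ^ 4 = q\<^sup>2" by (simp add: q_def)
  have pos: "0 \<le> (1 - a) * (1 - b)" using a b by simp
  have ab: "a * b \<le> 1" using a b by (simp add: mult_le_one)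
  define v where "v = r * x * y / s"
  have v2: "v\<^sup>2 = q * (a * b) / s\<^sup>2" by (simp add: v_def q_def a_def b_def power_mult_distrib power_divide)
  show ?thesis
  proof (cases "q \<le> 1/4")
    case False
    have "\<bar>r * x * y\<bar> \<le> (a + b) / 2"
    proof -
      have "\<bar>r * x * y\<bar> = \<bar>r\<bar> * (\<bar>x\<bar> * \<bar>y\<bar>)" by (simp add: abs_mult)
      also have "\<dots> \<le> 1 * (\<bar>x\<bar> * \<bar>y\<bar>)" using r by (intro mult_right_mono) auto
      also have "\<dots> \<le> (a + b) / 2"
        using abs_mult_le_mean_squares[of x y] by (simp add: a_def b_def abs_mult)
      finally show ?thesis .
    qed
    then have "\<bar>r * x * y\<bar> / s \<le> (a + b) / 2 / s" using s by (intro divide_right_mono) auto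
    then have "\<bar>v\<bar> \<le> (a + b) / 2 / s" using s(2) unfolding v_def abs_divide by simp
    then have "cosh v \<le> exp ((a + b) / (2 * s))" by (intro order.trans[OF cosh_le_exp_abs]) simp
    then have "exp (- (a + b) / (2 * s)) * cosh v \<le> exp (- (a + b) / (2 * s)) * exp ((a + b) / (2 * s))"
      by (intro mult_left_mono) auto
    also have "\<dots> = 1" by (simp only: exp_add[symmetric] minus_divide_left[symmetric] add.left_inverse exp_zero)
    finally have "exp (- (a + b) / (2 * s)) * cosh v / sqrt s \<le> 1 / sqrt s"
      using s by (intro divide_right_mono) auto
    also have "\<dots> \<le> 16 * (q\<^sup>2 / sqrt s)"
    proof -
      have "(1/4)\<^sup>2 \<le> q\<^sup>2" using False by (intro power_mono) auto
      then have "1 / sqrt s \<le> (16 * q\<^sup>2) / sqrt s"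
        using s by (intro divide_right_mono) (auto simp: power2_eq_square)
      then show ?thesis by simp
    qed
    also have "\<dots> \<le> exp (- (a + b) / 2) * (1 + q / 2 * ((1 - a) * (1 - b))) + 16 * (q\<^sup>2 / sqrt s)"
      using q pos by simp
    finally show ?thesis unfolding v_def a_def b_def q_def r4 by simp
  next
    case True
    define t where "t = q / 2 * ((1 - a) * (1 - b)) + 3 * q\<^sup>2"
    have lns: "- ln s / 2 \<le> q / 2 + q\<^sup>2"
      using ln_one_minus_pos_lower_bound[of q] q True s by simp
    have u: "- ((a + b) * q / (2 * s)) \<le> - ((a + b) * q / 2)"
    proof -
      have "(a + b) * q / 2 * s \<le> (a + b) * q / 2 * 1" using a b q s(3) by (intro mult_left_mono) auto
      then have "(a + b) * q / 2 \<le> (a + b) * q / 2 / s" using s(2) by (simp add: le_divide_eq)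
      then show ?thesis by simp
    qed
    have s2: "q / s\<^sup>2 \<le> q + 4 * q\<^sup>2"
    proof -
      have "0 \<le> 2 - 7 * q + 4 * q\<^sup>2" using True zero_le_power2[of q] by linarith
      then have "0 \<le> q\<^sup>2 * (2 - 7 * q + 4 * q\<^sup>2)" by (intro mult_nonneg_nonneg) auto
      moreover have "(q + 4 * q\<^sup>2) * s\<^sup>2 - q = q\<^sup>2 * (2 - 7 * q + 4 * q\<^sup>2)"
        unfolding s(1) by (simp add: power2_eq_square algebra_simps)
      ultimately have "q \<le> (q + 4 * q\<^sup>2) * s\<^sup>2" by linarith
      then show ?thesis using s by (simp add: divide_le_eq)
    qed
    have "v\<^sup>2 / 2 = q / s\<^sup>2 * (a * b) / 2" by (simp add: v2)
    also have "\<dots> \<le> (q + 4 * q\<^sup>2) * (a * b) / 2" using s2 a b by (intro divide_right_mono mult_right_mono) auto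
    also have "\<dots> = q * (a * b) / 2 + 2 * q\<^sup>2 * (a * b)" by (simp add: field_simps)
    also have "\<dots> \<le> q * (a * b) / 2 + 2 * q\<^sup>2" using ab a b q by (simp add: mult_left_le)
    finally have vv: "v\<^sup>2 / 2 \<le> q * (a * b) / 2 + 2 * q\<^sup>2" .
    have sq: "1 / sqrt s = exp (- ln s / 2)"
    proof -
      have "exp (- ln s / 2) = inverse (exp (ln s / 2))" by (simp only: exp_minus minus_divide_left[symmetric])
      also have "ln s / 2 = ln (sqrt s)" using s(2) by (simp only: ln_sqrt)
      finally show ?thesis using s(2) by (simp only: exp_ln real_sqrt_gt_zero divide_inverse mult_1)
    qed
    have E: "- (a + b) / (2 * s) = - (a + b) / 2 + - ((a + b) * q / (2 * s))"
      using s(2) unfolding s(1) by (simp add: field_simps)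
    have "exp (- (a + b) / (2 * s)) * cosh v / sqrt s = exp (- (a + b) / 2) * (exp (- ((a + b) * q / (2 * s))) * cosh v * (1 / sqrt s))"
      unfolding E exp_add by simp
    also have "\<dots> \<le> exp (- (a + b) / 2) * (exp (- ((a + b) * q / 2)) * exp (q * (a * b) / 2 + 2 * q\<^sup>2) * exp (q / 2 + q\<^sup>2))"
    proof -
      have "cosh v \<le> exp (q * (a * b) / 2 + 2 * q\<^sup>2)"
        by (rule order.trans[OF cosh_le_exp_half_square]) (use vv in simp)
      moreover have "1 / sqrt s \<le> exp (q / 2 + q\<^sup>2)" unfolding sq using lns by simp
      moreover have "exp (- ((a + b) * q / (2 * s))) \<le> exp (- ((a + b) * q / 2))" using u by simp
      ultimately show ?thesis
        using s by (intro mult_left_mono[OF mult_mono[OF mult_mono]]) auto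
    qed
    also have "\<dots> = exp (- (a + b) / 2) * exp t"
      unfolding exp_add[symmetric] t_def by (simp add: field_simps)
    also have "\<dots> \<le> exp (- (a + b) / 2) * (1 + q / 2 * ((1 - a) * (1 - b)) + 5 * q\<^sup>2)"
    proof (intro mult_left_mono)
      have le1: "(1 - a) * (1 - b) \<le> 1" using a b by (simp add: mult_le_one)
      have "q * q \<le> q * (1/4)" using q True by (intro mult_left_mono) auto
      moreover have "q * ((1 - a) * (1 - b)) \<le> q * 1" using le1 q by (intro mult_left_mono) auto
      ultimately have t: "0 \<le> t" "t \<le> 5/4 * q" using pos q by (auto simp: t_def power2_eq_square)
      then have "t \<le> 1" using True by simp
      then have "exp t \<le> 1 + t + t\<^sup>2" using exp_bound t by blast
      moreover have "t\<^sup>2 \<le> (5/4 * q)\<^sup>2" using t by (intro power_mono) auto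
      moreover have "(5/4 * q)\<^sup>2 \<le> 2 * q\<^sup>2" by (simp add: power2_eq_square)
      ultimately show "exp t \<le> 1 + q / 2 * ((1 - a) * (1 - b)) + 5 * q\<^sup>2" by (simp add: t_def)
    qed auto
    also have "\<dots> \<le> exp (- (a + b) / 2) * (1 + q / 2 * ((1 - a) * (1 - b))) + 1 * (5 * q\<^sup>2)"
      using a b by (simp add: distrib_left mult_left_le_one_le)
    also have "1 * (5 * q\<^sup>2) \<le> 16 * (q\<^sup>2 / sqrt s)"
    proof -
      have "q\<^sup>2 * sqrt s \<le> q\<^sup>2 * 1" using s by (intro mult_left_mono) auto
      then have "q\<^sup>2 \<le> q\<^sup>2 / sqrt s" using s by (simp add: le_divide_eq)
      then show ?thesis using zero_le_power2[of q] by linarith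
    qed
    finally show ?thesis unfolding v_def a_def b_def q_def r4 by simp
  qed
qed

section \<open>The residual after projecting on the second chaos\<close>

definition window :: "real \<Rightarrow> real \<Rightarrow> real" where
  "window \<epsilon> t = indicator {-\<epsilon><..<\<epsilon>} t / (2 * \<epsilon>)"

definition window_measure :: "real \<Rightarrow> real measure" where
  "window_measure \<epsilon> = density lborel (\<lambda>t. ennreal (window \<epsilon> t))"

text \<open>The coefficients of the window on the Hermite polynomials \<open>1\<close> and \<open>1 - t\<^sup>2\<close>, and what
  remains of it.\<close>

definition hermite0 :: "real \<Rightarrow> real" where
  "hermite0 \<epsilon> = (\<integral>t. window \<epsilon> t \<partial>std_normal_distribution)"

definition hermite2 :: "real \<Rightarrow> real" where
  "hermite2 \<epsilon> = (\<integral>t. window \<epsilon> t * (1 - t\<^sup>2) \<partial>std_normal_distribution)"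

definition resid :: "real \<Rightarrow> real \<Rightarrow> real" where
  "resid \<epsilon> t = window \<epsilon> t - hermite0 \<epsilon> + hermite2 \<epsilon> / 2 * (t\<^sup>2 - 1)"

lemma window_measurable [measurable]: "window \<epsilon> \<in> borel_measurable borel"
  unfolding window_def by measurable

lemma resid_measurable [measurable]: "resid \<epsilon> \<in> borel_measurable borel"
  unfolding resid_def by measurable

lemma sets_window_measure [measurable_cong, simp]: "sets (window_measure \<epsilon>) = sets borel"
  and space_window_measure [simp]: "space (window_measure \<epsilon>) = UNIV"
  by (simp_all add: window_measure_def)

lemma window_nonneg: "\<epsilon> > 0 \<Longrightarrow> 0 \<le> window \<epsilon> t"
  by (simp add: window_def)

lemma window_le: "\<epsilon> > 0 \<Longrightarrow> window \<epsilon> t \<le> 1 / (2 * \<epsilon>)"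
  by (simp add: window_def indicator_def)

lemma prob_space_window_measure:
  assumes "\<epsilon> > 0" shows "prob_space (window_measure \<epsilon>)"
proof (rule prob_spaceI)
  have "emeasure (window_measure \<epsilon>) (space (window_measure \<epsilon>)) = (\<integral>\<^sup>+t. ennreal (1 / (2 * \<epsilon>)) * indicator {-\<epsilon><..<\<epsilon>} t \<partial>lborel)"
    unfolding window_measure_def by (subst emeasure_density) (auto intro!: nn_integral_cong simp: window_def indicator_def)
  also have "\<dots> = ennreal (1 / (2 * \<epsilon>)) * ennreal (2 * \<epsilon>)"
    using assms by (subst nn_integral_cmult_indicator) auto
  also have "\<dots> = 1" using assms by (simp add: ennreal_mult[symmetric] del: ennreal_mult)
  finally show "emeasure (window_measure \<epsilon>) (space (window_measure \<epsilon>)) = 1" .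
qed

lemma AE_window_measure: "\<epsilon> > 0 \<Longrightarrow> AE t in window_measure \<epsilon>. \<bar>t\<bar> < \<epsilon>"
  unfolding window_measure_def by (subst AE_density) (auto simp: window_def indicator_def)

lemma nn_integral_window_measure:
  assumes "\<epsilon> > 0" and [measurable]: "f \<in> borel_measurable borel"
  shows "(\<integral>\<^sup>+t. f t \<partial>window_measure \<epsilon>) = (\<integral>\<^sup>+t. ennreal (window \<epsilon> t) * f t \<partial>lborel)"
  unfolding window_measure_def by (rule nn_integral_density) measurable

lemma nn_integral_window_measure_even:
  assumes "\<epsilon> > 0" and [measurable]: "f \<in> borel_measurable borel"
  shows "(\<integral>\<^sup>+t. f (- t) \<partial>window_measure \<epsilon>) = (\<integral>\<^sup>+t. f t \<partial>window_measure \<epsilon>)"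
proof -
  have "window \<epsilon> (- t) = window \<epsilon> t" for t by (auto simp: window_def indicator_def)
  then show ?thesis
    using assms(1) by (simp add: nn_integral_window_measure)
      (subst (2) nn_integral_real_affine[where c = "-1" and t = 0], auto)
qed

lemma integral_std_window:
  assumes "\<epsilon> > 0" and [measurable]: "g \<in> borel_measurable borel"
  shows "(\<integral>t. window \<epsilon> t * g t \<partial>std_normal_distribution) = (\<integral>t. std_normal_density t * g t \<partial>window_measure \<epsilon>)"
proof -
  have "(\<integral>t. window \<epsilon> t * g t \<partial>std_normal_distribution) = (\<integral>t. std_normal_density t *\<^sub>R (window \<epsilon> t * g t) \<partial>lborel)"
    by (rule integral_density) auto
  also have "\<dots> = (\<integral>t. window \<epsilon> t *\<^sub>R (std_normal_density t * g t) \<partial>lborel)"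
    by (simp add: mult_ac)
  also have "\<dots> = (\<integral>t. std_normal_density t * g t \<partial>window_measure \<epsilon>)"
    unfolding window_measure_def using window_nonneg[OF assms(1)] by (intro integral_density[symmetric]) auto
  finally show ?thesis .
qed

lemma std_normal_density_le_1: "std_normal_density t \<le> 1"
proof -
  have "1 \<le> sqrt (2 * pi)" using pi_gt3 by simp
  then have "1 / sqrt (2 * pi) * exp (- t\<^sup>2 / 2) \<le> 1 * 1" by (intro mult_mono) auto
  then show ?thesis by (simp add: std_normal_density_def)
qed

lemma bivariate_density_sum_le:
  fixes x y r :: real
  assumes x: "\<bar>x\<bar> \<le> 1" and y: "\<bar>y\<bar> \<le> 1" and r: "\<bar>r\<bar> < 1"
  defines "s \<equiv> sqrt (1 - r\<^sup>2)"
  shows "std_normal_density x * std_normal_density ((y - r * x) / s) / s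
      + std_normal_density x * std_normal_density ((- y - r * x) / s) / s
    \<le> 2 * (std_normal_density x * std_normal_density y
        + r\<^sup>2 / 2 * ((std_normal_density x * (1 - x\<^sup>2)) * (std_normal_density y * (1 - y\<^sup>2))) + 3 * (r ^ 4 / s))"
proof -
  have S: "1 - r\<^sup>2 > 0" using r by (simp add: abs_square_less_1)
  then have s: "s > 0" "s\<^sup>2 = 1 - r\<^sup>2" by (simp_all add: s_def)
  have e: "std_normal_density x * std_normal_density ((z - r * x) / s) =
      1 / (2 * pi) * (exp (- (x\<^sup>2 + z\<^sup>2) / (2 * s\<^sup>2)) * exp (r * x * z / s\<^sup>2))" for z
  proof -
    have "x\<^sup>2 * s\<^sup>2 + (z - r * x)\<^sup>2 = x\<^sup>2 + z\<^sup>2 - 2 * r * x * z"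
      unfolding s(2) by (simp add: power2_eq_square algebra_simps)
    then have "- x\<^sup>2 / 2 + - ((z - r * x) / s)\<^sup>2 / 2 = - (x\<^sup>2 + z\<^sup>2) / (2 * s\<^sup>2) + r * x * z / s\<^sup>2"
      using s(1) by (simp add: power_divide field_simps)
    then have "exp (- x\<^sup>2 / 2) * exp (- ((z - r * x) / s)\<^sup>2 / 2) = exp (- (x\<^sup>2 + z\<^sup>2) / (2 * s\<^sup>2)) * exp (r * x * z / s\<^sup>2)"
      by (simp only: exp_add[symmetric])
    moreover have "1 / sqrt (2 * pi) * (1 / sqrt (2 * pi)) = 1 / (2 * pi)" by simp
    ultimately show ?thesis unfolding std_normal_density_def by (simp add: mult_ac)
  qed
  have "std_normal_density x * std_normal_density ((y - r * x) / s) / s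
      + std_normal_density x * std_normal_density ((- y - r * x) / s) / s
    = 1 / pi * (exp (- (x\<^sup>2 + y\<^sup>2) / (2 * (1 - r\<^sup>2))) * cosh (r * x * y / (1 - r\<^sup>2)) / sqrt (1 - r\<^sup>2))"
    unfolding e cosh_def s(2) s_def[symmetric] using s(1) by (simp add: field_simps)
  also have "\<dots> \<le> 1 / pi * (exp (- (x\<^sup>2 + y\<^sup>2) / 2) * (1 + r\<^sup>2 / 2 * ((1 - x\<^sup>2) * (1 - y\<^sup>2))) + 16 * (r ^ 4 / sqrt (1 - r\<^sup>2)))"
    using bivariate_kernel_bound[OF x y r] by (intro mult_left_mono) auto
  also have "\<dots> = 1 / pi * exp (- (x\<^sup>2 + y\<^sup>2) / 2) * (1 + r\<^sup>2 / 2 * ((1 - x\<^sup>2) * (1 - y\<^sup>2))) + 16 / pi * (r ^ 4 / s)"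
    by (simp add: s_def distrib_left)
  also have "1 / pi * exp (- (x\<^sup>2 + y\<^sup>2) / 2) = 2 * (std_normal_density x * std_normal_density y)"
    by (simp add: std_normal_density_def add_divide_distrib diff_divide_distrib exp_add[symmetric] real_sqrt_mult[symmetric])
  also have "16 / pi * (r ^ 4 / s) \<le> 6 * (r ^ 4 / s)"
    using pi_gt3 s(1) by (intro mult_right_mono) (auto simp: divide_le_eq)
  finally show ?thesis by (simp add: algebra_simps)
qed

lemma bounded_integrable_window:
  fixes B :: real
  assumes "\<epsilon> > 0" "f \<in> borel_measurable borel" "\<And>t. \<bar>t\<bar> < \<epsilon> \<Longrightarrow> \<bar>f t\<bar> \<le> B"
  shows "integrable (window_measure \<epsilon>) f"
proof -
  interpret W: prob_space "window_measure \<epsilon>" by (rule prob_space_window_measure[OF assms(1)])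
  show ?thesis
    using AE_window_measure[OF assms(1)] assms(2,3)
    by (intro W.integrable_const_bound[where B = B]) (auto elim!: eventually_mono)
qed

lemma hermite0_eq: "\<epsilon> > 0 \<Longrightarrow> hermite0 \<epsilon> = (\<integral>t. std_normal_density t \<partial>window_measure \<epsilon>)"
  unfolding hermite0_def using integral_std_window[of \<epsilon> "\<lambda>_. 1"] by simp

lemma hermite2_eq: "\<epsilon> > 0 \<Longrightarrow> hermite2 \<epsilon> = (\<integral>t. std_normal_density t * (1 - t\<^sup>2) \<partial>window_measure \<epsilon>)"
  unfolding hermite2_def by (rule integral_std_window) auto

text \<open>The mean of \<open>window X * window Y\<close> is an average of the bivariate density over a small square. As
  the window is even, the density may be symmetrised in \<open>y\<close>.\<close>

lemma nn_integral_window_pair_le: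
  assumes eps: "0 < \<epsilon>" "\<epsilon> \<le> 1" and r: "\<bar>r\<bar> < 1"
  shows "(\<integral>\<^sup>+z. ennreal (window \<epsilon> (fst z) * window \<epsilon> (r * fst z + sqrt (1 - r\<^sup>2) * snd z))
      \<partial>(std_normal_distribution \<Otimes>\<^sub>M std_normal_distribution))
    \<le> ennreal ((hermite0 \<epsilon>)\<^sup>2 + r\<^sup>2 / 2 * (hermite2 \<epsilon>)\<^sup>2 + 3 * (r ^ 4 / sqrt (1 - r\<^sup>2)))"
    (is "?L \<le> _")
proof -
  let ?f = std_normal_density and ?W = "window_measure \<epsilon>"
  interpret W: prob_space ?W by (rule prob_space_window_measure[OF eps(1)])
  define s where "s = sqrt (1 - r\<^sup>2)"
  have s: "s > 0" using r by (simp add: s_def abs_square_less_1)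
  have wn: "0 \<le> window \<epsilon> t" for t by (rule window_nonneg[OF eps(1)])
  define K where "K x y = ?f x * ?f ((y - r * x) / s) / s" for x y
  have Kn: "0 \<le> K x y" for x y using s by (simp add: K_def)
  have [measurable]: "(\<lambda>y. K x y) \<in> borel_measurable borel" for x unfolding K_def by measurable
  have [measurable]: "(\<lambda>z. K (fst z) (snd z)) \<in> borel_measurable (borel \<Otimes>\<^sub>M borel)" unfolding K_def by measurable
  have mK: "(\<lambda>x. \<integral>\<^sup>+y. ennreal (K x y) \<partial>?W) \<in> borel_measurable borel"
    "(\<lambda>x. \<integral>\<^sup>+y. ennreal (K x (- y)) \<partial>?W) \<in> borel_measurable borel"
    by (rule W.borel_measurable_nn_integral; simp add: K_def split_def)+
  have "?L = (\<integral>\<^sup>+x. \<integral>\<^sup>+w. ennreal (window \<epsilon> x * window \<epsilon> (r * x + s * w)) \<partial>std_normal_distribution \<partial>std_normal_distribution)"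
    unfolding s_def by (subst std_normal.nn_integral_fst[symmetric]) auto
  also have "\<dots> = (\<integral>\<^sup>+x. ennreal (?f x) * (\<integral>\<^sup>+w. ennreal (?f w) * ennreal (window \<epsilon> x * window \<epsilon> (r * x + s * w)) \<partial>lborel) \<partial>lborel)"
    by (simp add: nn_integral_density)
  also have "\<dots> = (\<integral>\<^sup>+x. ennreal (window \<epsilon> x) * (\<integral>\<^sup>+y. ennreal (window \<epsilon> y) * ennreal (K x y) \<partial>lborel) \<partial>lborel)"
  proof (rule nn_integral_cong)
    fix x
    have "(\<integral>\<^sup>+y. ennreal (window \<epsilon> y) * ennreal (K x y) \<partial>lborel) =
        ennreal s * (\<integral>\<^sup>+w. ennreal (window \<epsilon> (r * x + s * w)) * ennreal (K x (r * x + s * w)) \<partial>lborel)"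
      using s by (subst nn_integral_real_affine[where c = s and t = "r * x"]) auto
    also have "\<dots> = (\<integral>\<^sup>+w. ennreal (?f x) * (ennreal (?f w) * ennreal (window \<epsilon> (r * x + s * w))) \<partial>lborel)"
      using s wn by (subst nn_integral_cmult[symmetric])
        (auto intro!: nn_integral_cong simp: K_def ennreal_mult[symmetric] mult_ac simp del: ennreal_mult)
    finally have "ennreal (window \<epsilon> x) * (\<integral>\<^sup>+y. ennreal (window \<epsilon> y) * ennreal (K x y) \<partial>lborel) =
      ennreal (window \<epsilon> x) * (ennreal (?f x) * (\<integral>\<^sup>+w. ennreal (?f w) * ennreal (window \<epsilon> (r * x + s * w)) \<partial>lborel))"
      by (simp add: nn_integral_cmult)
    also have "\<dots> = ennreal (?f x) * (\<integral>\<^sup>+w. ennreal (?f w) * ennreal (window \<epsilon> x * window \<epsilon> (r * x + s * w)) \<partial>lborel)"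
      using wn by (simp add: ennreal_mult nn_integral_cmult[symmetric] mult_ac)
    finally show "ennreal (?f x) * (\<integral>\<^sup>+w. ennreal (?f w) * ennreal (window \<epsilon> x * window \<epsilon> (r * x + s * w)) \<partial>lborel) =
      ennreal (window \<epsilon> x) * (\<integral>\<^sup>+y. ennreal (window \<epsilon> y) * ennreal (K x y) \<partial>lborel)" by (rule sym)
  qed
  also have "\<dots> = (\<integral>\<^sup>+x. \<integral>\<^sup>+y. ennreal (K x y) \<partial>?W \<partial>?W)" (is "_ = ?I")
    using eps(1) mK by (simp add: nn_integral_window_measure)
  finally have L: "?L = ?I" .
  have even: "(\<integral>\<^sup>+y. ennreal (K x (- y)) \<partial>?W) = (\<integral>\<^sup>+y. ennreal (K x y) \<partial>?W)" for x
    using eps(1) by (intro nn_integral_window_measure_even[where f = "\<lambda>y. ennreal (K x y)"]) auto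
  define c where "c = 3 * (r ^ 4 / s)"
  have c: "0 \<le> c" using s by (simp add: c_def)
  define g where "g t = ?f t * (1 - t\<^sup>2)" for t
  have [measurable]: "g \<in> borel_measurable borel" unfolding g_def by measurable
  define B where "B x y = ?f x * ?f y + r\<^sup>2 / 2 * (g x * g y) + c" for x y
  have small: "\<bar>t\<bar> \<le> 1" "t\<^sup>2 \<le> 1" if "\<bar>t\<bar> < \<epsilon>" for t
    using that eps by (auto simp: abs_square_le_1)
  have g0: "0 \<le> g t" if "\<bar>t\<bar> < \<epsilon>" for t using small[OF that] by (simp add: g_def)
  have if0: "integrable ?W ?f"
    by (rule bounded_integrable_window[OF eps(1), of _ 1]) (auto simp: std_normal_density_le_1)
  have ig: "integrable ?W g"
  proof (rule bounded_integrable_window[OF eps(1), of _ 1])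
    fix t assume t: "\<bar>t\<bar> < \<epsilon>"
    have "?f t * (1 - t\<^sup>2) \<le> 1 * 1" using small[OF t] by (intro mult_mono std_normal_density_le_1) auto
    then show "\<bar>g t\<bar> \<le> 1" using g0[OF t] by (simp add: g_def)
  qed measurable
  have Bn: "0 \<le> B x y" if "\<bar>x\<bar> < \<epsilon>" "\<bar>y\<bar> < \<epsilon>" for x y
    using g0[OF that(1)] g0[OF that(2)] c by (auto simp: B_def intro!: add_nonneg_nonneg mult_nonneg_nonneg)
  have inner: "(\<integral>\<^sup>+y. ennreal (B x y) \<partial>?W) = ennreal (?f x * hermite0 \<epsilon> + r\<^sup>2 / 2 * (g x * hermite2 \<epsilon>) + c)" if "\<bar>x\<bar> < \<epsilon>" for x
  proof -
    have "(\<integral>\<^sup>+y. ennreal (B x y) \<partial>?W) = ennreal (\<integral>y. B x y \<partial>?W)"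
    proof (rule nn_integral_eq_integral)
      show "integrable ?W (B x)" unfolding B_def using if0 ig by simp
      show "AE y in ?W. 0 \<le> B x y" using AE_window_measure[OF eps(1)] by eventually_elim (rule Bn[OF that])
    qed
    also have "(\<integral>y. B x y \<partial>?W) = ?f x * hermite0 \<epsilon> + r\<^sup>2 / 2 * (g x * hermite2 \<epsilon>) + c"
      unfolding B_def hermite0_eq[OF eps(1)] hermite2_eq[OF eps(1)] g_def[symmetric]
      using if0 ig by (simp add: W.prob_space[simplified])
    finally show ?thesis .
  qed
  have h2: "0 \<le> hermite2 \<epsilon>" "0 \<le> hermite0 \<epsilon>"
    unfolding hermite0_eq[OF eps(1)] hermite2_eq[OF eps(1)] g_def[symmetric]
    using AE_window_measure[OF eps(1)] by (auto intro!: integral_nonneg_AE elim!: eventually_mono simp: g0)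
  have outer: "(\<integral>\<^sup>+x. \<integral>\<^sup>+y. ennreal (B x y) \<partial>?W \<partial>?W) = ennreal ((hermite0 \<epsilon>)\<^sup>2 + r\<^sup>2 / 2 * (hermite2 \<epsilon>)\<^sup>2 + c)"
  proof -
    have "(\<integral>\<^sup>+x. \<integral>\<^sup>+y. ennreal (B x y) \<partial>?W \<partial>?W) = (\<integral>\<^sup>+x. ennreal (?f x * hermite0 \<epsilon> + r\<^sup>2 / 2 * (g x * hermite2 \<epsilon>) + c) \<partial>?W)"
      using AE_window_measure[OF eps(1)] by (intro nn_integral_cong_AE) (auto elim!: eventually_mono simp: inner)
    also have "\<dots> = ennreal (\<integral>x. ?f x * hermite0 \<epsilon> + r\<^sup>2 / 2 * (g x * hermite2 \<epsilon>) + c \<partial>?W)"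
    proof (rule nn_integral_eq_integral)
      show "integrable ?W (\<lambda>x. ?f x * hermite0 \<epsilon> + r\<^sup>2 / 2 * (g x * hermite2 \<epsilon>) + c)" using if0 ig by simp
      show "AE x in ?W. 0 \<le> ?f x * hermite0 \<epsilon> + r\<^sup>2 / 2 * (g x * hermite2 \<epsilon>) + c"
        using AE_window_measure[OF eps(1)] by eventually_elim (use g0 h2 c in \<open>auto intro!: add_nonneg_nonneg mult_nonneg_nonneg\<close>)
    qed
    also have "(\<integral>x. ?f x * hermite0 \<epsilon> + r\<^sup>2 / 2 * (g x * hermite2 \<epsilon>) + c \<partial>?W) = (\<integral>x. ?f x \<partial>?W) * hermite0 \<epsilon> + r\<^sup>2 / 2 * ((\<integral>x. g x \<partial>?W) * hermite2 \<epsilon>) + c"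
      using if0 ig by (simp add: W.prob_space[simplified])
    also have "\<dots> = (hermite0 \<epsilon>)\<^sup>2 + r\<^sup>2 / 2 * (hermite2 \<epsilon>)\<^sup>2 + c"
      unfolding hermite0_eq[OF eps(1)] hermite2_eq[OF eps(1)] g_def[symmetric] by (simp add: power2_eq_square)
    finally show ?thesis .
  qed
  have mB: "(\<lambda>x. \<integral>\<^sup>+y. ennreal (B x y) \<partial>?W) \<in> borel_measurable borel"
    by (rule W.borel_measurable_nn_integral) (simp add: B_def split_def)
  have "2 * ?I = ?I + (\<integral>\<^sup>+x. \<integral>\<^sup>+y. ennreal (K x (- y)) \<partial>?W \<partial>?W)"
    by (simp add: even mult_2)
  also have "\<dots> = (\<integral>\<^sup>+x. (\<integral>\<^sup>+y. ennreal (K x y) \<partial>?W) + (\<integral>\<^sup>+y. ennreal (K x (- y)) \<partial>?W) \<partial>?W)"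
    using mK by (intro nn_integral_add[symmetric]) auto
  also have "\<dots> = (\<integral>\<^sup>+x. \<integral>\<^sup>+y. ennreal (K x y + K x (- y)) \<partial>?W \<partial>?W)"
    using Kn by (intro nn_integral_cong) (simp add: nn_integral_add[symmetric])
  also have "\<dots> \<le> (\<integral>\<^sup>+x. \<integral>\<^sup>+y. ennreal (2 * B x y) \<partial>?W \<partial>?W)"
  proof (intro nn_integral_mono_AE)
    show "AE x in ?W. (\<integral>\<^sup>+y. ennreal (K x y + K x (- y)) \<partial>?W) \<le> (\<integral>\<^sup>+y. ennreal (2 * B x y) \<partial>?W)"
      using AE_window_measure[OF eps(1)]
    proof eventually_elim
      case (elim x)
      show ?case
      proof (intro nn_integral_mono_AE)
        show "AE y in ?W. ennreal (K x y + K x (- y)) \<le> ennreal (2 * B x y)"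
          using AE_window_measure[OF eps(1)]
        proof eventually_elim
          case (elim y)
          show ?case
            using bivariate_density_sum_le[OF small(1)[OF \<open>\<bar>x\<bar> < \<epsilon>\<close>] small(1)[OF \<open>\<bar>y\<bar> < \<epsilon>\<close>] r]
            unfolding K_def B_def g_def c_def s_def by (intro ennreal_leI)
        qed
      qed
    qed
  qed
  also have "\<dots> = 2 * (\<integral>\<^sup>+x. \<integral>\<^sup>+y. ennreal (B x y) \<partial>?W \<partial>?W)"
  proof -
    have [measurable]: "B x \<in> borel_measurable borel" for x unfolding B_def by measurable
    show ?thesis using mB by (simp add: ennreal_mult' nn_integral_cmult)
  qed
  finally have "2 * ?I \<le> 2 * ennreal ((hermite0 \<epsilon>)\<^sup>2 + r\<^sup>2 / 2 * (hermite2 \<epsilon>)\<^sup>2 + c)" unfolding outer .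
  then have "?I \<le> ennreal ((hermite0 \<epsilon>)\<^sup>2 + r\<^sup>2 / 2 * (hermite2 \<epsilon>)\<^sup>2 + c)"
    by (subst (asm) ennreal_mult_le_mult_iff) auto
  then show ?thesis unfolding L c_def s_def .
qed

lemma std_normal_moments:
  "(\<integral>x. x \<partial>std_normal_distribution) = 0"
  "(\<integral>x. x\<^sup>2 \<partial>std_normal_distribution) = 1"
  "(\<integral>x. x ^ 4 \<partial>std_normal_distribution) = 3"
  using integral_std_normal_distribution_moment_odd[of 1]
    std_normal_distribution_even_moments(1)[of 1] std_normal_distribution_even_moments(1)[of 2]
  by (simp_all add: fact_numeral eval_nat_numeral)

lemma std_normal_integrable_powers [simp]:
  "integrable std_normal_distribution (\<lambda>x. x)"
  "integrable std_normal_distribution (\<lambda>x. x ^ k)"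
  using integrable_std_normal_distribution_moment[of 1] integrable_std_normal_distribution_moment[of k] by simp_all

lemma integral_pair_product:
  fixes f :: "'a \<Rightarrow> real" and g :: "'b \<Rightarrow> real"
  assumes "prob_space M1" "prob_space M2" and f: "integrable M1 f" and g: "integrable M2 g"
  shows "integrable (M1 \<Otimes>\<^sub>M M2) (\<lambda>z. f (fst z) * g (snd z))"
    and "(\<integral>z. f (fst z) * g (snd z) \<partial>(M1 \<Otimes>\<^sub>M M2)) = (\<integral>x. f x \<partial>M1) * (\<integral>x. g x \<partial>M2)"
proof -
  interpret M1: prob_space M1 by fact
  interpret M2: prob_space M2 by fact
  interpret SS: pair_prob_space M1 M2 ..
  have [measurable]: "f \<in> borel_measurable M1" "g \<in> borel_measurable M2"
    using borel_measurable_integrable[OF f] borel_measurable_integrable[OF g] by simp_all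
  have *: "integrable (M1 \<Otimes>\<^sub>M M2) (\<lambda>(x, y). f x * g y)"
  proof (rule SS.Fubini_integrable)
    show "integrable M1 (\<lambda>x. \<integral>y. norm (case (x, y) of (x, y) \<Rightarrow> f x * g y) \<partial>M2)"
      using f g by (simp add: abs_mult)
    show "AE x in M1. integrable M2 (\<lambda>y. case (x, y) of (x, y) \<Rightarrow> f x * g y)"
      using g by simp
  qed measurable
  then show "integrable (M1 \<Otimes>\<^sub>M M2) (\<lambda>z. f (fst z) * g (snd z))"
    by (simp add: split_def)
  from SS.integral_fst'[OF *]
  show "(\<integral>z. f (fst z) * g (snd z) \<partial>(M1 \<Otimes>\<^sub>M M2)) = (\<integral>x. f x \<partial>M1) * (\<integral>x. g x \<partial>M2)"
    by (simp add: split_def)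
qed

lemmas integral_std_pair_product =
  integral_pair_product[OF std_normal.prob_space_axioms std_normal.prob_space_axioms]

text \<open>The law of a pair of standard Gaussian variables with correlation \<open>r\<close>.\<close>

abbreviation gaussian_pair :: "'a measure \<Rightarrow> real \<Rightarrow> ('a \<Rightarrow> real) \<Rightarrow> ('a \<Rightarrow> real) \<Rightarrow> bool" where
  "gaussian_pair M r X Y \<equiv> distr M (borel \<Otimes>\<^sub>M borel) (\<lambda>x. (X x, Y x)) =
    distr (std_normal_distribution \<Otimes>\<^sub>M std_normal_distribution) (borel \<Otimes>\<^sub>M borel)
      (\<lambda>z. (fst z, r * fst z + sqrt (1 - r\<^sup>2) * snd z))"

lemma gaussian_pair_integral:
  fixes F :: "real \<times> real \<Rightarrow> real"
  assumes [measurable]: "X \<in> borel_measurable M" "Y \<in> borel_measurable M" "F \<in> borel_measurable (borel \<Otimes>\<^sub>M borel)"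
    and law: "gaussian_pair M r X Y"
  shows "integrable M (\<lambda>x. F (X x, Y x)) \<longleftrightarrow>
      integrable (std_normal_distribution \<Otimes>\<^sub>M std_normal_distribution) (\<lambda>z. F (fst z, r * fst z + sqrt (1 - r\<^sup>2) * snd z))"
    and "(\<integral>x. F (X x, Y x) \<partial>M) =
      (\<integral>z. F (fst z, r * fst z + sqrt (1 - r\<^sup>2) * snd z) \<partial>(std_normal_distribution \<Otimes>\<^sub>M std_normal_distribution))"
proof -
  have 1: "integrable M (\<lambda>x. F (X x, Y x)) \<longleftrightarrow> integrable (distr M (borel \<Otimes>\<^sub>M borel) (\<lambda>x. (X x, Y x))) F"
    by (rule integrable_distr_eq[symmetric]) measurable
  have 2: "(\<integral>x. F (X x, Y x) \<partial>M) = integral\<^sup>L (distr M (borel \<Otimes>\<^sub>M borel) (\<lambda>x. (X x, Y x))) F"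
    by (rule integral_distr[symmetric]) measurable
  show "integrable M (\<lambda>x. F (X x, Y x)) \<longleftrightarrow>
      integrable (std_normal_distribution \<Otimes>\<^sub>M std_normal_distribution) (\<lambda>z. F (fst z, r * fst z + sqrt (1 - r\<^sup>2) * snd z))"
    unfolding 1 law by (rule integrable_distr_eq) measurable
  show "(\<integral>x. F (X x, Y x) \<partial>M) =
      (\<integral>z. F (fst z, r * fst z + sqrt (1 - r\<^sup>2) * snd z) \<partial>(std_normal_distribution \<Otimes>\<^sub>M std_normal_distribution))"
    unfolding 2 law by (rule integral_distr) measurable
qed

lemma gaussian_pair_fst:
  fixes f :: "real \<Rightarrow> real"
  assumes "X \<in> borel_measurable M" "Y \<in> borel_measurable M"
    and law: "gaussian_pair M r X Y" and f: "integrable std_normal_distribution f"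
  shows "integrable M (\<lambda>x. f (X x))" "(\<integral>x. f (X x) \<partial>M) = (\<integral>x. f x \<partial>std_normal_distribution)"
proof -
  have [measurable]: "f \<in> borel_measurable borel" using borel_measurable_integrable[OF f] by simp
  have F: "(\<lambda>z. f (fst z)) \<in> borel_measurable (borel \<Otimes>\<^sub>M borel)" by measurable
  show "integrable M (\<lambda>x. f (X x))" "(\<integral>x. f (X x) \<partial>M) = (\<integral>x. f x \<partial>std_normal_distribution)"
    using gaussian_pair_integral[OF assms(1,2) F law] integral_std_pair_product[OF f, of "\<lambda>_. 1"]
      std_normal.prob_space by simp_all
qed

lemma gaussian_pair_hermite2:
  fixes f :: "real \<Rightarrow> real"
  assumes "X \<in> borel_measurable M" "Y \<in> borel_measurable M"
    and law: "gaussian_pair M r X Y" and r: "\<bar>r\<bar> \<le> 1"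
    and f: "integrable std_normal_distribution f"
      "integrable std_normal_distribution (\<lambda>x. f x * x)" "integrable std_normal_distribution (\<lambda>x. f x * x\<^sup>2)"
  shows "integrable M (\<lambda>x. f (X x) * ((Y x)\<^sup>2 - 1))"
    and "(\<integral>x. f (X x) * ((Y x)\<^sup>2 - 1) \<partial>M) = r\<^sup>2 * (\<integral>x. f x * (x\<^sup>2 - 1) \<partial>std_normal_distribution)"
proof -
  let ?SS = "std_normal_distribution \<Otimes>\<^sub>M std_normal_distribution"
  have [measurable]: "f \<in> borel_measurable borel" using borel_measurable_integrable[OF f(1)] by simp
  define s where "s = sqrt (1 - r\<^sup>2)"
  have s: "s\<^sup>2 = 1 - r\<^sup>2" using r by (simp add: s_def abs_square_le_1)
  let ?H = "\<lambda>x::real. x\<^sup>2 - 1"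
  have iH: "integrable std_normal_distribution ?H" by simp
  have ifH: "integrable std_normal_distribution (\<lambda>x. f x * ?H x)" using f by (simp add: right_diff_distrib)
  have EH: "(\<integral>x. ?H x \<partial>std_normal_distribution) = 0"
    using std_normal.prob_space by (simp add: std_normal_moments)
  note p1 = integral_std_pair_product[OF ifH, of "\<lambda>_. 1", simplified]
  note p2 = integral_std_pair_product[OF f(2), of "\<lambda>w. w", simplified]
  note p3 = integral_std_pair_product[OF f(1) iH]
  have eq: "f x * ?H (r * x + s * w) = r\<^sup>2 * (f x * ?H x) + 2 * r * s * (f x * x * w) + s\<^sup>2 * (f x * ?H w)" for x w
  proof -
    have "?H (r * x + s * w) = r\<^sup>2 * ?H x + 2 * r * s * (x * w) + s\<^sup>2 * ?H w + (r\<^sup>2 + s\<^sup>2 - 1)"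
      by (simp add: power2_eq_square algebra_simps)
    also have "r\<^sup>2 + s\<^sup>2 - 1 = 0" using s by simp
    finally have h: "?H (r * x + s * w) = r\<^sup>2 * ?H x + 2 * r * s * (x * w) + s\<^sup>2 * ?H w" by simp
    show ?thesis unfolding h by (simp only: distrib_left mult_ac)
  qed
  have F: "(\<lambda>z. f (fst z) * ?H (snd z)) \<in> borel_measurable (borel \<Otimes>\<^sub>M borel)" by measurable
  note G = gaussian_pair_integral[OF assms(1,2) F law, folded s_def, simplified]
  show "integrable M (\<lambda>x. f (X x) * ?H (Y x))"
    using p1(1) p2(1) p3(1) unfolding G(1) eq by simp
  show "(\<integral>x. f (X x) * ?H (Y x) \<partial>M) = r\<^sup>2 * (\<integral>x. f x * ?H x \<partial>std_normal_distribution)"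
    using p1 p2 p3 EH std_normal.prob_space unfolding G(2) eq by (simp add: std_normal_moments)
qed

lemma window_integrable_std:
  assumes "\<epsilon> > 0" shows "integrable std_normal_distribution (\<lambda>t. window \<epsilon> t * t ^ k)"
proof (rule Bochner_Integration.integrable_bound)
  show "integrable std_normal_distribution (\<lambda>t. 1 / (2 * \<epsilon>) * t ^ k)" by simp
  show "AE t in std_normal_distribution. norm (window \<epsilon> t * t ^ k) \<le> norm (1 / (2 * \<epsilon>) * t ^ k)"
    using window_le[OF assms] window_nonneg[OF assms] assms
    by (intro AE_I2) (auto simp: abs_mult intro!: mult_right_mono simp del: times_divide_eq_left)
qed measurable

text \<open>The second Hermite polynomial is an eigenfunction: its correlation with anything
  is multiplied by \<open>r\<^sup>2\<close>. So removing the projections cancels exactly the first two terms of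
  the kernel expansion.\<close>

lemma resid_pair:
  assumes "prob_space M" and m[measurable]: "X \<in> borel_measurable M" "Y \<in> borel_measurable M"
    and law: "gaussian_pair M r X Y" and law': "gaussian_pair M r Y X"
    and r: "\<bar>r\<bar> < 1" and eps: "0 < \<epsilon>" "\<epsilon> \<le> 1"
  shows "(\<integral>x. resid \<epsilon> (X x) * resid \<epsilon> (Y x) \<partial>M) \<le> 3 * (r ^ 4 / sqrt (1 - r\<^sup>2))"
proof -
  interpret prob_space M by fact
  let ?w = "window \<epsilon>" and ?H = "\<lambda>t::real. t\<^sup>2 - 1"
  define c0 c2 where "c0 = hermite0 \<epsilon>" and "c2 = hermite2 \<epsilon>"
  have r1: "\<bar>r\<bar> \<le> 1" using r by simp
  have s0: "0 < sqrt (1 - r\<^sup>2)" using r by (simp add: abs_square_less_1)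
  have iw: "integrable std_normal_distribution ?w" "integrable std_normal_distribution (\<lambda>x. ?w x * x)"
    "integrable std_normal_distribution (\<lambda>x. ?w x * x\<^sup>2)"
    using window_integrable_std[OF eps(1), of 0] window_integrable_std[OF eps(1), of 1] window_integrable_std[OF eps(1), of 2] by simp_all
  have iH: "integrable std_normal_distribution ?H" by simp
  have iHs: "integrable std_normal_distribution (\<lambda>x. ?H x * x)" "integrable std_normal_distribution (\<lambda>x. ?H x * x\<^sup>2)"
  proof -
    have "(\<lambda>x::real. ?H x * x) = (\<lambda>x. x ^ 3 - x)" "(\<lambda>x::real. ?H x * x\<^sup>2) = (\<lambda>x. x ^ 4 - x\<^sup>2)"
      by (simp_all add: fun_eq_iff left_diff_distrib power2_eq_square eval_nat_numeral)
    then show "integrable std_normal_distribution (\<lambda>x. ?H x * x)" "integrable std_normal_distribution (\<lambda>x. ?H x * x\<^sup>2)"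
      by simp_all
  qed
  have EH: "(\<integral>x. ?H x \<partial>std_normal_distribution) = 0"
    using std_normal.prob_space by (simp add: std_normal_moments)
  have EHH: "(\<integral>x. ?H x * ?H x \<partial>std_normal_distribution) = 2"
  proof -
    have "?H x * ?H x = x ^ 4 - 2 * x\<^sup>2 + 1" for x :: real by (simp add: power2_eq_square eval_nat_numeral algebra_simps)
    then show ?thesis using std_normal.prob_space by (simp add: std_normal_moments)
  qed
  have EwH: "(\<integral>x. ?w x * ?H x \<partial>std_normal_distribution) = - c2"
  proof -
    have "?w x * ?H x = - (?w x * (1 - x\<^sup>2))" for x by (simp add: algebra_simps)
    then show ?thesis by (simp add: c2_def hermite2_def)
  qed
  note wX = gaussian_pair_fst[OF m law iw(1)] and wY = gaussian_pair_fst[OF m(2,1) law' iw(1)]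
  note HX = gaussian_pair_fst[OF m law iH] and HY = gaussian_pair_fst[OF m(2,1) law' iH]
  note wH = gaussian_pair_hermite2[OF m law r1 iw] and Hw = gaussian_pair_hermite2[OF m(2,1) law' r1 iw]
  note HH = gaussian_pair_hermite2[OF m law r1 iH iHs]
  have wwb: "\<bar>?w x * ?w y\<bar> \<le> (1 / (2 * \<epsilon>)) * (1 / (2 * \<epsilon>))" for x y
    using window_le[OF eps(1)] window_nonneg[OF eps(1)] eps unfolding abs_mult by (intro mult_mono) auto
  have iww: "integrable M (\<lambda>x. ?w (X x) * ?w (Y x))"
    by (rule integrable_const_bound[where B = "(1 / (2 * \<epsilon>)) * (1 / (2 * \<epsilon>))"]) (use wwb in auto)
  have F: "(\<lambda>z. ?w (fst z) * ?w (snd z)) \<in> borel_measurable (borel \<Otimes>\<^sub>M borel)" by measurable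
  have ww: "(\<integral>x. ?w (X x) * ?w (Y x) \<partial>M) \<le> c0\<^sup>2 + r\<^sup>2 / 2 * c2\<^sup>2 + 3 * (r ^ 4 / sqrt (1 - r\<^sup>2))" (is "_ \<le> ?b")
  proof -
    interpret SS: pair_prob_space std_normal_distribution std_normal_distribution ..
    have i: "integrable (std_normal_distribution \<Otimes>\<^sub>M std_normal_distribution) (\<lambda>z. ?w (fst z) * ?w (r * fst z + sqrt (1 - r\<^sup>2) * snd z))"
      using gaussian_pair_integral(1)[OF m F law] iww by simp
    have "ennreal (\<integral>x. ?w (X x) * ?w (Y x) \<partial>M) = ennreal (\<integral>z. ?w (fst z) * ?w (r * fst z + sqrt (1 - r\<^sup>2) * snd z) \<partial>(std_normal_distribution \<Otimes>\<^sub>M std_normal_distribution))"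
      using gaussian_pair_integral(2)[OF m F law] by simp
    also have "\<dots> = (\<integral>\<^sup>+z. ennreal (?w (fst z) * ?w (r * fst z + sqrt (1 - r\<^sup>2) * snd z)) \<partial>(std_normal_distribution \<Otimes>\<^sub>M std_normal_distribution))"
      using window_nonneg[OF eps(1)] by (intro nn_integral_eq_integral[symmetric] i) auto
    also have "\<dots> \<le> ennreal ?b" unfolding c0_def c2_def by (rule nn_integral_window_pair_le[OF eps r])
    finally show ?thesis
      using s0 by (subst (asm) ennreal_le_iff) (auto intro!: add_nonneg_nonneg)
  qed
  have expand: "resid \<epsilon> (X x) * resid \<epsilon> (Y x) = ?w (X x) * ?w (Y x) - c0 * ?w (X x) - c0 * ?w (Y x) + c0\<^sup>2
      + c2 / 2 * (?w (X x) * ?H (Y x)) + c2 / 2 * (?w (Y x) * ?H (X x))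
      - c0 * c2 / 2 * ?H (X x) - c0 * c2 / 2 * ?H (Y x) + c2\<^sup>2 / 4 * (?H (X x) * ?H (Y x))" for x
    unfolding resid_def c0_def c2_def by (simp add: power2_eq_square field_simps)
  have "(\<integral>x. resid \<epsilon> (X x) * resid \<epsilon> (Y x) \<partial>M) = (\<integral>x. ?w (X x) * ?w (Y x) \<partial>M) - c0 * c0 - c0 * c0 + c0\<^sup>2
      + c2 / 2 * (r\<^sup>2 * (- c2)) + c2 / 2 * (r\<^sup>2 * (- c2)) - 0 - 0 + c2\<^sup>2 / 4 * (r\<^sup>2 * 2)"
    unfolding expand
    using wX wY HX HY wH Hw HH iww
    by (simp add: EH EHH EwH prob_space hermite0_def[symmetric] c0_def[symmetric])
  also have "\<dots> = (\<integral>x. ?w (X x) * ?w (Y x) \<partial>M) - c0\<^sup>2 - r\<^sup>2 / 2 * c2\<^sup>2"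
    by (simp add: power2_eq_square field_simps)
  finally show ?thesis using ww by simp
qed

section \<open>The covariance of the wave\<close>

lemma e_freq_measurable [measurable]: "e_freq l \<in> borel_measurable borel"
  unfolding e_freq_def by (intro borel_measurable_continuous_onI continuous_intros)

lemma Re_of_real_mult: "Re (complex_of_real c * z) = c * Re z"
  by simp

lemma (in prob_space) char_normal_var_half:
  assumes "distributed M lborel X (\<lambda>t. ennreal (normal_density 0 (sqrt (1/2)) t))"
  shows "char (distr M borel (\<lambda>\<omega>. u * X \<omega>)) t = complex_of_real (exp (- (u * t)\<^sup>2 / 4))"
proof -
  define Y where "Y \<omega> = (X \<omega> - 0) / sqrt (1/2)" for \<omega>
  have "distributed M lborel Y std_normal_density"
    using assms unfolding Y_def by (subst (asm) normal_standard_normal_convert) auto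
  then have Y: "distr M lborel Y = std_normal_distribution" and [measurable]: "Y \<in> borel_measurable M"
    by (simp_all add: distributed_def)
  have Yb: "distr M borel Y = std_normal_distribution"
    unfolding Y[symmetric] by (rule distr_cong) auto
  have X: "u * X \<omega> = u * sqrt (1/2) * Y \<omega>" for \<omega> by (simp add: Y_def)
  have "char (distr M borel (\<lambda>\<omega>. u * X \<omega>)) t = (\<integral>\<omega>. iexp ((t * (u * sqrt (1/2))) * Y \<omega>) \<partial>M)"
    unfolding char_def X by (subst integral_distr) (auto simp: mult_ac)
  also have "\<dots> = char (distr M borel Y) (t * (u * sqrt (1/2)))"
    unfolding char_def by (subst integral_distr) auto
  also have "\<dots> = complex_of_real (exp (- (t * (u * sqrt (1/2)))\<^sup>2 / 2))"
    unfolding Yb by (rule fun_cong[OF char_std_normal_distribution])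
  also have "- (t * (u * sqrt (1/2)))\<^sup>2 / 2 = - (u * t)\<^sup>2 / 4"
    by (simp add: power_mult_distrib power_divide)
  finally show ?thesis .
qed

lemma wave_cov_minus: "wave_cov n (- x) = wave_cov n x"
proof -
  have "cos (2 * pi * phase l (- x)) = cos (2 * pi * phase l x)" for l
  proof -
    have "2 * pi * phase l (- x) = - (2 * pi * phase l x)" by (simp add: algebra_simps)
    then show ?thesis by (simp only: cos_minus)
  qed
  then show ?thesis by (simp add: wave_cov_def)
qed

locale arithmetic_wave = prob_space M for M :: "'w measure" +
  fixes n :: nat and a :: "int \<times> int \<Rightarrow> 'w \<Rightarrow> complex"
  assumes sum_of_squares: "n \<in> sums_of_two_squares"
    and coefficients: "wave_coefficients M n a"
begin

abbreviation N :: real where "N \<equiv> real (card (Freq n))"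

abbreviation T :: "real \<times> real \<Rightarrow> 'w \<Rightarrow> real" where "T \<equiv> arith_random_wave n a"

text \<open>One frequency of each opposite pair.\<close>

definition half :: "(int \<times> int) set" where
  "half = {l \<in> Freq n. snd l > 0 \<or> (snd l = 0 \<and> fst l > 0)}"

lemma n_pos: "n > 0"
  using sum_of_squares by (simp add: sums_of_two_squares_def)

lemma N_pos: "N > 0"
  using Freq_nonempty[OF sum_of_squares] finite_Freq by (simp add: card_gt_0_iff)

lemma finite_half [simp]: "finite half"
  by (rule finite_subset[OF _ finite_Freq[of n]]) (auto simp: half_def)

lemma Freq_split: "Freq n = half \<union> uminus ` half" "half \<inter> uminus ` half = {}"
proof -
  have nz: "l \<noteq> 0" if "l \<in> Freq n" for l
    using that n_pos by (auto simp: Freq_def zero_prod_def)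
  show "Freq n = half \<union> uminus ` half"
  proof (intro equalityI subsetI)
    fix l assume l: "l \<in> Freq n"
    show "l \<in> half \<union> uminus ` half"
    proof (cases "l \<in> half")
      case False
      then have "- l \<in> half" using l nz[OF l] by (cases l) (auto simp: half_def Freq_def zero_prod_def)
      then show ?thesis by (metis UnI2 image_eqI minus_minus)
    qed simp
  next
    fix l assume "l \<in> half \<union> uminus ` half"
    then show "l \<in> Freq n" by (auto simp: half_def Freq_def)
  qed
  show "half \<inter> uminus ` half = {}" by (auto simp: half_def)
qed

lemma sum_Freq_split: "(\<Sum>l\<in>Freq n. f l) = (\<Sum>l\<in>half. f l + f (- l))" for f :: "int \<times> int \<Rightarrow> 'b :: comm_monoid_add"
proof -
  have "(\<Sum>l\<in>uminus ` half. f l) = (\<Sum>l\<in>half. f (- l))"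
    by (subst sum.reindex) (auto simp: inj_on_def)
  then show ?thesis
    unfolding Freq_split(1) by (subst sum.union_disjoint) (auto simp: Freq_split(2) sum.distrib)
qed

lemma N_half: "N = 2 * real (card half)"
  using sum_Freq_split[of "\<lambda>_. 1::real"] by simp

lemma half_indep: "indep_vars (\<lambda>_. borel) a half"
proof -
  have "half \<subseteq> Freq n" "\<forall>l\<in>half. - l \<notin> half" by (auto simp: half_def)
  then show ?thesis using coefficients unfolding wave_coefficients_def by blast
qed

lemma coefficient_gaussian: "l \<in> Freq n \<Longrightarrow> std_complex_gaussian M (a l)"
  using coefficients by (simp add: wave_coefficients_def)

lemma coefficient_cnj: "l \<in> Freq n \<Longrightarrow> \<omega> \<in> space M \<Longrightarrow> a (- l) \<omega> = cnj (a l \<omega>)"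
  using coefficients by (simp add: wave_coefficients_def)

lemma coefficient_measurable [measurable]:
  assumes "l \<in> Freq n" shows "a l \<in> borel_measurable M"
proof -
  have "random_variable borel (\<lambda>\<omega>. Re (a l \<omega>))" "random_variable borel (\<lambda>\<omega>. Im (a l \<omega>))"
    using coefficient_gaussian[OF assms] unfolding std_complex_gaussian_def distributed_def by auto
  then have "(\<lambda>\<omega>. Complex (Re (a l \<omega>)) (Im (a l \<omega>))) \<in> borel_measurable M"
    unfolding Complex_eq by measurable
  then show ?thesis by simp
qed

lemma wave_pair_measurable [measurable]:
  "(\<lambda>z. T (fst z) (snd z)) \<in> borel_measurable (torus_measure \<Otimes>\<^sub>M M)"
proof -
  have *: "(\<lambda>z. a l (snd z) * e_freq l (fst z)) \<in> borel_measurable (torus_measure \<Otimes>\<^sub>M M)" if "l \<in> Freq n" for l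
  proof -
    note coefficient_measurable[OF that, measurable]
    show ?thesis by measurable
  qed
  have [measurable]: "(\<lambda>z. \<Sum>l\<in>Freq n. a l (snd z) * e_freq l (fst z)) \<in> borel_measurable (torus_measure \<Otimes>\<^sub>M M)"
    by (intro borel_measurable_sum *)
  show ?thesis unfolding arith_random_wave_def by measurable
qed

lemma wave_measurable [measurable]: "T x \<in> borel_measurable M"
proof -
  have "(\<lambda>\<omega>. T (fst (x, \<omega>)) (snd (x, \<omega>))) \<in> borel_measurable M"
    by (rule measurable_compose[OF _ wave_pair_measurable]) (simp add: space_pair_measure)
  then show ?thesis by simp
qed

lemma wave_measurable_torus [measurable]: "(\<lambda>x. T x \<omega>) \<in> borel_measurable borel"
  unfolding arith_random_wave_def by measurable

lemma wave_eq_half: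
  assumes "\<omega> \<in> space M"
  shows "T x \<omega> = (\<Sum>l\<in>half. Re (a l \<omega> * (2 / sqrt N * e_freq l x)))"
proof -
  have "Re (a (- l) \<omega> * e_freq (- l) x) = Re (a l \<omega> * e_freq l x)" if "l \<in> half" for l
  proof -
    have "e_freq (- l) x = cnj (e_freq l x)" by (simp add: e_freq_cis cis_cnj algebra_simps)
    then show ?thesis using coefficient_cnj[of l \<omega>] that assms by (simp add: half_def)
  qed
  then have "(\<Sum>l\<in>Freq n. Re (a l \<omega> * e_freq l x)) = (\<Sum>l\<in>half. 2 * Re (a l \<omega> * e_freq l x))"
    unfolding sum_Freq_split by (intro sum.cong) auto
  moreover have "T x \<omega> = (\<Sum>l\<in>Freq n. Re (a l \<omega> * e_freq l x)) / sqrt N"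
  proof -
    have "T x \<omega> = Re (complex_of_real (1 / sqrt N) * (\<Sum>l\<in>Freq n. a l \<omega> * e_freq l x))"
      unfolding arith_random_wave_def by simp
    then show ?thesis by (simp only: Re_of_real_mult Re_sum) simp
  qed
  moreover have "Re (a l \<omega> * (2 / sqrt N * e_freq l x)) = 2 * Re (a l \<omega> * e_freq l x) / sqrt N" for l
  proof -
    have "a l \<omega> * (2 / sqrt N * e_freq l x) = complex_of_real (2 / sqrt N) * (a l \<omega> * e_freq l x)" by simp
    then show ?thesis by (simp only: Re_of_real_mult) simp
  qed
  ultimately show ?thesis by (simp only: sum_divide_distrib)
qed

lemma char_coefficient:
  assumes "l \<in> Freq n"
  shows "char (distr M borel (\<lambda>\<omega>. Re (a l \<omega> * w))) 1 = complex_of_real (exp (- (norm w)\<^sup>2 / 4))"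
proof -
  note g = coefficient_gaussian[OF assms, unfolded std_complex_gaussian_def]
  have ind: "indep_var borel (\<lambda>\<omega>. Re w * Re (a l \<omega>)) borel (\<lambda>\<omega>. - Im w * Im (a l \<omega>))"
    using indep_var_compose[of borel "\<lambda>\<omega>. Re (a l \<omega>)" borel "\<lambda>\<omega>. Im (a l \<omega>)" "\<lambda>t. Re w * t" borel "\<lambda>t. - Im w * t" borel] g
    by (simp add: comp_def)
  have "(\<lambda>\<omega>. Re (a l \<omega> * w)) = (\<lambda>\<omega>. Re w * Re (a l \<omega>) + (- Im w) * Im (a l \<omega>))" by (simp add: fun_eq_iff)
  then have "char (distr M borel (\<lambda>\<omega>. Re (a l \<omega> * w))) 1 =
      char (distr M borel (\<lambda>\<omega>. Re w * Re (a l \<omega>))) 1 * char (distr M borel (\<lambda>\<omega>. - Im w * Im (a l \<omega>))) 1"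
    using char_distr_add[OF ind, of 1] by (simp only:)
  also have "\<dots> = complex_of_real (exp (- (Re w * 1)\<^sup>2 / 4)) * complex_of_real (exp (- (- Im w * 1)\<^sup>2 / 4))"
    using char_normal_var_half[of "\<lambda>\<omega>. Re (a l \<omega>)" "Re w" 1] char_normal_var_half[of "\<lambda>\<omega>. Im (a l \<omega>)" "- Im w" 1] g by (simp only:)
  also have "\<dots> = complex_of_real (exp (- (norm w)\<^sup>2 / 4))"
    by (simp add: exp_add[symmetric] of_real_mult[symmetric] cmod_power2 add_divide_distrib del: of_real_mult)
  finally show ?thesis .
qed

lemma wave_cov_half: "wave_cov n x = 2 * (\<Sum>l\<in>half. cos (2 * pi * phase l x)) / N"
proof -
  have "cos (2 * pi * phase (- l) x) = cos (2 * pi * phase l x)" for l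
  proof -
    have "2 * pi * phase (- l) x = - (2 * pi * phase l x)" by (simp add: algebra_simps)
    then show ?thesis by (simp only: cos_minus)
  qed
  then show ?thesis unfolding wave_cov_def sum_Freq_split by (simp add: sum_distrib_left)
qed

lemma wave_joint_char:
  "(\<integral>\<omega>. iexp (s * T x \<omega> + t * T y \<omega>) \<partial>M) =
    complex_of_real (exp (- (s\<^sup>2 + 2 * wave_cov n (x - y) * s * t + t\<^sup>2) / 2))"
proof -
  define w where "w l = 2 / sqrt N * (complex_of_real s * e_freq l x + complex_of_real t * e_freq l y)" for l
  have half_Freq: "l \<in> Freq n" if "l \<in> half" for l using that by (simp add: half_def)
  have eq: "s * T x \<omega> + t * T y \<omega> = (\<Sum>l\<in>half. Re (a l \<omega> * w l))" if "\<omega> \<in> space M" for \<omega>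
  proof -
    have "Re (a l \<omega> * w l) = s * Re (a l \<omega> * (2 / sqrt N * e_freq l x)) + t * Re (a l \<omega> * (2 / sqrt N * e_freq l y))" for l
    proof -
      have "a l \<omega> * w l = complex_of_real s * (a l \<omega> * (2 / sqrt N * e_freq l x)) + complex_of_real t * (a l \<omega> * (2 / sqrt N * e_freq l y))"
        unfolding w_def by (simp add: distrib_left mult_ac)
      then show ?thesis by (simp only: plus_complex.simps Re_of_real_mult)
    qed
    then show ?thesis unfolding wave_eq_half[OF that] by (simp add: sum.distrib sum_distrib_left)
  qed
  have ind: "indep_vars (\<lambda>_. borel) (\<lambda>l \<omega>. Re (a l \<omega> * w l)) half"
    by (rule indep_vars_compose2[OF half_indep, where Y = "\<lambda>l z. Re (z * w l)"]) measurable
  have mS: "(\<lambda>\<omega>. \<Sum>l\<in>half. Re (a l \<omega> * w l)) \<in> borel_measurable M"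
    using ind unfolding indep_vars_def by (intro borel_measurable_sum) auto
  have "(\<integral>\<omega>. iexp (s * T x \<omega> + t * T y \<omega>) \<partial>M) = (\<integral>\<omega>. iexp (1 * (\<Sum>l\<in>half. Re (a l \<omega> * w l))) \<partial>M)"
    by (intro Bochner_Integration.integral_cong refl) (simp only: eq mult_1)
  also have "\<dots> = char (distr M borel (\<lambda>\<omega>. \<Sum>l\<in>half. Re (a l \<omega> * w l))) 1"
    unfolding char_def by (rule integral_distr[OF mS, symmetric]) measurable
  also have "\<dots> = (\<Prod>l\<in>half. char (distr M borel (\<lambda>\<omega>. Re (a l \<omega> * w l))) 1)"
    by (rule char_distr_sum[OF ind])
  also have "\<dots> = (\<Prod>l\<in>half. complex_of_real (exp (- (norm (w l))\<^sup>2 / 4)))"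
    by (intro prod.cong refl char_coefficient half_Freq)
  also have "\<dots> = complex_of_real (exp (\<Sum>l\<in>half. - (norm (w l))\<^sup>2 / 4))"
    by (simp add: exp_sum)
  also have "(\<Sum>l\<in>half. - (norm (w l))\<^sup>2 / 4) = (\<Sum>l\<in>half. - (s\<^sup>2 + t\<^sup>2 + 2 * s * t * cos (2 * pi * phase l (x - y))) / N)"
  proof (rule sum.cong[OF refl])
    fix l
    have "(norm (complex_of_real s * e_freq l x + complex_of_real t * e_freq l y))\<^sup>2 = s\<^sup>2 + t\<^sup>2 + 2 * s * t * cos (2 * pi * phase l x - 2 * pi * phase l y)"
    proof -
      define \<alpha> \<beta> where "\<alpha> = 2 * pi * phase l x" and "\<beta> = 2 * pi * phase l y"
      have "(norm (complex_of_real s * cis \<alpha> + complex_of_real t * cis \<beta>))\<^sup>2 =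
        s\<^sup>2 * ((cos \<alpha>)\<^sup>2 + (sin \<alpha>)\<^sup>2) + t\<^sup>2 * ((cos \<beta>)\<^sup>2 + (sin \<beta>)\<^sup>2) + 2 * s * t * (cos \<alpha> * cos \<beta> + sin \<alpha> * sin \<beta>)"
        unfolding cmod_power2
        by (simp add: power2_sum power_mult_distrib algebra_simps del: sin_cos_squared_add sin_cos_squared_add2)
      then show ?thesis unfolding e_freq_cis \<alpha>_def[symmetric] \<beta>_def[symmetric] cos_diff by simp
    qed
    moreover have "2 * pi * phase l x - 2 * pi * phase l y = 2 * pi * phase l (x - y)" by (simp add: algebra_simps)
    moreover have "(norm (w l))\<^sup>2 = 4 / N * (norm (complex_of_real s * e_freq l x + complex_of_real t * e_freq l y))\<^sup>2"
      using N_pos unfolding w_def norm_mult power_mult_distrib by (simp add: norm_divide power_divide)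
    ultimately show "- (norm (w l))\<^sup>2 / 4 = - (s\<^sup>2 + t\<^sup>2 + 2 * s * t * cos (2 * pi * phase l (x - y))) / N"
      using N_pos by (simp add: field_simps)
  qed
  also have "\<dots> = - (real (card half) * (s\<^sup>2 + t\<^sup>2) + 2 * s * t * (\<Sum>l\<in>half. cos (2 * pi * phase l (x - y)))) / N"
    unfolding sum_divide_distrib[symmetric] sum_negf sum.distrib sum_distrib_left[symmetric] by (simp only: sum_constant distrib_left)
  also have "\<dots> = - (s\<^sup>2 + 2 * wave_cov n (x - y) * s * t + t\<^sup>2) / 2"
  proof -
    define C where "C = (\<Sum>l\<in>half. cos (2 * pi * phase l (x - y)))"
    have h: "real (card half) = N / 2" using N_half by simp
    show ?thesis
      using N_pos unfolding wave_cov_half C_def[symmetric] h by (simp add: field_simps)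
  qed
  finally show ?thesis .
qed

lemma wave_gaussian_pair: "gaussian_pair M (wave_cov n (x - y)) (T x) (T y)"
  by (rule gaussian_pair_law[OF prob_space_axioms wave_measurable wave_measurable wave_cov_le_1 wave_joint_char])

lemma wave_gaussian_pair': "gaussian_pair M (wave_cov n (x - y)) (T y) (T x)"
  using wave_gaussian_pair[of y x] wave_cov_minus[of n "x - y"] by simp

end

section \<open>The projection on the second chaos\<close>

text \<open>Translation by a half period of the phase changes the sign of the cosine.\<close>

lemma integral_torus_cos:
  assumes "v \<noteq> 0"
  shows "(\<integral>x. cos (2 * pi * phase v x + \<theta>) \<partial>torus_measure) = 0"
proof -
  define D where "D = real_of_int (fst v * fst v + snd v * snd v)"
  have D: "D > 0"
    using assms unfolding D_def by (cases v) (auto simp: zero_prod_def sum_squares_gt_zero_iff simp del: of_int_add)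
  define c where "c = 1 / (2 * D)"
  define z where "z = (c * of_int (fst v), c * of_int (snd v))"
  have "phase v z = c * D" unfolding z_def D_def by (simp add: algebra_simps)
  then have z: "2 * pi * phase v z = pi" using D by (simp add: c_def)
  define F where "F x = 1 + cos (2 * pi * phase v x + \<theta>)" for x
  have cont: "continuous_on UNIV F" unfolding F_def by (intro continuous_intros)
  have [measurable]: "F \<in> borel_measurable borel" using borel_measurable_continuous_onI[OF cont] .
  have F0: "0 \<le> F x" "F x \<le> 2" for x
    using cos_ge_minus_one[of "2 * pi * phase v x + \<theta>"] cos_le_one[of "2 * pi * phase v x + \<theta>"] unfolding F_def by linarith+
  have per: "torus_periodic (\<lambda>x. ennreal (F x))"
  proof -
    have "F (x + (of_int j, of_int k)) = F x" for x j k
    proof -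
      have "2 * pi * phase v (x + (of_int j, of_int k)) + \<theta> = (2 * pi * phase v x + \<theta>) + 2 * pi * of_int (fst v * j + snd v * k)"
        by (simp add: algebra_simps)
      then show ?thesis unfolding F_def
        by (simp only: cos_add[of _ "2 * pi * of_int (fst v * j + snd v * k)"] cos_int_2pin sin_int_2pin mult_1_right mult_zero_right diff_0_right)
    qed
    then show ?thesis by (simp add: torus_periodic_def)
  qed
  have shift: "F (x + z) = 1 - cos (2 * pi * phase v x + \<theta>)" for x
  proof -
    have "2 * pi * phase v (x + z) + \<theta> = (2 * pi * phase v x + \<theta>) + 2 * pi * phase v z"
      by (simp add: algebra_simps)
    note h = this
    show ?thesis unfolding F_def h z by simp
  qed
  have int: "integrable torus_measure F" "integrable torus_measure (\<lambda>x. F (x + z))"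
    by (rule torus_measure.integrable_const_bound[where B = 2]; use F0 in \<open>auto simp: abs_le_iff intro: order.trans[of "- _" 0]\<close>)+
  have ic: "integrable torus_measure (\<lambda>x. cos (2 * pi * phase v x + \<theta>))"
    using Bochner_Integration.integrable_diff[OF int(1), of "\<lambda>_. 1"] by (simp add: F_def)
  have "ennreal (\<integral>x. F (x + z) \<partial>torus_measure) = (\<integral>\<^sup>+x. ennreal (F (x + z)) \<partial>torus_measure)"
    using F0 int(2) by (intro nn_integral_eq_integral[symmetric]) auto
  also have "\<dots> = (\<integral>\<^sup>+x. ennreal (F x) \<partial>torus_measure)"
    by (rule nn_integral_torus_shift[OF _ per]) measurable
  also have "\<dots> = ennreal (\<integral>x. F x \<partial>torus_measure)"
    using F0 int(1) by (intro nn_integral_eq_integral) auto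
  finally have "(\<integral>x. F (x + z) \<partial>torus_measure) = (\<integral>x. F x \<partial>torus_measure)"
    using F0 by (subst (asm) ennreal_inj) (auto intro!: integral_nonneg_AE)
  then have "(\<integral>x. 1 - cos (2 * pi * phase v x + \<theta>) \<partial>torus_measure) = (\<integral>x. F x \<partial>torus_measure)"
    by (simp only: shift)
  then show ?thesis using ic by (simp add: F_def)
qed

lemma integrable_e_freq: "integrable torus_measure (e_freq v)"
proof (rule torus_measure.integrable_const_bound[where B = 1])
  show "e_freq v \<in> borel_measurable torus_measure" by measurable
qed simp

lemma integral_e_freq: "(\<integral>x. e_freq v x \<partial>torus_measure) = (if v = 0 then 1 else 0)"
proof (cases "v = 0")
  case True
  then show ?thesis using torus_measure.prob_space by (simp add: e_freq_def zero_prod_def)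
next
  case False
  have "Re (\<integral>x. e_freq v x \<partial>torus_measure) = (\<integral>x. Re (e_freq v x) \<partial>torus_measure)"
    by (rule integral_Re[symmetric, OF integrable_e_freq])
  also have "\<dots> = 0" using integral_torus_cos[OF False, of 0] by (simp add: e_freq_cis)
  finally have re: "Re (\<integral>x. e_freq v x \<partial>torus_measure) = 0" .
  have "Im (\<integral>x. e_freq v x \<partial>torus_measure) = (\<integral>x. Im (e_freq v x) \<partial>torus_measure)"
    by (rule integral_Im[symmetric, OF integrable_e_freq])
  also have "\<dots> = 0" using integral_torus_cos[OF False, of "- (pi / 2)"] by (simp add: e_freq_cis cos_diff)
  finally have "Im (\<integral>x. e_freq v x \<partial>torus_measure) = 0" .
  with re False show ?thesis by (simp add: complex_eq_iff)
qed

lemma resid_square_integrable_std: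
  assumes "\<epsilon> > 0" shows "integrable std_normal_distribution (\<lambda>t. (resid \<epsilon> t)\<^sup>2)"
proof -
  let ?w = "window \<epsilon>"
  define c d where "c = hermite0 \<epsilon>" and "d = hermite2 \<epsilon> / 2"
  have ww: "?w t * ?w t = 1 / (2 * \<epsilon>) * ?w t" for t by (simp add: window_def indicator_def)
  have eq: "(resid \<epsilon> t)\<^sup>2 = 1 / (2 * \<epsilon>) * ?w t + 2 * (?w t * (- c - d)) + 2 * d * (?w t * t ^ 2) + (d\<^sup>2 * t ^ 4 - 2 * d * (c + d) * t ^ 2 + (c + d)\<^sup>2)" for t
  proof -
    have "(resid \<epsilon> t)\<^sup>2 = ?w t * ?w t + 2 * (?w t * (- c - d)) + 2 * d * (?w t * t ^ 2) + (d * t ^ 2 - (c + d))\<^sup>2"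
      unfolding resid_def c_def[symmetric] d_def[symmetric] by (simp add: power2_eq_square algebra_simps)
    also have "(d * t ^ 2 - (c + d))\<^sup>2 = d\<^sup>2 * t ^ 4 - 2 * d * (c + d) * t ^ 2 + (c + d)\<^sup>2"
      by (simp add: power2_eq_square eval_nat_numeral algebra_simps)
    finally show ?thesis unfolding ww .
  qed
  show ?thesis unfolding eq
    using window_integrable_std[OF assms, of 0] window_integrable_std[OF assms, of 2] by simp
qed

context arithmetic_wave
begin

definition energy :: "'w \<Rightarrow> real" where
  "energy \<omega> = (\<Sum>l\<in>half. (norm (a l \<omega>))\<^sup>2)"

abbreviation m :: real where "m \<equiv> real (card half)"

lemma m_pos: "m > 0" using N_pos N_half by simp

lemma energy_measurable [measurable]: "energy \<in> borel_measurable M"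
proof -
  have "(\<lambda>\<omega>. (norm (a l \<omega>))\<^sup>2) \<in> borel_measurable M" if "l \<in> half" for l
  proof -
    have "a l \<in> borel_measurable M" using that by (intro coefficient_measurable) (simp add: half_def)
    then show ?thesis by measurable
  qed
  then show ?thesis unfolding energy_def by (intro borel_measurable_sum)
qed

text \<open>Parseval's identity: the projection of the wave on the second chaos, averaged over the
  torus, depends on the coefficients through their energy only.\<close>

lemma integral_wave_square:
  assumes \<omega>: "\<omega> \<in> space M"
  shows "(\<integral>x. (T x \<omega>)\<^sup>2 \<partial>torus_measure) = energy \<omega> / m"
proof -
  let ?F = "Freq n"
  have real: "complex_of_real (T x \<omega>) = 1 / complex_of_real (sqrt N) * (\<Sum>l\<in>?F. a l \<omega> * e_freq l x)" for x
    by (rule arith_random_wave_eq[OF coefficients \<omega>])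
  have e: "e_freq l x * cnj (e_freq k x) = e_freq (l - k) x" for l k x
    by (simp add: e_freq_cis cis_cnj cis_mult algebra_simps)
  have NN: "1 / complex_of_real (sqrt N) * cnj (1 / complex_of_real (sqrt N)) = 1 / complex_of_real N"
    using N_pos by (simp flip: of_real_mult)
  have sq: "complex_of_real ((T x \<omega>)\<^sup>2) = 1 / complex_of_real N * (\<Sum>l\<in>?F. \<Sum>k\<in>?F. (a l \<omega> * cnj (a k \<omega>)) * e_freq (l - k) x)" for x
  proof -
    have "complex_of_real ((T x \<omega>)\<^sup>2) = complex_of_real (T x \<omega>) * cnj (complex_of_real (T x \<omega>))"
      by (simp add: power2_eq_square)
    also have "\<dots> = (1 / complex_of_real (sqrt N) * cnj (1 / complex_of_real (sqrt N))) * ((\<Sum>l\<in>?F. a l \<omega> * e_freq l x) * (\<Sum>k\<in>?F. cnj (a k \<omega> * e_freq k x)))"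
      unfolding real complex_cnj_mult cnj_sum by (simp only: mult_ac)
    also have "\<dots> = 1 / complex_of_real N * (\<Sum>l\<in>?F. \<Sum>k\<in>?F. (a l \<omega> * cnj (a k \<omega>)) * (e_freq l x * cnj (e_freq k x)))"
      unfolding NN sum_product complex_cnj_mult by (simp only: mult_ac)
    finally show ?thesis unfolding e .
  qed
  have "complex_of_real (\<integral>x. (T x \<omega>)\<^sup>2 \<partial>torus_measure) = (\<integral>x. complex_of_real ((T x \<omega>)\<^sup>2) \<partial>torus_measure)"
    by (rule integral_complex_of_real[symmetric])
  also have "\<dots> = 1 / complex_of_real N * (\<Sum>l\<in>?F. \<Sum>k\<in>?F. (a l \<omega> * cnj (a k \<omega>)) * (\<integral>x. e_freq (l - k) x \<partial>torus_measure))"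
    unfolding sq using integrable_e_freq
    by (simp add: Bochner_Integration.integral_sum del: mult_cancel_left)
  also have "\<dots> = 1 / complex_of_real N * (\<Sum>l\<in>?F. a l \<omega> * cnj (a l \<omega>))"
    unfolding integral_e_freq by (simp add: if_distrib[where f = "\<lambda>z. _ * z"] sum.delta' finite_Freq cong: if_cong)
  also have "\<dots> = complex_of_real (1 / N * (\<Sum>l\<in>?F. (norm (a l \<omega>))\<^sup>2))"
    by (simp add: complex_norm_square[symmetric])
  finally have "(\<integral>x. (T x \<omega>)\<^sup>2 \<partial>torus_measure) = 1 / N * (\<Sum>l\<in>?F. (norm (a l \<omega>))\<^sup>2)"
    by (simp only: of_real_eq_iff)
  also have "(\<Sum>l\<in>?F. (norm (a l \<omega>))\<^sup>2) = 2 * energy \<omega>"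
    using coefficient_cnj[OF _ \<omega>] unfolding sum_Freq_split energy_def sum_distrib_left
    by (intro sum.cong) (auto simp: half_def)
  finally show ?thesis using m_pos unfolding N_half by simp
qed

lemma leray_approx_eq:
  assumes "\<epsilon> > 0"
  shows "leray_approx T \<epsilon> \<omega> = (\<integral>x. window \<epsilon> (T x \<omega>) \<partial>torus_measure)"
proof -
  let ?A = "{x. \<bar>T x \<omega>\<bar> < \<epsilon>}"
  have A: "?A \<in> sets borel" by measurable
  have "(\<integral>x. window \<epsilon> (T x \<omega>) \<partial>torus_measure) = (\<integral>x. 1 / (2 * \<epsilon>) * indicator ?A x \<partial>torus_measure)"
    by (rule Bochner_Integration.integral_cong) (auto simp: window_def indicator_def abs_less_iff)
  also have "\<dots> = 1 / (2 * \<epsilon>) * measure torus_measure ?A" using A by simp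
  also have "measure torus_measure ?A = measure lborel (torus \<inter> ?A)"
    unfolding measure_def torus_measure_def using A by (subst emeasure_restricted) auto
  also have "torus \<inter> ?A = {x \<in> torus. \<bar>T x \<omega>\<bar> < \<epsilon>}" by auto
  finally show ?thesis by (simp add: leray_approx_def)
qed

lemma integral_torus_measurable:
  fixes f :: "real \<Rightarrow> real"
  assumes [measurable]: "f \<in> borel_measurable borel"
  shows "(\<lambda>\<omega>. \<integral>x. f (T x \<omega>) \<partial>torus_measure) \<in> borel_measurable M"
proof (rule torus_measure.borel_measurable_lebesgue_integral)
  have "(\<lambda>p. (snd p, fst p)) \<in> M \<Otimes>\<^sub>M torus_measure \<rightarrow>\<^sub>M torus_measure \<Otimes>\<^sub>M M" by measurable
  from measurable_compose[OF this wave_pair_measurable]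
  show "(\<lambda>(\<omega>, x). f (T x \<omega>)) \<in> borel_measurable (M \<Otimes>\<^sub>M torus_measure)"
    by (simp add: split_def)
qed

lemma leray_approx_measurable: "\<epsilon> > 0 \<Longrightarrow> leray_approx T \<epsilon> \<in> borel_measurable M"
  using integral_torus_measurable[OF window_measurable] by (simp add: leray_approx_eq cong: measurable_cong)

lemma integrable_torus_wave_power: "integrable torus_measure (\<lambda>x. (T x \<omega>) ^ k)"
proof -
  define B where "B = norm (1 / complex_of_real (sqrt N)) * (\<Sum>l\<in>Freq n. norm (a l \<omega>))"
  have "\<bar>T x \<omega>\<bar> \<le> B" for x
  proof -
    have "\<bar>T x \<omega>\<bar> \<le> norm (1 / complex_of_real (sqrt N) * (\<Sum>l\<in>Freq n. a l \<omega> * e_freq l x))"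
      unfolding arith_random_wave_def by (rule abs_Re_le_cmod)
    also have "\<dots> \<le> norm (1 / complex_of_real (sqrt N)) * (\<Sum>l\<in>Freq n. norm (a l \<omega> * e_freq l x))"
      unfolding norm_mult by (intro mult_left_mono order.trans[OF norm_sum]) (auto simp: norm_mult)
    finally show ?thesis by (simp add: B_def norm_mult)
  qed
  then have "\<bar>(T x \<omega>) ^ k\<bar> \<le> B ^ k" for x unfolding power_abs by (intro power_mono) auto
  then show ?thesis by (intro torus_measure.integrable_const_bound[where B = "B ^ k"]) auto
qed

lemma integrable_torus_window: "\<epsilon> > 0 \<Longrightarrow> integrable torus_measure (\<lambda>x. window \<epsilon> (T x \<omega>))"
  using window_le[of \<epsilon>] window_nonneg[of \<epsilon>]
  by (intro torus_measure.integrable_const_bound[where B = "1 / (2 * \<epsilon>)"]) auto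

lemma integrable_torus_resid: "\<epsilon> > 0 \<Longrightarrow> integrable torus_measure (\<lambda>x. resid \<epsilon> (T x \<omega>))"
  unfolding resid_def using integrable_torus_wave_power[of \<omega> 2] integrable_torus_window[of \<epsilon> \<omega>] by simp

lemma integral_torus_resid:
  assumes "\<epsilon> > 0" "\<omega> \<in> space M"
  shows "(\<integral>x. resid \<epsilon> (T x \<omega>) \<partial>torus_measure) =
    leray_approx T \<epsilon> \<omega> - hermite0 \<epsilon> + hermite2 \<epsilon> / 2 * (energy \<omega> / m - 1)"
  unfolding resid_def leray_approx_eq[OF assms(1)]
  using integrable_torus_wave_power[of \<omega> 2] integrable_torus_window[of \<epsilon> \<omega>] assms torus_measure.prob_space
  by (simp add: integral_wave_square)

end

section \<open>The second moment of the residual\<close>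

lemma integral_le_of_nn_integral_le:
  fixes g h :: "'a \<Rightarrow> real"
  assumes "AE x in Q. g x \<le> h x" and "(\<integral>\<^sup>+x. ennreal (h x) \<partial>Q) \<le> ennreal c" "0 \<le> c"
  shows "(\<integral>x. g x \<partial>Q) \<le> c"
proof (cases "integrable Q g")
  case True
  have "(\<integral>x. g x \<partial>Q) \<le> enn2real (\<integral>\<^sup>+x. ennreal (g x) \<partial>Q)"
    unfolding real_lebesgue_integral_def[OF True] by simp
  also have "\<dots> \<le> enn2real (ennreal c)"
  proof (rule enn2real_mono)
    have "(\<integral>\<^sup>+x. ennreal (g x) \<partial>Q) \<le> (\<integral>\<^sup>+x. ennreal (h x) \<partial>Q)"
      using assms(1) by (intro nn_integral_mono_AE) (auto elim!: eventually_mono intro: ennreal_leI)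
    then show "(\<integral>\<^sup>+x. ennreal (g x) \<partial>Q) \<le> ennreal c" using assms(2) by (rule order.trans)
  qed simp
  finally show ?thesis using assms(3) by simp
qed (use assms(3) in \<open>simp add: not_integrable_integral_eq\<close>)

context arithmetic_wave
begin

interpretation TT: pair_prob_space torus_measure torus_measure ..

lemma wave_cov_diff: "wave_cov n (x - y) = wave_cov n (y + (- x))"
  using wave_cov_minus[of n "x - y"] by simp

lemma torus_pair_wave_cov_lt:
  "AE z in torus_measure \<Otimes>\<^sub>M torus_measure. \<bar>wave_cov n (fst z - snd z)\<bar> < 1"
proof (rule TT.AE_pair_measure)
  show "{z \<in> space (torus_measure \<Otimes>\<^sub>M torus_measure). \<bar>wave_cov n (fst z - snd z)\<bar> < 1} \<in> sets (torus_measure \<Otimes>\<^sub>M torus_measure)"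
    by measurable
  show "AE x in torus_measure. AE y in torus_measure. \<bar>wave_cov n (fst (x, y) - snd (x, y))\<bar> < 1"
  proof (rule AE_I2)
    fix x :: "real \<times> real"
    define F :: "real \<times> real \<Rightarrow> ennreal" where "F y = of_bool (\<not> \<bar>wave_cov n y\<bar> < 1)" for y
    have [measurable]: "F \<in> borel_measurable borel" unfolding F_def of_bool_def by measurable
    have "AE y in torus_measure. F y = 0"
      using wave_cov_bounds_AE[OF sum_of_squares] by (auto elim!: eventually_mono simp: F_def)
    then have "(\<integral>\<^sup>+y. F y \<partial>torus_measure) = 0" by (simp add: nn_integral_0_iff_AE)
    moreover have "(\<integral>\<^sup>+y. F (y + (- x)) \<partial>torus_measure) = (\<integral>\<^sup>+y. F y \<partial>torus_measure)"
      using wave_cov_periodic[of n] by (intro nn_integral_torus_shift) (auto simp: torus_periodic_def F_def)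
    ultimately have "(\<integral>\<^sup>+y. F (y + (- x)) \<partial>torus_measure) = 0" by simp
    then have "AE y in torus_measure. F (y + (- x)) = 0" by (subst (asm) nn_integral_0_iff_AE) auto
    then show "AE y in torus_measure. \<bar>wave_cov n (fst (x, y) - snd (x, y))\<bar> < 1"
      by (rule eventually_mono) (use wave_cov_diff[of x] in \<open>simp add: F_def del: add_uminus_conv_diff\<close>)
  qed
qed

lemma nn_integral_torus_difference:
  fixes h :: "real \<Rightarrow> ennreal"
  assumes [measurable]: "h \<in> borel_measurable borel"
  shows "(\<integral>\<^sup>+z. h (wave_cov n (fst z - snd z)) \<partial>(torus_measure \<Otimes>\<^sub>M torus_measure)) =
    (\<integral>\<^sup>+x. h (wave_cov n x) \<partial>torus_measure)"
proof -
  have "(\<integral>\<^sup>+z. h (wave_cov n (fst z - snd z)) \<partial>(torus_measure \<Otimes>\<^sub>M torus_measure)) =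
      (\<integral>\<^sup>+x. \<integral>\<^sup>+y. h (wave_cov n (x - y)) \<partial>torus_measure \<partial>torus_measure)"
    by (subst torus_measure.nn_integral_fst[symmetric]) auto
  also have "\<dots> = (\<integral>\<^sup>+x. \<integral>\<^sup>+y. h (wave_cov n (y + (- x))) \<partial>torus_measure \<partial>torus_measure)"
    by (simp only: wave_cov_diff)
  also have "\<dots> = (\<integral>\<^sup>+x. \<integral>\<^sup>+y. h (wave_cov n y) \<partial>torus_measure \<partial>torus_measure)"
  proof (rule nn_integral_cong)
    fix x :: "real \<times> real"
    show "(\<integral>\<^sup>+y. h (wave_cov n (y + (- x))) \<partial>torus_measure) = (\<integral>\<^sup>+y. h (wave_cov n y) \<partial>torus_measure)"
      using wave_cov_periodic[of n] by (intro nn_integral_torus_shift) (auto simp: torus_periodic_def)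
  qed
  finally show ?thesis using torus_measure.emeasure_space_1 by simp
qed

definition residual :: "real \<Rightarrow> 'w \<Rightarrow> real" where
  "residual \<epsilon> \<omega> = (\<integral>x. resid \<epsilon> (T x \<omega>) \<partial>torus_measure)"

lemma residual_measurable [measurable]: "residual \<epsilon> \<in> borel_measurable M"
  unfolding residual_def by (rule integral_torus_measurable) measurable

text \<open>The square of an average over the torus is a double average, so that the second moment
  is controlled by the correlations of the residual at pairs of points.\<close>

lemma residual_second_moment:
  assumes eps: "0 < \<epsilon>" "\<epsilon> \<le> 1" and c: "0 \<le> c"
    and singular: "(\<integral>\<^sup>+x. ennreal (wave_cov n x ^ 4 / sqrt (1 - (wave_cov n x)\<^sup>2)) \<partial>torus_measure) \<le> ennreal c"
  shows "(\<integral>\<^sup>+\<omega>. ennreal ((residual \<epsilon> \<omega>)\<^sup>2) \<partial>M) \<le> ennreal (3 * c)"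
proof -
  let ?P = "torus_measure \<Otimes>\<^sub>M torus_measure"
  define G where "G z \<omega> = resid \<epsilon> (T (fst z) \<omega>) * resid \<epsilon> (T (snd z) \<omega>)" for z \<omega>
  interpret PM: pair_prob_space ?P M ..
  define D where "D = (\<integral>t. (resid \<epsilon> t)\<^sup>2 \<partial>std_normal_distribution)"
  have sq: "integrable M (\<lambda>\<omega>. (resid \<epsilon> (T x \<omega>))\<^sup>2)" "(\<integral>\<omega>. (resid \<epsilon> (T x \<omega>))\<^sup>2 \<partial>M) = D" for x
    using gaussian_pair_fst[OF wave_measurable wave_measurable wave_gaussian_pair resid_square_integrable_std[OF eps(1)]]
    unfolding D_def by blast+
  have mG: "(\<lambda>p. G (fst p) (snd p)) \<in> borel_measurable (?P \<Otimes>\<^sub>M M)"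
  proof -
    have 1: "(\<lambda>p. (fst (fst p), snd p)) \<in> ?P \<Otimes>\<^sub>M M \<rightarrow>\<^sub>M torus_measure \<Otimes>\<^sub>M M"
      and 2: "(\<lambda>p. (snd (fst p), snd p)) \<in> ?P \<Otimes>\<^sub>M M \<rightarrow>\<^sub>M torus_measure \<Otimes>\<^sub>M M" by measurable
    from measurable_compose[OF 1 wave_pair_measurable] measurable_compose[OF 2 wave_pair_measurable]
    have [measurable]: "(\<lambda>p. T (fst (fst p)) (snd p)) \<in> borel_measurable (?P \<Otimes>\<^sub>M M)"
      "(\<lambda>p. T (snd (fst p)) (snd p)) \<in> borel_measurable (?P \<Otimes>\<^sub>M M)" by simp_all
    show ?thesis unfolding G_def by measurable
  qed
  have Gle: "\<bar>G z \<omega>\<bar> \<le> ((resid \<epsilon> (T (fst z) \<omega>))\<^sup>2 + (resid \<epsilon> (T (snd z) \<omega>))\<^sup>2) / 2" for z \<omega>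
    unfolding G_def by (rule abs_mult_le_mean_squares)
  have isum: "integrable M (\<lambda>\<omega>. ((resid \<epsilon> (T x \<omega>))\<^sup>2 + (resid \<epsilon> (T y \<omega>))\<^sup>2) / 2)" for x y
    using sq(1) by simp
  have iG: "integrable M (\<lambda>\<omega>. G z \<omega>)" for z
    by (rule Bochner_Integration.integrable_bound[OF isum[of "fst z" "snd z"]])
       (use Gle in \<open>auto simp: G_def intro!: AE_I2\<close>)
  have absG: "(\<integral>\<omega>. \<bar>G z \<omega>\<bar> \<partial>M) \<le> D" for z
  proof -
    have "(\<integral>\<omega>. \<bar>G z \<omega>\<bar> \<partial>M) \<le> (\<integral>\<omega>. ((resid \<epsilon> (T (fst z) \<omega>))\<^sup>2 + (resid \<epsilon> (T (snd z) \<omega>))\<^sup>2) / 2 \<partial>M)"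
      by (intro integral_mono isum Gle integrable_abs iG)
    also have "\<dots> = D" using sq by simp
    finally show ?thesis .
  qed
  have int: "integrable (?P \<Otimes>\<^sub>M M) (case_prod G)"
  proof (rule PM.Fubini_integrable)
    show mc: "case_prod G \<in> borel_measurable (?P \<Otimes>\<^sub>M M)" using mG by (simp add: split_def)
    show "integrable ?P (\<lambda>z. \<integral>\<omega>. norm (case_prod G (z, \<omega>)) \<partial>M)"
    proof (rule TT.integrable_const_bound[where B = D])
      show "AE z in ?P. norm (\<integral>\<omega>. norm (case_prod G (z, \<omega>)) \<partial>M) \<le> D" using absG by simp
      show "(\<lambda>z. \<integral>\<omega>. norm (case_prod G (z, \<omega>)) \<partial>M) \<in> borel_measurable ?P"
        using mG by (intro borel_measurable_lebesgue_integral) (simp add: split_def)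
    qed
    show "AE z in ?P. integrable M (\<lambda>\<omega>. case_prod G (z, \<omega>))" using iG by simp
  qed
  have R: "(\<integral>z. G z \<omega> \<partial>?P) = (residual \<epsilon> \<omega>)\<^sup>2" for \<omega>
    using integral_pair_product(2)[OF torus_measure.prob_space_axioms torus_measure.prob_space_axioms
        integrable_torus_resid[OF eps(1)] integrable_torus_resid[OF eps(1)], of \<omega> \<omega>]
    by (simp add: G_def residual_def power2_eq_square)
  have iR: "integrable M (\<lambda>\<omega>. (residual \<epsilon> \<omega>)\<^sup>2)"
    using PM.integrable_snd[OF int] by (simp add: R)
  have "(\<integral>\<omega>. (residual \<epsilon> \<omega>)\<^sup>2 \<partial>M) = (\<integral>z. \<integral>\<omega>. G z \<omega> \<partial>M \<partial>?P)"
    using PM.Fubini_integral[OF int] by (simp add: R)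
  also have "\<dots> \<le> 3 * c"
  proof (rule integral_le_of_nn_integral_le)
    let ?h = "\<lambda>r::real. 3 * (r ^ 4 / sqrt (1 - r\<^sup>2))"
    show "AE z in ?P. (\<integral>\<omega>. G z \<omega> \<partial>M) \<le> ?h (wave_cov n (fst z - snd z))"
      using torus_pair_wave_cov_lt
    proof eventually_elim
      case (elim z)
      then show ?case unfolding G_def
        by (intro resid_pair[OF prob_space_axioms _ _ wave_gaussian_pair wave_gaussian_pair' _ eps]) auto
    qed
    have "(\<integral>\<^sup>+z. ennreal (?h (wave_cov n (fst z - snd z))) \<partial>?P) = (\<integral>\<^sup>+x. ennreal (?h (wave_cov n x)) \<partial>torus_measure)"
      by (rule nn_integral_torus_difference[where h = "\<lambda>r. ennreal (?h r)"]) measurable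
    also have "\<dots> = (\<integral>\<^sup>+x. 3 * ennreal (wave_cov n x ^ 4 / sqrt (1 - (wave_cov n x)\<^sup>2)) \<partial>torus_measure)"
      by (intro nn_integral_cong) (simp add: ennreal_mult'[of 3, symmetric] flip: ennreal_numeral)
    also have "\<dots> = 3 * (\<integral>\<^sup>+x. ennreal (wave_cov n x ^ 4 / sqrt (1 - (wave_cov n x)\<^sup>2)) \<partial>torus_measure)"
      by (rule nn_integral_cmult) measurable
    also have "\<dots> \<le> 3 * ennreal c" using singular by (rule mult_left_mono) simp
    also have "\<dots> = ennreal (3 * c)" using c by (simp add: ennreal_mult)
    finally show "(\<integral>\<^sup>+z. ennreal (?h (wave_cov n (fst z - snd z))) \<partial>?P) \<le> ennreal (3 * c)" .
  qed (use c in simp)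
  finally have "ennreal (\<integral>\<omega>. (residual \<epsilon> \<omega>)\<^sup>2 \<partial>M) \<le> ennreal (3 * c)" by (rule ennreal_leI)
  then show ?thesis using iR by (subst nn_integral_eq_integral) auto
qed

end

lemma window_mean_tendsto:
  fixes f :: "real \<Rightarrow> real"
  assumes f: "isCont f 0" and [measurable]: "f \<in> borel_measurable borel"
  shows "((\<lambda>\<epsilon>. \<integral>t. f t \<partial>window_measure \<epsilon>) \<longlongrightarrow> f 0) (at_right 0)"
proof (rule tendstoI)
  fix e :: real assume e: "0 < e"
  obtain d where d: "d > 0" "\<And>t. \<bar>t\<bar> < d \<Longrightarrow> \<bar>f t - f 0\<bar> < e / 2"
    using f[unfolded continuous_at_eps_delta, rule_format, of "e / 2"] e by (auto simp: dist_real_def)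
  have "eventually (\<lambda>\<epsilon>. 0 < \<epsilon> \<and> \<epsilon> < d) (at_right 0)"
    using eventually_at_right_real[OF d(1)] by (rule eventually_mono) auto
  then show "\<forall>\<^sub>F \<epsilon> in at_right 0. dist (\<integral>t. f t \<partial>window_measure \<epsilon>) (f 0) < e"
  proof eventually_elim
    case (elim \<epsilon>)
    then have eps: "\<epsilon> > 0" "\<epsilon> < d" by auto
    interpret W: prob_space "window_measure \<epsilon>" by (rule prob_space_window_measure[OF eps(1)])
    have near: "\<bar>f t - f 0\<bar> < e / 2" if "\<bar>t\<bar> < \<epsilon>" for t using d(2)[of t] that eps by linarith
    have int: "integrable (window_measure \<epsilon>) f"
    proof (rule bounded_integrable_window[OF eps(1), of _ "\<bar>f 0\<bar> + e / 2"])
      fix t assume "\<bar>t\<bar> < \<epsilon>"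
      from near[OF this] show "\<bar>f t\<bar> \<le> \<bar>f 0\<bar> + e / 2" by linarith
    qed measurable
    have "AE t in window_measure \<epsilon>. f t \<le> f 0 + e / 2"
      using AE_window_measure[OF eps(1)] by (rule eventually_mono) (drule near, linarith)
    moreover have "AE t in window_measure \<epsilon>. f 0 - e / 2 \<le> f t"
      using AE_window_measure[OF eps(1)] by (rule eventually_mono) (drule near, linarith)
    ultimately have "(\<integral>t. f t \<partial>window_measure \<epsilon>) \<le> f 0 + e / 2" "f 0 - e / 2 \<le> (\<integral>t. f t \<partial>window_measure \<epsilon>)"
      using W.integral_le_const[OF int] W.integral_ge_const[OF int] by blast+
    then show ?case using e unfolding dist_real_def by linarith
  qed
qed

text \<open>The value of the standard normal density at \<open>0\<close>.\<close>

definition peak :: real where "peak = 1 / sqrt (2 * pi)"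

lemma peak_pos: "peak > 0" by (simp add: peak_def)

lemma std_normal_density_isCont: "isCont std_normal_density t"
  unfolding std_normal_density_def[abs_def] by (intro continuous_intros) auto

lemma hermite_tendsto:
  "(hermite0 \<longlongrightarrow> peak) (at_right 0)" "(hermite2 \<longlongrightarrow> peak) (at_right 0)"
proof -
  have ev: "eventually (\<lambda>\<epsilon>::real. 0 < \<epsilon>) (at_right 0)" by (simp add: eventually_at_right_less)
  have peak: "std_normal_density 0 = peak" "std_normal_density 0 * (1 - 0\<^sup>2) = peak"
    by (simp_all add: peak_def std_normal_density_def)
  have lim0: "((\<lambda>\<epsilon>. \<integral>t. std_normal_density t \<partial>window_measure \<epsilon>) \<longlongrightarrow> std_normal_density 0) (at_right 0)"
    by (intro window_mean_tendsto std_normal_density_isCont) simp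
  show "(hermite0 \<longlongrightarrow> peak) (at_right 0)"
    by (rule Lim_transform_eventually[OF lim0[unfolded peak(1)]], rule eventually_mono[OF ev]) (simp only: hermite0_eq)
  have lim2: "((\<lambda>\<epsilon>. \<integral>t. std_normal_density t * (1 - t\<^sup>2) \<partial>window_measure \<epsilon>) \<longlongrightarrow> std_normal_density 0 * (1 - 0\<^sup>2)) (at_right 0)"
    by (rule window_mean_tendsto[where f = "\<lambda>t. std_normal_density t * (1 - t\<^sup>2)"])
       (intro isCont_mult isCont_diff isCont_power continuous_ident continuous_const std_normal_density_isCont, measurable)
  show "(hermite2 \<longlongrightarrow> peak) (at_right 0)"
    by (rule Lim_transform_eventually[OF lim2[unfolded peak(2)]], rule eventually_mono[OF ev]) (simp only: hermite2_eq)
qed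

text \<open>Convergence in probability is fast enough along a suitable sequence to hold almost surely.\<close>

lemma (in prob_space) tendsto_in_probability_AE_sequence:
  assumes conv: "tendsto_in_probability M X Y (at_right (0::real))"
    and X: "\<And>\<epsilon>. \<epsilon> > 0 \<Longrightarrow> X \<epsilon> \<in> borel_measurable M" and Y[measurable]: "Y \<in> borel_measurable M"
  shows "\<exists>e. (\<forall>k. 0 < e k \<and> e k \<le> 1) \<and> filterlim e (at_right 0) sequentially \<and>
    (AE \<omega> in M. (\<lambda>k. X (e k) \<omega>) \<longlonglongrightarrow> Y \<omega>)"
proof -
  have ex: "\<exists>\<epsilon>. 0 < \<epsilon> \<and> \<epsilon> < 1 / real (Suc k) \<and> measure M {\<omega> \<in> space M. \<bar>X \<epsilon> \<omega> - Y \<omega>\<bar> > (1/2) ^ k} < (1/2) ^ k" for k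
  proof -
    have "eventually (\<lambda>\<epsilon>. measure M {\<omega> \<in> space M. \<bar>X \<epsilon> \<omega> - Y \<omega>\<bar> > (1/2) ^ k} < (1/2) ^ k) (at_right 0)"
      using conv unfolding tendsto_in_probability_def by (intro order_tendstoD(2)[where y = 0]) auto
    moreover have "eventually (\<lambda>\<epsilon>. 0 < \<epsilon> \<and> \<epsilon> < 1 / real (Suc k)) (at_right 0)"
      using eventually_at_right_real[of 0 "1 / real (Suc k)"] by (rule eventually_mono) auto
    ultimately have "eventually (\<lambda>\<epsilon>. 0 < \<epsilon> \<and> \<epsilon> < 1 / real (Suc k) \<and> measure M {\<omega> \<in> space M. \<bar>X \<epsilon> \<omega> - Y \<omega>\<bar> > (1/2) ^ k} < (1/2) ^ k) (at_right 0)"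
      by eventually_elim auto
    then show ?thesis by (rule eventually_happens'[rotated]) simp
  qed
  have "\<forall>k. \<exists>\<epsilon>. 0 < \<epsilon> \<and> \<epsilon> < 1 / real (Suc k) \<and> measure M {\<omega> \<in> space M. \<bar>X \<epsilon> \<omega> - Y \<omega>\<bar> > (1/2) ^ k} < (1/2) ^ k"
    using ex by (rule allI)
  from choice[OF this] obtain e where
    "\<forall>k. 0 < e k \<and> e k < 1 / real (Suc k) \<and> measure M {\<omega> \<in> space M. \<bar>X (e k) \<omega> - Y \<omega>\<bar> > (1/2) ^ k} < (1/2) ^ k"
    by (rule exE)
  then have e: "\<And>k. 0 < e k" "\<And>k. e k < 1 / real (Suc k)"
    and small: "\<And>k. measure M {\<omega> \<in> space M. \<bar>X (e k) \<omega> - Y \<omega>\<bar> > (1/2) ^ k} < (1/2) ^ k"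
    by simp_all
  have le1: "e k \<le> 1" for k
  proof -
    have "1 / real (Suc k) \<le> 1" by simp
    then show ?thesis using e(2)[of k] by linarith
  qed
  have "e \<longlonglongrightarrow> 0"
  proof (rule tendsto_sandwich[where f = "\<lambda>_. 0" and h = "\<lambda>k. 1 / real (Suc k)"])
    show "(\<lambda>k. 1 / real (Suc k)) \<longlonglongrightarrow> 0" by (rule LIMSEQ_Suc[OF lim_1_over_n])
    show "\<forall>\<^sub>F k in sequentially. 0 \<le> e k" by (intro always_eventually allI less_imp_le e(1))
    show "\<forall>\<^sub>F k in sequentially. e k \<le> 1 / real (Suc k)" by (intro always_eventually allI less_imp_le e(2))
  qed (rule tendsto_const)
  then have lim: "filterlim e (at_right 0) sequentially"
  proof -
    have "e k \<in> {0<..} \<and> e k \<noteq> 0" for k using e(1)[of k] by simp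
    then show ?thesis unfolding filterlim_at using \<open>e \<longlonglongrightarrow> 0\<close> by simp
  qed
  define A where "A k = {\<omega> \<in> space M. \<bar>X (e k) \<omega> - Y \<omega>\<bar> > (1/2) ^ k}" for k
  have [measurable]: "X (e k) \<in> borel_measurable M" for k using X e(1) by blast
  have "AE \<omega> in M. eventually (\<lambda>k. \<omega> \<in> space M - A k) sequentially"
  proof (rule borel_cantelli_AE1)
    show "A k \<in> sets M" for k unfolding A_def by measurable
    show "emeasure M (A k) < \<infinity>" for k by (simp add: emeasure_eq_measure)
    show "summable (\<lambda>k. measure M (A k))"
    proof (rule summable_comparison_test')
      show "summable (\<lambda>k. (1/2 :: real) ^ k)" by (rule summable_geometric) simp
      show "norm (measure M (A k)) \<le> (1/2) ^ k" for k
        using small[of k] unfolding A_def[symmetric] by simp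
    qed
  qed
  then have "AE \<omega> in M. (\<lambda>k. X (e k) \<omega>) \<longlonglongrightarrow> Y \<omega>"
  proof eventually_elim
    case (elim \<omega>)
    then have "eventually (\<lambda>k. norm (X (e k) \<omega> - Y \<omega>) \<le> (1/2) ^ k) sequentially"
      by (rule eventually_mono) (simp add: A_def not_less)
    then have "(\<lambda>k. X (e k) \<omega> - Y \<omega>) \<longlonglongrightarrow> 0"
      by (rule Lim_null_comparison) (rule LIMSEQ_power_zero, simp)
    then show ?case by (rule LIM_zero_cancel)
  qed
  then show ?thesis by (intro exI[of _ e] conjI allI e(1) le1 lim)
qed

context arithmetic_wave
begin

text \<open>The bound for a positive window width is uniform, so Fatou's lemma carries it to the limit along
  a sequence of almost sure convergence.\<close>

lemma leray_residual_second_moment: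
  assumes leray: "is_leray_measure M T Z" and c: "0 \<le> c"
    and singular: "(\<integral>\<^sup>+x. ennreal (wave_cov n x ^ 4 / sqrt (1 - (wave_cov n x)\<^sup>2)) \<partial>torus_measure) \<le> ennreal c"
  shows "(\<integral>\<^sup>+\<omega>. ennreal ((Z \<omega> - peak + peak / 2 * (energy \<omega> / m - 1))\<^sup>2) \<partial>M) \<le> ennreal (3 * c)"
proof -
  have [measurable]: "Z \<in> borel_measurable M" using leray by (simp add: is_leray_measure_def)
  obtain e where "(\<forall>k. 0 < e k \<and> e k \<le> 1) \<and> filterlim e (at_right 0) sequentially \<and>
      (AE \<omega> in M. (\<lambda>k. leray_approx T (e k) \<omega>) \<longlonglongrightarrow> Z \<omega>)"
    using tendsto_in_probability_AE_sequence[OF leray[unfolded is_leray_measure_def, THEN conjunct2] leray_approx_measurable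
        leray[unfolded is_leray_measure_def, THEN conjunct1], simplified]
    by (rule exE)
  then have e: "\<And>k. 0 < e k" "\<And>k. e k \<le> 1" "filterlim e (at_right 0) sequentially"
    and conv: "AE \<omega> in M. (\<lambda>k. leray_approx T (e k) \<omega>) \<longlonglongrightarrow> Z \<omega>"
    by simp_all
  have h: "(\<lambda>k. hermite0 (e k)) \<longlonglongrightarrow> peak" "(\<lambda>k. hermite2 (e k)) \<longlonglongrightarrow> peak"
    using filterlim_compose[OF hermite_tendsto(1) e(3)] filterlim_compose[OF hermite_tendsto(2) e(3)] by simp_all
  let ?R = "\<lambda>\<omega>. Z \<omega> - peak + peak / 2 * (energy \<omega> / m - 1)"
  have "AE \<omega> in M. ennreal ((?R \<omega>)\<^sup>2) = liminf (\<lambda>k. ennreal ((residual (e k) \<omega>)\<^sup>2))"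
    using conv AE_space
  proof eventually_elim
    case (elim \<omega>)
    have "(\<lambda>k. residual (e k) \<omega>) \<longlonglongrightarrow> ?R \<omega>"
      unfolding residual_def integral_torus_resid[OF e(1) elim(2)]
      by (intro tendsto_intros elim(1) h) simp
    then have "(\<lambda>k. ennreal ((residual (e k) \<omega>)\<^sup>2)) \<longlonglongrightarrow> ennreal ((?R \<omega>)\<^sup>2)"
      by (intro tendsto_ennrealI tendsto_intros)
    then show ?case by (rule lim_imp_Liminf[OF trivial_limit_sequentially, symmetric])
  qed
  then have "(\<integral>\<^sup>+\<omega>. ennreal ((?R \<omega>)\<^sup>2) \<partial>M) = (\<integral>\<^sup>+\<omega>. liminf (\<lambda>k. ennreal ((residual (e k) \<omega>)\<^sup>2)) \<partial>M)"
    by (rule nn_integral_cong_AE)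
  also have "\<dots> \<le> liminf (\<lambda>k. \<integral>\<^sup>+\<omega>. ennreal ((residual (e k) \<omega>)\<^sup>2) \<partial>M)"
    by (rule nn_integral_liminf) measurable
  also have "\<dots> \<le> liminf (\<lambda>k. ennreal (3 * c))"
    by (intro Liminf_mono always_eventually allI residual_second_moment e c singular)
  also have "\<dots> = ennreal (3 * c)" by (simp add: Liminf_const)
  finally show ?thesis .
qed

end

section \<open>Stein's equation\<close>

lemma continuous_on_lipschitz:
  fixes h :: "real \<Rightarrow> real"
  assumes "\<And>x y. \<bar>h x - h y\<bar> \<le> \<bar>x - y\<bar>" shows "continuous_on UNIV h"
  by (rule lipschitz_on_continuous_on[of 1]) (use assms in \<open>auto simp: lipschitz_on_def dist_real_def\<close>)

lemmas borel_measurable_lipschitz = borel_measurable_continuous_onI[OF continuous_on_lipschitz]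

lemma (in prob_space) integrable_lipschitz:
  fixes h :: "real \<Rightarrow> real"
  assumes lip: "\<And>x y. \<bar>h x - h y\<bar> \<le> \<bar>x - y\<bar>" and X: "integrable M X"
  shows "integrable M (\<lambda>\<omega>. h (X \<omega>))"
proof (rule Bochner_Integration.integrable_bound)
  note [measurable] = borel_measurable_integrable[OF X] borel_measurable_lipschitz[OF lip]
  show "integrable M (\<lambda>\<omega>. \<bar>h 0\<bar> + \<bar>X \<omega>\<bar>)" using X by simp
  show "AE \<omega> in M. norm (h (X \<omega>)) \<le> norm (\<bar>h 0\<bar> + \<bar>X \<omega>\<bar>)"
  proof (rule AE_I2)
    fix \<omega> show "norm (h (X \<omega>)) \<le> norm (\<bar>h 0\<bar> + \<bar>X \<omega>\<bar>)" using lip[of "X \<omega>" 0] by auto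
  qed
  show "(\<lambda>\<omega>. h (X \<omega>)) \<in> borel_measurable M" by measurable
qed

lemma antiderivative_line:
  fixes g :: "real \<Rightarrow> real"
  assumes cont: "continuous_on UNIV g" and int: "integrable lborel g"
  shows "\<exists>G. (\<forall>x. (G has_real_derivative g x) (at x)) \<and> (G \<longlongrightarrow> 0) at_bot \<and> (G \<longlongrightarrow> (\<integral>t. g t \<partial>lborel)) at_top"
proof -
  define G where "G x = (\<integral>t. indicator {..x} t * g t \<partial>lborel)" for x
  have [measurable]: "g \<in> borel_measurable borel" using borel_measurable_continuous_onI[OF cont] .
  have inti: "integrable lborel (\<lambda>t. indicator A t * g t)" if "A \<in> sets borel" for A
    using integrable_mult_indicator[OF _ int, of A] that by simp
  have diff: "G y - G x = integral {x..y} g" if "x \<le> y" for x y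
  proof -
    have "G y = (\<integral>t. indicator {..x} t * g t + indicator {x<..y} t * g t \<partial>lborel)"
      unfolding G_def using that by (intro Bochner_Integration.integral_cong) (auto simp: indicator_def)
    also have "\<dots> = G x + (\<integral>t. indicator {x<..y} t * g t \<partial>lborel)"
      unfolding G_def by (intro Bochner_Integration.integral_add inti) auto
    also have "(\<integral>t. indicator {x<..y} t * g t \<partial>lborel) = (\<integral>t. indicator {x..y} t * g t \<partial>lborel)"
    proof (rule integral_cong_AE)
      show "AE t in lborel. indicator {x<..y} t * g t = indicator {x..y} t * g t"
        using AE_lborel_singleton[of x] by eventually_elim (auto simp: indicator_def)
    qed auto
    also have "\<dots> = (LINT t : {x..y} | lborel. g t)" by (simp add: set_lebesgue_integral_def)
    also have "\<dots> = integral {x..y} g"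
      using inti[of "{x..y}"] by (intro set_borel_integral_eq_integral(2)) (simp add: set_integrable_def)
    finally show ?thesis by simp
  qed
  have der: "(G has_real_derivative g x) (at x)" for x
  proof -
    have "((\<lambda>y. integral {x - 1..y} g) has_real_derivative g x) (at x within {x - 1..x + 1})"
      by (intro integral_has_real_derivative continuous_on_subset[OF cont]) auto
    then have "((\<lambda>y. G (x - 1) + integral {x - 1..y} g) has_real_derivative (0 + g x)) (at x within {x - 1..x + 1})"
      by (intro DERIV_add) auto
    then have "((\<lambda>y. G (x - 1) + integral {x - 1..y} g) has_real_derivative g x) (at x within {x - 1..x + 1})"
      by (simp only: add_0_left)
    then have "(G has_real_derivative g x) (at x within {x - 1..x + 1})"
    proof (rule has_field_derivative_transform_within[where d = 1])
      fix y assume "y \<in> {x - 1..x + 1}"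
      then show "G (x - 1) + integral {x - 1..y} g = G y" using diff[of "x - 1" y] by simp
    qed auto
    then show ?thesis by (subst (asm) at_within_interior) auto
  qed
  have top: "(G \<longlongrightarrow> (\<integral>t. g t \<partial>lborel)) at_top"
    unfolding G_def
  proof (rule integral_dominated_convergence_at_top[where w = "\<lambda>t. \<bar>g t\<bar>"])
    show "AE t in lborel. ((\<lambda>x. indicator {..x} t * g t) \<longlongrightarrow> g t) at_top"
    proof (rule AE_I2)
      fix t
      show "((\<lambda>x. indicator {..x} t * g t) \<longlongrightarrow> g t) at_top"
        by (rule tendsto_eventually) (use eventually_ge_at_top[of t] in eventually_elim, simp)
    qed
  qed (use int in \<open>auto simp: indicator_def\<close>)
  have "((\<lambda>x. \<integral>t. indicator {..- x} t * g t \<partial>lborel) \<longlongrightarrow> (\<integral>t. 0 \<partial>(lborel :: real measure))) at_top"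
  proof (rule integral_dominated_convergence_at_top[where w = "\<lambda>t. \<bar>g t\<bar>" and s = "\<lambda>x t. indicator {..- x} t * g t" and f = "\<lambda>_. 0"])
    show "AE t in lborel. ((\<lambda>x. indicator {..- x} t * g t) \<longlongrightarrow> 0) at_top"
    proof (rule AE_I2)
      fix t
      show "((\<lambda>x. indicator {..- x} t * g t) \<longlongrightarrow> 0) at_top"
        by (rule tendsto_eventually) (use eventually_gt_at_top[of "- t"] in eventually_elim, simp)
    qed
  qed (use int in \<open>auto simp: indicator_def\<close>)
  then have "(G \<longlongrightarrow> 0) at_bot" by (simp add: filterlim_at_bot_mirror G_def)
  with der top show ?thesis by blast
qed

lemma nonneg_of_decreasing_to_0:
  fixes D :: "real \<Rightarrow> real"
  assumes D: "\<And>y. x \<le> y \<Longrightarrow> \<exists>d. (D has_real_derivative d) (at y) \<and> d \<le> 0" and lim: "(D \<longlongrightarrow> 0) at_top"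
  shows "0 \<le> D x"
proof (rule tendsto_upperbound[OF lim])
  show "\<forall>\<^sub>F y in at_top. D y \<le> D x"
    using eventually_ge_at_top[of x]
    by eventually_elim (rule DERIV_nonpos_imp_nonincreasing, auto intro: D)
qed simp

lemma std_normal_density_deriv: "(std_normal_density has_real_derivative (- x * std_normal_density x)) (at x)"
proof -
  have "((\<lambda>x::real. exp (- x\<^sup>2 / 2)) has_real_derivative (exp (- x\<^sup>2 / 2) * (- x))) (at x)"
    by (auto intro!: derivative_eq_intros)
  from DERIV_cmult[OF this, of "1 / sqrt (2 * pi)"] show ?thesis
    unfolding std_normal_density_def[abs_def] by (simp add: mult_ac)
qed

lemma gaussian_tail_tendsto_0:
  fixes c :: real assumes "c > 0"
  shows "((\<lambda>t. (t\<^sup>2) ^ k * exp (- c * t\<^sup>2)) \<longlongrightarrow> 0) at_top"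
proof -
  have "filterlim (\<lambda>t::real. t\<^sup>2) at_top at_top" by (intro filterlim_pow_at_top filterlim_ident) auto
  then have "filterlim (\<lambda>t::real. c * t\<^sup>2) at_top at_top"
    using assms by (intro filterlim_tendsto_pos_mult_at_top[OF tendsto_const]) auto
  from filterlim_compose[OF tendsto_power_div_exp_0[of k] this]
  have "((\<lambda>t. 1 / c ^ k * ((c * t\<^sup>2) ^ k / exp (c * t\<^sup>2))) \<longlongrightarrow> 1 / c ^ k * 0) at_top"
    by (intro tendsto_mult tendsto_const)
  moreover have "1 / c ^ k * ((c * t\<^sup>2) ^ k / exp (c * t\<^sup>2)) = (t\<^sup>2) ^ k * exp (- c * t\<^sup>2)" for t
    using assms by (simp add: power_mult_distrib exp_minus field_simps)
  ultimately show ?thesis by simp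
qed

lemma std_normal_density_tendsto_0: "(std_normal_density \<longlongrightarrow> 0) at_top"
  using tendsto_mult_left[OF gaussian_tail_tendsto_0[of "1/2" 0], of "1 / sqrt (2 * pi)"]
  unfolding std_normal_density_def[abs_def] by simp

text \<open>The function \<open>H\<close> is minus the tail integral of \<open>(h - \<mu>)\<close> against the Gaussian density \<open>f\<close>, and \<open>Q\<close> below
  is the Gaussian tail. The estimates \<open>ab\<close> and \<open>d\<close> compare such tails with closed forms by comparing
  derivatives, everything vanishing at infinity: by \<open>ab\<close>, replacing \<open>h\<close> by its value at \<open>x\<close> changes the
  tail by at most \<open>f x - x * Q x\<close>, since \<open>h\<close> is Lipschitz, and by \<open>d\<close>, the classical bound on Mills'
  ratio, this is at most \<open>f x / (1 + x\<^sup>2)\<close>, which compensates the growth of \<open>h x - \<mu>\<close>.\<close>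

lemma stein_bound_nonneg:
  fixes h H :: "real \<Rightarrow> real"
  assumes lip: "\<And>x y. \<bar>h x - h y\<bar> \<le> \<bar>x - y\<bar>" and mean: "\<And>x. \<bar>h x - \<mu>\<bar> \<le> \<bar>x\<bar> + 1"
    and H: "\<And>x. (H has_real_derivative ((h x - \<mu>) * std_normal_density x)) (at x)" "(H \<longlongrightarrow> 0) at_top"
    and x: "0 \<le> x"
  shows "\<bar>h x - \<mu> + x * (H x / std_normal_density x)\<bar> \<le> 2"
proof -
  let ?f = std_normal_density
  have f0: "0 < ?f t" for t by (simp add: normal_density_pos)
  have cont: "continuous_on UNIV ?f" by (simp add: continuous_on_eq_continuous_at std_normal_density_isCont)
  obtain G where G: "\<And>t. (G has_real_derivative ?f t) (at t)" "(G \<longlongrightarrow> 1) at_top"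
    using antiderivative_line[OF cont] by auto
  define Q where "Q t = 1 - G t" for t
  have Q: "(Q has_real_derivative (- ?f t)) (at t)" for t
    unfolding Q_def[abs_def] using DERIV_diff[OF DERIV_const G(1)] by simp
  have Qlim: "(Q \<longlongrightarrow> 0) at_top" unfolding Q_def[abs_def] using tendsto_diff[OF tendsto_const G(2), of 1] by simp
  define c where "c = h x - \<mu>"
  have ab: "0 \<le> ?f x - x * Q x + e * (H x + c * Q x)" if e: "e = 1 \<or> e = - 1" for e
  proof (rule nonneg_of_decreasing_to_0[where D = "\<lambda>y. ?f y - x * Q y + e * (H y + c * Q y)"])
    fix y assume y: "x \<le> y"
    have "((\<lambda>y. ?f y - x * Q y + e * (H y + c * Q y)) has_real_derivative
        (- y * ?f y - x * (- ?f y) + e * ((h y - \<mu>) * ?f y + c * (- ?f y)))) (at y)"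
      by (intro DERIV_diff DERIV_add DERIV_cmult Q H(1) std_normal_density_deriv)
    moreover have "- y * ?f y - x * (- ?f y) + e * ((h y - \<mu>) * ?f y + c * (- ?f y)) = - (((y - x) - e * (h y - h x)) * ?f y)"
      by (simp add: c_def algebra_simps)
    moreover have "- (((y - x) - e * (h y - h x)) * ?f y) \<le> 0"
      unfolding neg_le_0_iff_le using lip[of y x] y f0[of y] e by (intro mult_nonneg_nonneg) auto
    ultimately show "\<exists>d. ((\<lambda>y. ?f y - x * Q y + e * (H y + c * Q y)) has_real_derivative d) (at y) \<and> d \<le> 0"
      by (intro exI conjI) (simp only:)+
  next
    have "((\<lambda>y. ?f y - x * Q y + e * (H y + c * Q y)) \<longlongrightarrow> 0 - x * 0 + e * (0 + c * 0)) at_top"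
      by (intro tendsto_intros std_normal_density_tendsto_0 Qlim H(2))
    then show "((\<lambda>y. ?f y - x * Q y + e * (H y + c * Q y)) \<longlongrightarrow> 0) at_top" by simp
  qed
  have d: "0 \<le> Q x - x / (1 + x\<^sup>2) * ?f x"
  proof (rule nonneg_of_decreasing_to_0[where D = "\<lambda>y. Q y - y / (1 + y\<^sup>2) * ?f y"])
    fix y assume y: "x \<le> y"
    define u where "u = 1 + y\<^sup>2"
    have u: "u > 0" using zero_le_power2[of y] unfolding u_def by linarith
    have yy: "y * y = u - 1" by (simp add: u_def power2_eq_square)
    have quot: "((\<lambda>y. y / (1 + y\<^sup>2)) has_real_derivative ((1 * u - y * (2 * y)) / (u * u))) (at y)"
      unfolding u_def
      by (rule DERIV_divide) (use u in \<open>auto intro!: derivative_eq_intros simp: u_def\<close>)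
    have "((\<lambda>y. Q y - y / (1 + y\<^sup>2) * ?f y) has_real_derivative
        (- ?f y - ((1 * u - y * (2 * y)) / (u * u) * ?f y + (- y * ?f y) * (y / (1 + y\<^sup>2))))) (at y)"
      by (intro DERIV_diff DERIV_mult Q std_normal_density_deriv quot)
    moreover have "- ?f y - ((1 * u - y * (2 * y)) / (u * u) * ?f y + (- y * ?f y) * (y / (1 + y\<^sup>2))) = - (2 / (u * u) * ?f y)"
    proof -
      have gen: "- F - (A * F + (- y * F) * B) = - ((1 + (A - y * B)) * F)" for A B F :: real
        by (simp add: algebra_simps)
      have A: "1 * u - y * (2 * y) = 2 - u" and B: "y * (y / u) = (u - 1) / u" using yy by simp_all
      have "1 + ((1 * u - y * (2 * y)) / (u * u) - y * (y / u)) = 2 / (u * u)"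
        unfolding A B using u by (simp add: field_simps)
      then show ?thesis unfolding gen u_def[symmetric] by (simp only:)
    qed
    moreover have "- (2 / (u * u) * ?f y) \<le> 0"
      unfolding neg_le_0_iff_le using f0[of y] u by (intro mult_nonneg_nonneg) auto
    ultimately show "\<exists>d. ((\<lambda>y. Q y - y / (1 + y\<^sup>2) * ?f y) has_real_derivative d) (at y) \<and> d \<le> 0"
      by (intro exI conjI) (simp only:)+
  next
    have "((\<lambda>y. y / (1 + y\<^sup>2) * ?f y) \<longlongrightarrow> 0) at_top"
    proof (rule Lim_null_comparison[OF always_eventually std_normal_density_tendsto_0], rule allI)
      fix y :: real
      have "\<bar>y\<bar> \<le> 1 + y\<^sup>2"
        using zero_le_power2[of "\<bar>y\<bar> - 1"] zero_le_power2[of y] by (simp add: power2_diff)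
      moreover have "0 < 1 + y\<^sup>2" using zero_le_power2[of y] by linarith
      ultimately have "\<bar>y / (1 + y\<^sup>2)\<bar> \<le> 1" by (simp add: abs_divide divide_le_eq)
      then have "\<bar>y / (1 + y\<^sup>2)\<bar> * ?f y \<le> 1 * ?f y" using f0[of y] by (intro mult_right_mono) auto
      then show "norm (y / (1 + y\<^sup>2) * ?f y) \<le> ?f y" using f0[of y] by (simp add: abs_mult)
    qed
    then show "((\<lambda>y. Q y - y / (1 + y\<^sup>2) * ?f y) \<longlongrightarrow> 0) at_top" using tendsto_diff[OF Qlim] by fastforce
  qed
  define m where "m = 1 - x * (Q x / ?f x)"
  have pos: "0 < 1 + x\<^sup>2" using zero_le_power2[of x] by linarith
  have m0: "\<bar>(H x + c * Q x) / ?f x\<bar> \<le> m"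
  proof -
    have "\<bar>H x + c * Q x\<bar> \<le> ?f x - x * Q x" using ab[of 1] ab[of "- 1"] by simp
    then have "\<bar>H x + c * Q x\<bar> / ?f x \<le> (?f x - x * Q x) / ?f x" using f0[of x] by (intro divide_right_mono) auto
    then show ?thesis using f0[of x] by (simp add: m_def abs_divide diff_divide_distrib)
  qed
  have m1: "m \<le> 1 / (1 + x\<^sup>2)"
  proof -
    have "x / (1 + x\<^sup>2) \<le> Q x / ?f x" using d f0[of x] by (simp add: le_divide_eq)
    then have "x * (x / (1 + x\<^sup>2)) \<le> x * (Q x / ?f x)" using x by (rule mult_left_mono)
    moreover have "1 - x * (x / (1 + x\<^sup>2)) = 1 / (1 + x\<^sup>2)" using pos by (simp add: field_simps power2_eq_square)
    ultimately show ?thesis unfolding m_def by linarith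
  qed
  have m2: "0 \<le> m" using m0 by linarith
  have "h x - \<mu> + x * (H x / ?f x) = c * m + x * ((H x + c * Q x) / ?f x)"
    using f0[of x] by (simp add: c_def m_def field_simps)
  also have "\<bar>\<dots>\<bar> \<le> \<bar>c\<bar> * m + x * m"
  proof (intro order.trans[OF abs_triangle_ineq] add_mono)
    show "\<bar>c * m\<bar> \<le> \<bar>c\<bar> * m" using m2 by (simp add: abs_mult)
    show "\<bar>x * ((H x + c * Q x) / ?f x)\<bar> \<le> x * m"
      unfolding abs_mult[of x] abs_of_nonneg[OF x] by (rule mult_left_mono[OF m0 x])
  qed
  also have "\<dots> = (\<bar>c\<bar> + x) * m" by (simp add: distrib_right)
  also have "\<dots> \<le> (2 * x + 1) * (1 / (1 + x\<^sup>2))"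
    using mean[of x] x m1 m2 by (intro mult_mono) (auto simp: c_def)
  also have "\<dots> \<le> 2"
  proof -
    have "2 * x + 1 \<le> 2 * (1 + x\<^sup>2)"
      using zero_le_power2[of "x - 1/2"] zero_le_power2[of x] by (simp add: power2_eq_square algebra_simps)
    then show ?thesis using pos by (simp add: divide_le_eq)
  qed
  finally show ?thesis .
qed

text \<open>The bound on the negative half line follows from the one on the positive half line by
  reflection.\<close>

lemma stein_solution:
  fixes h :: "real \<Rightarrow> real"
  assumes lip: "\<And>x y. \<bar>h x - h y\<bar> \<le> \<bar>x - y\<bar>"
  defines "\<mu> \<equiv> (\<integral>t. h t \<partial>std_normal_distribution)"
  shows "\<exists>f f'. (\<forall>x. (f has_real_derivative f' x) (at x)) \<and> continuous_on UNIV f' \<and> (\<forall>x. \<bar>f' x\<bar> \<le> 2) \<and>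
    (\<forall>x. f' x - x * f x = h x - \<mu>)"
proof -
  let ?f = std_normal_density
  have f0: "0 < ?f t" for t by (simp add: normal_density_pos)
  note conth = continuous_on_lipschitz[OF lip]
  note [measurable] = borel_measurable_lipschitz[OF lip]
  have inth: "integrable std_normal_distribution h"
    using std_normal.integrable_lipschitz[OF lip, of "\<lambda>t. t"] by simp
  have mean: "\<bar>h x - \<mu>\<bar> \<le> \<bar>x\<bar> + 1" for x
  proof -
    have "h x - \<mu> = (\<integral>t. h x - h t \<partial>std_normal_distribution)"
      using inth std_normal.prob_space by (simp add: \<mu>_def)
    also have "\<bar>\<dots>\<bar> \<le> (\<integral>t. \<bar>h x - h t\<bar> \<partial>std_normal_distribution)" by (rule integral_abs_bound)
    also have "\<dots> \<le> (\<integral>t. \<bar>x\<bar> + (1 + t\<^sup>2) / 2 \<partial>std_normal_distribution)"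
    proof (rule integral_mono)
      fix t :: real
      have "\<bar>t\<bar> \<le> (1 + t\<^sup>2) / 2" using zero_le_power2[of "\<bar>t\<bar> - 1"] by (simp add: power2_diff)
      then show "\<bar>h x - h t\<bar> \<le> \<bar>x\<bar> + (1 + t\<^sup>2) / 2" using lip[of x t] by linarith
    qed (use inth in simp_all)
    also have "\<dots> = \<bar>x\<bar> + 1" using std_normal.prob_space by (simp add: std_normal_moments)
    finally show ?thesis .
  qed
  have contg: "continuous_on UNIV (\<lambda>t. (h t - \<mu>) * ?f t)"
    by (intro continuous_intros conth) (simp add: continuous_on_eq_continuous_at std_normal_density_isCont)
  have intg: "integrable lborel (\<lambda>t. (h t - \<mu>) * ?f t)" "(\<integral>t. (h t - \<mu>) * ?f t \<partial>lborel) = 0"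
  proof -
    have "integrable std_normal_distribution (\<lambda>t. h t - \<mu>)" using inth by simp
    then have "integrable lborel (\<lambda>t. ?f t *\<^sub>R (h t - \<mu>))" by (subst (asm) integrable_density) auto
    then show "integrable lborel (\<lambda>t. (h t - \<mu>) * ?f t)" by (simp add: mult.commute)
    have "(\<integral>t. h t - \<mu> \<partial>std_normal_distribution) = (\<integral>t. ?f t *\<^sub>R (h t - \<mu>) \<partial>lborel)" by (rule integral_density) auto
    then show "(\<integral>t. (h t - \<mu>) * ?f t \<partial>lborel) = 0"
      using inth std_normal.prob_space by (simp add: mult.commute \<mu>_def)
  qed
  obtain H where H: "\<And>x. (H has_real_derivative ((h x - \<mu>) * ?f x)) (at x)" "(H \<longlongrightarrow> 0) at_bot" "(H \<longlongrightarrow> 0) at_top"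
    using antiderivative_line[OF contg intg(1)] unfolding intg(2) by blast
  define f where "f x = H x / ?f x" for x
  define f' where "f' x = h x - \<mu> + x * f x" for x
  have "(f has_real_derivative f' x) (at x)" for x
  proof -
    have "(f has_real_derivative (((h x - \<mu>) * ?f x * ?f x - H x * (- x * ?f x)) / (?f x * ?f x))) (at x)"
      unfolding f_def[abs_def] using f0[of x] by (intro DERIV_divide H(1) std_normal_density_deriv) simp
    moreover have "((h x - \<mu>) * ?f x * ?f x - H x * (- x * ?f x)) / (?f x * ?f x) = f' x"
      using f0[of x] by (simp add: f'_def f_def field_simps)
    ultimately show ?thesis by simp
  qed
  moreover have "continuous_on UNIV f'"
  proof -
    have "continuous_on UNIV f"
      unfolding continuous_on_eq_continuous_at[OF open_UNIV] using calculation DERIV_isCont by blast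
    then show ?thesis unfolding f'_def[abs_def] by (intro continuous_intros conth)
  qed
  moreover have "\<bar>f' x\<bar> \<le> 2" for x
  proof (cases "0 \<le> x")
    case True
    show ?thesis unfolding f'_def f_def by (rule stein_bound_nonneg[OF lip mean H(1,3) True])
  next
    case False
    have d: "((\<lambda>x. - H (- x)) has_real_derivative ((h (- x) - \<mu>) * ?f x)) (at x)" for x
    proof -
      have "((\<lambda>x. H (- x)) has_real_derivative ((h (- x) - \<mu>) * ?f (- x) * (- 1))) (at x)"
        by (rule DERIV_chain2[OF H(1)]) (auto intro!: derivative_eq_intros)
      from DERIV_minus[OF this] show ?thesis by (simp add: std_normal_density_def)
    qed
    have l: "((\<lambda>x. - H (- x)) \<longlongrightarrow> 0) at_top"
      using tendsto_minus[OF H(2)[unfolded filterlim_at_bot_mirror]] by simp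
    have "\<bar>h (- (- x)) - \<mu> + (- x) * (- H (- (- x)) / ?f (- x))\<bar> \<le> 2"
    proof (rule stein_bound_nonneg[where h = "\<lambda>x. h (- x)" and H = "\<lambda>x. - H (- x)"])
      show "\<bar>h (- x) - h (- y)\<bar> \<le> \<bar>x - y\<bar>" for x y using lip[of "- x" "- y"] by simp
      show "\<bar>h (- x) - \<mu>\<bar> \<le> \<bar>x\<bar> + 1" for x using mean[of "- x"] by simp
    qed (use d l False in auto)
    then show ?thesis by (simp add: f'_def f_def std_normal_density_def)
  qed
  moreover have "f' x - x * f x = h x - \<mu>" for x by (simp add: f'_def)
  ultimately show ?thesis by blast
qed

section \<open>The energy of the coefficients\<close>

abbreviation coord_density :: "real \<Rightarrow> real" where
  "coord_density \<equiv> normal_density 0 (sqrt (1/2))"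

abbreviation coord_normal :: "real measure" where
  "coord_normal \<equiv> density lborel (\<lambda>t. ennreal (coord_density t))"

interpretation coord_normal: prob_space coord_normal
  by (rule prob_space_normal_density) simp

lemma coord_density_eq: "coord_density t = 1 / sqrt pi * exp (- 1 * t\<^sup>2)"
  by (simp add: normal_density_def)

lemma coord_density_deriv: "(coord_density has_real_derivative (- (2 * x) * coord_density x)) (at x)"
proof -
  have "((\<lambda>x::real. exp (- 1 * x\<^sup>2)) has_real_derivative (exp (- 1 * x\<^sup>2) * (- (2 * x)))) (at x)"
    by (auto intro!: derivative_eq_intros)
  from DERIV_cmult[OF this, of "1 / sqrt pi"] have
    "((\<lambda>x. 1 / sqrt pi * exp (- 1 * x\<^sup>2)) has_real_derivative (- (2 * x) * (1 / sqrt pi * exp (- 1 * x\<^sup>2)))) (at x)"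
    by (simp add: mult_ac)
  moreover have "coord_density = (\<lambda>x. 1 / sqrt pi * exp (- 1 * x\<^sup>2))"
    by (rule ext) (rule coord_density_eq)
  ultimately show ?thesis by (simp only:)
qed

lemma coord_normal_powers: "integrable coord_normal (\<lambda>t. t ^ k)"
proof -
  have "integrable lborel (\<lambda>t. coord_density t * (t - 0) ^ k)" by (rule integrable_normal_moment) simp
  then show ?thesis by (subst integrable_density) (simp_all add: normal_density_nonneg)
qed

lemma growth_of_bounded_derivative:
  fixes F :: "real \<Rightarrow> real"
  assumes F: "\<And>t. (F has_real_derivative F' t) (at t)" and B: "\<And>t. \<bar>F' t\<bar> \<le> B"
  shows "\<bar>F t\<bar> \<le> \<bar>F 0\<bar> + B * \<bar>t\<bar>"
proof -
  have "norm (F t - F 0) \<le> B * norm (t - 0)"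
    by (rule field_differentiable_bound[where S = UNIV and f' = F']) (simp_all add: F B)
  then have "\<bar>F t - F 0\<bar> \<le> B * \<bar>t\<bar>" by simp
  then show ?thesis by linarith
qed

lemma quartic_bounds:
  fixes t :: real
  shows "t\<^sup>2 \<le> 1 + t ^ 4" "1 + t\<^sup>2 \<le> 2 * (1 + t ^ 4)" "(1 + t\<^sup>2)\<^sup>2 \<le> 2 * (1 + t ^ 4)" "0 \<le> t ^ 4"
proof -
  have "0 \<le> (t\<^sup>2 - 1)\<^sup>2" by simp
  moreover have "(t\<^sup>2 - 1)\<^sup>2 = t ^ 4 - 2 * t\<^sup>2 + 1" "(1 + t\<^sup>2)\<^sup>2 = t ^ 4 + 2 * t\<^sup>2 + 1"
    by (simp_all add: power2_eq_square eval_nat_numeral algebra_simps)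
  moreover have "w \<le> 1 + v" "1 + w \<le> 2 * (1 + v)" "v + 2 * w + 1 \<le> 2 * (1 + v)"
    if "0 \<le> v - 2 * w + 1" "0 \<le> w" "0 \<le> v" for v w :: real using that by simp_all
  moreover show "0 \<le> t ^ 4" by simp
  ultimately show "t\<^sup>2 \<le> 1 + t ^ 4" "1 + t\<^sup>2 \<le> 2 * (1 + t ^ 4)" "(1 + t\<^sup>2)\<^sup>2 \<le> 2 * (1 + t ^ 4)"
    by (metis zero_le_power2)+
qed

lemma coord_normal_ibp:
  assumes g: "\<And>t. (g has_real_derivative g' t) (at t)" and cont: "continuous_on UNIV g'"
    and bound: "\<And>t. \<bar>g' t\<bar> \<le> C * (1 + t ^ 4)" "\<And>t. \<bar>t * g t\<bar> \<le> C * (1 + t ^ 4)" "\<And>t. \<bar>g t\<bar> \<le> C * (1 + t ^ 4)"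
  shows "(\<integral>t. g' t - 2 * (t * g t) \<partial>coord_normal) = 0"
proof -
  let ?f = coord_density
  define u where "u t = ?f t * (g' t - 2 * (t * g t))" for t
  have contg: "continuous_on UNIV g"
    unfolding continuous_on_eq_continuous_at[OF open_UNIV] using DERIV_isCont[OF g] by simp
  have contf: "continuous_on UNIV ?f"
    unfolding continuous_on_eq_continuous_at[OF open_UNIV] using DERIV_isCont[OF coord_density_deriv] by simp
  have contu: "continuous_on UNIV u" unfolding u_def by (intro continuous_intros cont contg contf)
  have [measurable]: "g \<in> borel_measurable borel" "g' \<in> borel_measurable borel"
    by (rule borel_measurable_continuous_onI[OF contg], rule borel_measurable_continuous_onI[OF cont])
  have "integrable coord_normal (\<lambda>t. g' t - 2 * (t * g t))"
  proof (rule Bochner_Integration.integrable_bound)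
    show "integrable coord_normal (\<lambda>t. 3 * C * (1 + t ^ 4))" using coord_normal_powers[of 4] by simp
    show "AE t in coord_normal. norm (g' t - 2 * (t * g t)) \<le> norm (3 * C * (1 + t ^ 4))"
    proof (rule AE_I2)
      fix t
      have "\<bar>g' t - 2 * (t * g t)\<bar> \<le> 3 * C * (1 + t ^ 4)" using bound(1)[of t] bound(2)[of t] by (simp only: mult.assoc)
      then show "norm (g' t - 2 * (t * g t)) \<le> norm (3 * C * (1 + t ^ 4))" by simp
    qed
  qed simp
  then have intu: "integrable lborel u"
    by (subst (asm) integrable_density) (simp_all add: u_def[abs_def] normal_density_nonneg)
  obtain G where G: "\<And>x. (G has_real_derivative u x) (at x)" "(G \<longlongrightarrow> 0) at_bot" "(G \<longlongrightarrow> (\<integral>t. u t \<partial>lborel)) at_top"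
    using antiderivative_line[OF contu intu] by blast
  define K where "K t = g t * ?f t" for t
  have K: "(K has_real_derivative u x) (at x)" for x
  proof -
    have "(K has_real_derivative (g' x * ?f x + - (2 * x) * ?f x * g x)) (at x)"
      unfolding K_def[abs_def] by (rule DERIV_mult[OF g coord_density_deriv])
    moreover have "g' x * ?f x + - (2 * x) * ?f x * g x = u x" by (simp add: u_def algebra_simps)
    ultimately show ?thesis by simp
  qed
  define k where "k = K 0 - G 0"
  have const: "K x - G x = k" for x
    unfolding k_def
  proof (rule DERIV_isconst_all[where f = "\<lambda>x. K x - G x"], rule allI)
    fix x show "((\<lambda>x. K x - G x) has_real_derivative 0) (at x)" using DERIV_diff[OF K G(1), of x] by simp
  qed
  define b where "b t = C / sqrt pi * ((t\<^sup>2) ^ 0 * exp (- 1 * t\<^sup>2) + (t\<^sup>2) ^ 2 * exp (- 1 * t\<^sup>2))" for t :: real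
  have b: "(b \<longlongrightarrow> 0) at_top"
    unfolding b_def[abs_def] using tendsto_mult_left[OF tendsto_add[OF gaussian_tail_tendsto_0[of 1 0] gaussian_tail_tendsto_0[of 1 2]], of "C / sqrt pi"] by simp
  have "b (- t) = b t" for t by (simp add: b_def)
  then have b': "(b \<longlongrightarrow> 0) at_bot" using b by (simp add: filterlim_at_bot_mirror)
  have Kb: "norm (K t) \<le> b t" for t
  proof -
    have "\<bar>g t\<bar> * ?f t \<le> C * (1 + t ^ 4) * ?f t" using bound(3)[of t] by (intro mult_right_mono) (simp_all add: normal_density_nonneg)
    also have "\<dots> = b t" unfolding coord_density_eq b_def by (simp add: algebra_simps add_divide_distrib power_mult[symmetric])
    finally show ?thesis by (simp add: K_def abs_mult normal_density_nonneg)
  qed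
  have K0: "(K \<longlongrightarrow> 0) at_top" by (rule Lim_null_comparison[OF always_eventually b]) (use Kb in blast)
  have K0': "(K \<longlongrightarrow> 0) at_bot" by (rule Lim_null_comparison[OF always_eventually b']) (use Kb in blast)
  have "((\<lambda>x. K x - G x) \<longlongrightarrow> 0 - 0) at_bot" by (intro tendsto_diff K0' G(2))
  then have "k = 0" unfolding const by (simp add: tendsto_const_iff)
  then have "G = K" using const by (simp add: fun_eq_iff)
  then have "(\<integral>t. u t \<partial>lborel) = 0" using tendsto_unique[OF trivial_limit_at_top_linorder G(3), of 0] K0 by simp
  then show ?thesis
    by (subst integral_density) (simp_all add: u_def normal_density_nonneg)
qed

lemma coord_normal_pair_integrable:
  fixes f :: "real \<times> real \<Rightarrow> real"
  assumes [measurable]: "f \<in> borel_measurable (borel \<Otimes>\<^sub>M borel)"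
    and bound: "\<And>b c. \<bar>f (b, c)\<bar> \<le> C * ((1 + b ^ 4) * (1 + c ^ 4))"
  shows "integrable (coord_normal \<Otimes>\<^sub>M coord_normal) f"
proof (rule Bochner_Integration.integrable_bound)
  have i: "integrable coord_normal (\<lambda>t. 1 + t ^ 4)" using coord_normal_powers[of 4] by simp
  show "integrable (coord_normal \<Otimes>\<^sub>M coord_normal) (\<lambda>z. C * ((1 + (fst z) ^ 4) * (1 + (snd z) ^ 4)))"
    using integral_pair_product(1)[OF coord_normal.prob_space_axioms coord_normal.prob_space_axioms i i] by simp
  show "AE z in coord_normal \<Otimes>\<^sub>M coord_normal. norm (f z) \<le> norm (C * ((1 + (fst z) ^ 4) * (1 + (snd z) ^ 4)))"
  proof (rule AE_I2)
    fix z
    show "norm (f z) \<le> norm (C * ((1 + (fst z) ^ 4) * (1 + (snd z) ^ 4)))"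
      using bound[of "fst z" "snd z"] by simp
  qed
qed simp

text \<open>The Stein operator of the exponential law, which is the law of the energy \<open>w\<close> of one coefficient;
  \<open>y\<close> is the energy of the other ones.\<close>

definition gamma_generator :: "(real \<Rightarrow> real) \<Rightarrow> (real \<Rightarrow> real) \<Rightarrow> real \<Rightarrow> real \<Rightarrow> real" where
  "gamma_generator F F' w y = (w - 1) * F (w + y) - w * F' (w + y)"

text \<open>Gaussian integration by parts in one coordinate of the coefficient accounts for half of the
  operator, the term \<open>p\<close> below, and the other coordinate for the other half.\<close>

lemma coord_normal_gamma_generator:
  assumes F: "\<And>t. (F has_real_derivative F' t) (at t)" and cont: "continuous_on UNIV F'"
    and B: "\<And>t. \<bar>F' t\<bar> \<le> B"
  shows "(\<integral>z. gamma_generator F F' ((fst z)\<^sup>2 + (snd z)\<^sup>2) y \<partial>(coord_normal \<Otimes>\<^sub>M coord_normal)) = 0"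
proof -
  interpret P: pair_prob_space coord_normal coord_normal ..
  have B0: "0 \<le> B" using B[of 0] by linarith
  have contF: "continuous_on UNIV F"
    unfolding continuous_on_eq_continuous_at[OF open_UNIV] using DERIV_isCont[OF F] by simp
  have [measurable]: "F \<in> borel_measurable borel" "F' \<in> borel_measurable borel"
    by (rule borel_measurable_continuous_onI[OF contF], rule borel_measurable_continuous_onI[OF cont])
  define p where "p b c = b\<^sup>2 * F (b\<^sup>2 + c\<^sup>2 + y) - F (b\<^sup>2 + c\<^sup>2 + y) / 2 - b\<^sup>2 * F' (b\<^sup>2 + c\<^sup>2 + y)" for b c
  define K where "K = \<bar>F 0\<bar> + B * (1 + \<bar>y\<bar>)"
  have K0: "0 \<le> K" using B0 by (simp add: K_def)
  have FK: "\<bar>F (b\<^sup>2 + c\<^sup>2 + y)\<bar> \<le> K * ((1 + b\<^sup>2) * (1 + c\<^sup>2))" for b c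
  proof -
    have ge: "1 \<le> (1 + b\<^sup>2) * (1 + c\<^sup>2)" "b\<^sup>2 + c\<^sup>2 + 1 \<le> (1 + b\<^sup>2) * (1 + c\<^sup>2)" by (simp_all add: distrib_left distrib_right)
    have "\<bar>F (b\<^sup>2 + c\<^sup>2 + y)\<bar> \<le> \<bar>F 0\<bar> + B * \<bar>b\<^sup>2 + c\<^sup>2 + y\<bar>" by (rule growth_of_bounded_derivative[OF F B])
    also have "\<dots> \<le> \<bar>F 0\<bar> * ((1 + b\<^sup>2) * (1 + c\<^sup>2)) + B * ((1 + \<bar>y\<bar>) * ((1 + b\<^sup>2) * (1 + c\<^sup>2)))"
    proof (intro add_mono mult_left_mono B0)
      show "\<bar>F 0\<bar> \<le> \<bar>F 0\<bar> * ((1 + b\<^sup>2) * (1 + c\<^sup>2))" using mult_left_mono[OF ge(1), of "\<bar>F 0\<bar>"] by simp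
      have "\<bar>b\<^sup>2 + c\<^sup>2 + y\<bar> \<le> (b\<^sup>2 + c\<^sup>2 + 1) * 1 + \<bar>y\<bar> * 1"
        using abs_triangle_ineq[of "b\<^sup>2 + c\<^sup>2" y] by simp
      also have "\<dots> \<le> 1 * ((1 + b\<^sup>2) * (1 + c\<^sup>2)) + \<bar>y\<bar> * ((1 + b\<^sup>2) * (1 + c\<^sup>2))"
        using ge by (intro add_mono mult_left_mono) simp_all
      finally show "\<bar>b\<^sup>2 + c\<^sup>2 + y\<bar> \<le> (1 + \<bar>y\<bar>) * ((1 + b\<^sup>2) * (1 + c\<^sup>2))" by (simp add: distrib_right)
    qed
    also have "\<dots> = K * ((1 + b\<^sup>2) * (1 + c\<^sup>2))" by (simp add: K_def algebra_simps)
    finally show ?thesis .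
  qed
  have inner: "(\<integral>b. p b c \<partial>coord_normal) = 0" for c
  proof -
    define d where "d = c\<^sup>2 + y"
    define L where "L = K * (1 + c\<^sup>2)"
    have L0: "0 \<le> L" using K0 by (simp add: L_def)
    have FL: "\<bar>F (b\<^sup>2 + d)\<bar> \<le> L * (1 + b\<^sup>2)" for b
      using FK[of b c] by (simp add: d_def L_def add.assoc mult_ac)
    define g where "g b = b * F (b\<^sup>2 + d)" for b
    define g' where "g' b = F (b\<^sup>2 + d) + 2 * (b\<^sup>2 * F' (b\<^sup>2 + d))" for b
    have "(\<integral>b. g' b - 2 * (b * g b) \<partial>coord_normal) = 0"
    proof (rule coord_normal_ibp[where C = "2 * L + 2 * B"])
      fix b
      have "((\<lambda>b. F (b\<^sup>2 + d)) has_real_derivative F' (b\<^sup>2 + d) * (2 * b)) (at b)"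
        by (rule DERIV_chain2[OF F]) (auto intro!: derivative_eq_intros)
      from DERIV_mult[OF DERIV_ident this]
      show "(g has_real_derivative g' b) (at b)"
        unfolding g_def[abs_def] g'_def by (simp add: power2_eq_square mult_ac)
      have F4: "L * (1 + b\<^sup>2) \<le> L * (2 * (1 + b ^ 4))" using quartic_bounds(2)[of b] L0 by (intro mult_left_mono) auto
      have bF: "\<bar>2 * (b\<^sup>2 * F' (b\<^sup>2 + d))\<bar> \<le> 2 * (B * (1 + b ^ 4))"
      proof -
        have "b\<^sup>2 * \<bar>F' (b\<^sup>2 + d)\<bar> \<le> (1 + b ^ 4) * B" using quartic_bounds(1)[of b] B[of "b\<^sup>2 + d"] quartic_bounds(4)[of b] by (intro mult_mono) auto
        then show ?thesis by (simp add: abs_mult mult.commute)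
      qed
      show "\<bar>g' b\<bar> \<le> (2 * L + 2 * B) * (1 + b ^ 4)"
      proof -
        have "\<bar>g' b\<bar> \<le> \<bar>F (b\<^sup>2 + d)\<bar> + \<bar>2 * (b\<^sup>2 * F' (b\<^sup>2 + d))\<bar>" unfolding g'_def by (rule abs_triangle_ineq)
        also have "\<dots> \<le> L * (2 * (1 + b ^ 4)) + 2 * (B * (1 + b ^ 4))" using FL[of b] F4 bF by linarith
        finally show ?thesis by (simp add: algebra_simps)
      qed
      have tail: "L * (2 * (1 + b ^ 4)) \<le> (2 * L + 2 * B) * (1 + b ^ 4)"
        using B0 quartic_bounds(4)[of b] by (simp add: algebra_simps)
      show "\<bar>b * g b\<bar> \<le> (2 * L + 2 * B) * (1 + b ^ 4)"
      proof -
        have "\<bar>b * g b\<bar> = b\<^sup>2 * \<bar>F (b\<^sup>2 + d)\<bar>" by (simp add: g_def power2_eq_square abs_mult)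
        also have "\<dots> \<le> (1 + b\<^sup>2) * (L * (1 + b\<^sup>2))" using FL[of b] by (intro mult_mono) auto
        also have "\<dots> = L * (1 + b\<^sup>2)\<^sup>2" by (simp add: power2_eq_square)
        also have "\<dots> \<le> L * (2 * (1 + b ^ 4))" using quartic_bounds(3)[of b] L0 by (intro mult_left_mono) auto
        finally show ?thesis using tail by linarith
      qed
      show "\<bar>g b\<bar> \<le> (2 * L + 2 * B) * (1 + b ^ 4)"
      proof -
        have "\<bar>b\<bar> \<le> 1 + b\<^sup>2" using zero_le_power2[of "\<bar>b\<bar> - 1"] zero_le_power2[of b] by (simp add: power2_diff)
        then have "\<bar>g b\<bar> \<le> (1 + b\<^sup>2) * (L * (1 + b\<^sup>2))" unfolding g_def abs_mult using FL[of b] by (intro mult_mono) auto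
        also have "\<dots> = L * (1 + b\<^sup>2)\<^sup>2" by (simp add: power2_eq_square)
        also have "\<dots> \<le> L * (2 * (1 + b ^ 4))" using quartic_bounds(3)[of b] L0 by (intro mult_left_mono) auto
        finally show ?thesis using tail by linarith
      qed
    next
      show "continuous_on UNIV g'" unfolding g'_def
        by (intro continuous_intros continuous_on_compose2[OF contF] continuous_on_compose2[OF cont]) auto
    qed
    moreover have "g' b - 2 * (b * g b) = - 2 * p b c" for b
      unfolding g'_def g_def p_def d_def by (simp add: power2_eq_square algebra_simps)
    ultimately show ?thesis by simp
  qed
  have pb: "\<bar>p b c\<bar> \<le> (4 * K + B) * ((1 + b ^ 4) * (1 + c ^ 4))" for b c
  proof -
    have "\<bar>p b c\<bar> = \<bar>(b\<^sup>2 - 1/2) * F (b\<^sup>2 + c\<^sup>2 + y) - b\<^sup>2 * F' (b\<^sup>2 + c\<^sup>2 + y)\<bar>" by (simp add: p_def algebra_simps)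
    also have "\<dots> \<le> \<bar>b\<^sup>2 - 1/2\<bar> * \<bar>F (b\<^sup>2 + c\<^sup>2 + y)\<bar> + b\<^sup>2 * \<bar>F' (b\<^sup>2 + c\<^sup>2 + y)\<bar>"
      by (rule order.trans[OF abs_triangle_ineq4]) (simp add: abs_mult)
    also have "\<dots> \<le> (1 + b\<^sup>2) * (K * ((1 + b\<^sup>2) * (1 + c\<^sup>2))) + (1 + b ^ 4) * B"
      using quartic_bounds(1)[of b] FK[of b c] B K0 quartic_bounds(4)[of b] zero_le_power2[of b]
      by (intro add_mono mult_mono) (auto simp: abs_le_iff)
    also have "(1 + b\<^sup>2) * (K * ((1 + b\<^sup>2) * (1 + c\<^sup>2))) = K * ((1 + b\<^sup>2)\<^sup>2 * (1 + c\<^sup>2))" by (simp add: power2_eq_square)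
    also have "\<dots> \<le> K * ((2 * (1 + b ^ 4)) * (2 * (1 + c ^ 4)))"
      using quartic_bounds(4)[of b] by (intro mult_left_mono[OF mult_mono[OF quartic_bounds(3) quartic_bounds(2)] K0]) auto
    also have "(1 + b ^ 4) * B \<le> B * ((1 + b ^ 4) * (1 + c ^ 4))"
      using B0 quartic_bounds(4)[of b] quartic_bounds(4)[of c] by (simp add: algebra_simps)
    finally show ?thesis by (simp add: algebra_simps)
  qed
  have mp: "(\<lambda>z. p (fst z) (snd z)) \<in> borel_measurable (borel \<Otimes>\<^sub>M borel)" "(\<lambda>z. p (snd z) (fst z)) \<in> borel_measurable (borel \<Otimes>\<^sub>M borel)"
    unfolding p_def by measurable
  have i1: "integrable (coord_normal \<Otimes>\<^sub>M coord_normal) (\<lambda>z. p (fst z) (snd z))"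
    by (rule coord_normal_pair_integrable[OF mp(1)]) (use pb in simp)
  have i2: "integrable (coord_normal \<Otimes>\<^sub>M coord_normal) (\<lambda>z. p (snd z) (fst z))"
  proof (rule coord_normal_pair_integrable[OF mp(2)])
    fix b c show "\<bar>p (snd (b, c)) (fst (b, c))\<bar> \<le> (4 * K + B) * ((1 + b ^ 4) * (1 + c ^ 4))"
      using pb[of c b] by (simp add: mult.commute)
  qed
  have e1: "(\<integral>z. p (fst z) (snd z) \<partial>(coord_normal \<Otimes>\<^sub>M coord_normal)) = 0"
    using P.integral_snd[of "\<lambda>b c. p b c"] i1 inner by (simp add: split_def)
  have e2: "(\<integral>z. p (snd z) (fst z) \<partial>(coord_normal \<Otimes>\<^sub>M coord_normal)) = 0"
    using P.integral_fst'[OF i2] inner by simp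
  have "gamma_generator F F' (b\<^sup>2 + c\<^sup>2) y = p b c + p c b" for b c
    unfolding gamma_generator_def p_def by (simp add: algebra_simps)
  then show ?thesis using i1 i2 e1 e2 by simp
qed

context arithmetic_wave
begin

abbreviation coeff_energy :: "int \<times> int \<Rightarrow> 'w \<Rightarrow> real" where
  "coeff_energy l \<omega> \<equiv> (norm (a l \<omega>))\<^sup>2"

lemma coefficient_law:
  assumes "l \<in> Freq n"
  shows "distr M (borel \<Otimes>\<^sub>M borel) (\<lambda>\<omega>. (Re (a l \<omega>), Im (a l \<omega>))) = coord_normal \<Otimes>\<^sub>M coord_normal"
proof -
  note g = coefficient_gaussian[OF assms, unfolded std_complex_gaussian_def]
  have re: "distr M borel (\<lambda>\<omega>. Re (a l \<omega>)) = coord_normal"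
    using g unfolding distributed_def by (metis distr_cong sets_lborel)
  have im: "distr M borel (\<lambda>\<omega>. Im (a l \<omega>)) = coord_normal"
    using g unfolding distributed_def by (metis distr_cong sets_lborel)
  show ?thesis using g unfolding indep_var_distribution_eq re im by simp
qed

lemma coeff_energy_integral:
  fixes f :: "real \<Rightarrow> real"
  assumes l: "l \<in> Freq n" and [measurable]: "f \<in> borel_measurable borel"
  shows "(\<integral>\<omega>. f (coeff_energy l \<omega>) \<partial>M) = (\<integral>z. f ((fst z)\<^sup>2 + (snd z)\<^sup>2) \<partial>(coord_normal \<Otimes>\<^sub>M coord_normal))"
    and "integrable (coord_normal \<Otimes>\<^sub>M coord_normal) (\<lambda>z. f ((fst z)\<^sup>2 + (snd z)\<^sup>2)) \<Longrightarrow> integrable M (\<lambda>\<omega>. f (coeff_energy l \<omega>))"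
proof -
  have [measurable]: "a l \<in> borel_measurable M" by (rule coefficient_measurable[OF l])
  have eq: "f (coeff_energy l \<omega>) = (\<lambda>z. f ((fst z)\<^sup>2 + (snd z)\<^sup>2)) (Re (a l \<omega>), Im (a l \<omega>))" for \<omega>
    by (simp add: cmod_power2)
  show "(\<integral>\<omega>. f (coeff_energy l \<omega>) \<partial>M) = (\<integral>z. f ((fst z)\<^sup>2 + (snd z)\<^sup>2) \<partial>(coord_normal \<Otimes>\<^sub>M coord_normal))"
    unfolding coefficient_law[OF l, symmetric] eq by (rule integral_distr[symmetric]) measurable
  show "integrable M (\<lambda>\<omega>. f (coeff_energy l \<omega>))" if "integrable (coord_normal \<Otimes>\<^sub>M coord_normal) (\<lambda>z. f ((fst z)\<^sup>2 + (snd z)\<^sup>2))"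
    using that unfolding coefficient_law[OF l, symmetric] eq by (subst (asm) integrable_distr_eq) auto
qed

lemma coeff_energy_square_integrable:
  assumes l: "l \<in> Freq n"
  shows "integrable M (\<lambda>\<omega>. K * (1 + \<bar>coeff_energy l \<omega>\<bar>)\<^sup>2)"
proof (rule coeff_energy_integral(2)[OF l, where f = "\<lambda>w. K * (1 + \<bar>w\<bar>)\<^sup>2"])
  show "integrable (coord_normal \<Otimes>\<^sub>M coord_normal) (\<lambda>z. K * (1 + \<bar>(fst z)\<^sup>2 + (snd z)\<^sup>2\<bar>)\<^sup>2)"
  proof (rule coord_normal_pair_integrable[where C = "\<bar>K\<bar> * 4"])
    fix b c :: real
    have "1 + (b\<^sup>2 + c\<^sup>2) \<le> (1 + b\<^sup>2) * (1 + c\<^sup>2)" by (simp add: distrib_left distrib_right)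
    then have "(1 + (b\<^sup>2 + c\<^sup>2))\<^sup>2 \<le> ((1 + b\<^sup>2) * (1 + c\<^sup>2))\<^sup>2" by (intro power_mono) auto
    also have "\<dots> = (1 + b\<^sup>2)\<^sup>2 * (1 + c\<^sup>2)\<^sup>2" by (rule power_mult_distrib)
    also have "\<dots> \<le> (2 * (1 + b ^ 4)) * (2 * (1 + c ^ 4))" by (intro mult_mono quartic_bounds(3)) auto
    also have "\<dots> = 4 * ((1 + b ^ 4) * (1 + c ^ 4))" by (simp add: algebra_simps)
    finally have "\<bar>K\<bar> * (1 + (b\<^sup>2 + c\<^sup>2))\<^sup>2 \<le> \<bar>K\<bar> * (4 * ((1 + b ^ 4) * (1 + c ^ 4)))" by (intro mult_left_mono) auto
    then show "\<bar>K * (1 + \<bar>(fst (b, c))\<^sup>2 + (snd (b, c))\<^sup>2\<bar>)\<^sup>2\<bar> \<le> \<bar>K\<bar> * 4 * ((1 + b ^ 4) * (1 + c ^ 4))"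
      by (simp add: abs_mult)
  qed measurable
qed measurable

lemma coeff_energy_integrable:
  assumes l: "l \<in> Freq n" shows "integrable M (coeff_energy l)"
proof (rule Bochner_Integration.integrable_bound[OF coeff_energy_square_integrable[OF l, of 1]])
  have [measurable]: "a l \<in> borel_measurable M" by (rule coefficient_measurable[OF l])
  show "coeff_energy l \<in> borel_measurable M" by measurable
  show "AE \<omega> in M. norm (coeff_energy l \<omega>) \<le> norm (1 * (1 + \<bar>coeff_energy l \<omega>\<bar>)\<^sup>2)"
  proof (rule AE_I2)
    fix \<omega>
    have "w \<le> (1 + w)\<^sup>2" if "0 \<le> w" for w :: real using that by (simp add: power2_eq_square algebra_simps)
    from this[of "coeff_energy l \<omega>"] show "norm (coeff_energy l \<omega>) \<le> norm (1 * (1 + \<bar>coeff_energy l \<omega>\<bar>)\<^sup>2)" by simp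
  qed
qed

lemma energy_integrable: "integrable M energy"
  unfolding energy_def[abs_def] by (intro Bochner_Integration.integrable_sum coeff_energy_integrable) (simp add: half_def)

lemma coeff_gamma_generator:
  assumes l: "l \<in> half"
    and F: "\<And>t. (F has_real_derivative F' t) (at t)" and cont: "continuous_on UNIV F'" and B: "\<And>t. \<bar>F' t\<bar> \<le> B"
  shows "integrable M (\<lambda>\<omega>. gamma_generator F F' (coeff_energy l \<omega>) (energy \<omega> - coeff_energy l \<omega>))"
    and "(\<integral>\<omega>. gamma_generator F F' (coeff_energy l \<omega>) (energy \<omega> - coeff_energy l \<omega>) \<partial>M) = 0"
proof -
  have lF: "l \<in> Freq n" using l by (simp add: half_def)
  define Y where "Y \<omega> = (\<Sum>k\<in>half - {l}. coeff_energy k \<omega>)" for \<omega>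
  have Y: "energy \<omega> - coeff_energy l \<omega> = Y \<omega>" for \<omega>
    unfolding energy_def Y_def using l by (subst sum.remove[of half l]) auto
  have B0: "0 \<le> B" using B[of 0] by linarith
  have contF: "continuous_on UNIV F"
    unfolding continuous_on_eq_continuous_at[OF open_UNIV] using DERIV_isCont[OF F] by simp
  have mF[measurable]: "F \<in> borel_measurable borel" "F' \<in> borel_measurable borel"
    by (rule borel_measurable_continuous_onI[OF contF], rule borel_measurable_continuous_onI[OF cont])
  have Yf: "Y = (\<lambda>\<omega>. energy \<omega> - coeff_energy l \<omega>)" by (rule ext) (rule Y[symmetric])
  have mW[measurable]: "coeff_energy l \<in> borel_measurable M"
    by (rule borel_measurable_integrable[OF coeff_energy_integrable[OF lF]])
  have mY[measurable]: "Y \<in> borel_measurable M" unfolding Yf using mW by measurable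
  have iY: "integrable M Y" unfolding Yf by (rule Bochner_Integration.integrable_diff[OF energy_integrable coeff_energy_integrable[OF lF]])
  have "indep_vars (\<lambda>_. borel) coeff_energy half"
    by (rule indep_vars_compose2[OF half_indep, where Y = "\<lambda>l z. (norm z)\<^sup>2"]) measurable
  then have "indep_var borel (coeff_energy l) borel Y"
    unfolding Y_def[abs_def] using l by (intro indep_vars_sum) (auto simp: insert_absorb)
  then have law: "distr M borel (coeff_energy l) \<Otimes>\<^sub>M distr M borel Y = distr M (borel \<Otimes>\<^sub>M borel) (\<lambda>\<omega>. (coeff_energy l \<omega>, Y \<omega>))"
    unfolding indep_var_distribution_eq by simp
  let ?W = "distr M borel (coeff_energy l)" and ?Y = "distr M borel Y"
  interpret W: prob_space ?W by (rule prob_space_distr) simp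
  interpret Y: prob_space ?Y by (rule prob_space_distr) simp
  interpret P: pair_prob_space ?W ?Y ..
  define q where "q w y = gamma_generator F F' w y" for w y
  have mq[measurable]: "case_prod q \<in> borel_measurable (borel \<Otimes>\<^sub>M borel)"
    unfolding q_def gamma_generator_def split_def by measurable
  have mq2: "(\<lambda>w. q w y) \<in> borel_measurable borel" for y unfolding q_def gamma_generator_def by measurable
  define K where "K = \<bar>F 0\<bar> + 2 * B"
  have qb: "\<bar>q w y\<bar> \<le> (K * (1 + \<bar>w\<bar>)\<^sup>2) * (1 + \<bar>y\<bar>)" for w y
  proof -
    have pr: "(1 + \<bar>w\<bar>) * (1 + \<bar>y\<bar>) = 1 + \<bar>w\<bar> + \<bar>y\<bar> + \<bar>w\<bar> * \<bar>y\<bar>" "0 \<le> \<bar>w\<bar> * \<bar>y\<bar>"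
      by (simp_all add: distrib_left distrib_right)
    have ge: "1 \<le> (1 + \<bar>w\<bar>) * (1 + \<bar>y\<bar>)" unfolding pr(1) using pr(2) by linarith
    have ge2: "\<bar>w + y\<bar> \<le> (1 + \<bar>w\<bar>) * (1 + \<bar>y\<bar>)" unfolding pr(1) using pr(2) abs_triangle_ineq[of w y] by linarith
    have "\<bar>F (w + y)\<bar> \<le> \<bar>F 0\<bar> * 1 + B * \<bar>w + y\<bar>" using growth_of_bounded_derivative[OF F B] by simp
    also have "\<dots> \<le> \<bar>F 0\<bar> * ((1 + \<bar>w\<bar>) * (1 + \<bar>y\<bar>)) + B * ((1 + \<bar>w\<bar>) * (1 + \<bar>y\<bar>))"
      by (intro add_mono mult_left_mono ge ge2 B0) auto
    finally have Fb: "\<bar>F (w + y)\<bar> \<le> (\<bar>F 0\<bar> + B) * ((1 + \<bar>w\<bar>) * (1 + \<bar>y\<bar>))" by (simp add: distrib_right)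
    have "\<bar>q w y\<bar> \<le> \<bar>w - 1\<bar> * \<bar>F (w + y)\<bar> + \<bar>w\<bar> * \<bar>F' (w + y)\<bar>"
      unfolding q_def gamma_generator_def by (rule order.trans[OF abs_triangle_ineq4]) (simp add: abs_mult)
    also have "\<dots> \<le> (1 + \<bar>w\<bar>) * ((\<bar>F 0\<bar> + B) * ((1 + \<bar>w\<bar>) * (1 + \<bar>y\<bar>))) + ((1 + \<bar>w\<bar>) * ((1 + \<bar>w\<bar>) * (1 + \<bar>y\<bar>))) * B"
    proof (intro add_mono mult_mono Fb B)
      show "\<bar>w - 1\<bar> \<le> 1 + \<bar>w\<bar>" by linarith
      have "(1 + \<bar>w\<bar>) * 1 \<le> (1 + \<bar>w\<bar>) * ((1 + \<bar>w\<bar>) * (1 + \<bar>y\<bar>))" using ge by (intro mult_left_mono) auto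
      then show "\<bar>w\<bar> \<le> (1 + \<bar>w\<bar>) * ((1 + \<bar>w\<bar>) * (1 + \<bar>y\<bar>))" by simp
    qed (auto intro!: mult_nonneg_nonneg)
    also have "\<dots> = (K * (1 + \<bar>w\<bar>)\<^sup>2) * (1 + \<bar>y\<bar>)"
    proof -
      have "(1 + u) * ((A + B) * ((1 + u) * v)) + ((1 + u) * ((1 + u) * v)) * B = ((A + 2 * B) * (1 + u)\<^sup>2) * v" for u v A :: real
        by (simp add: power2_eq_square algebra_simps)
      then show ?thesis unfolding K_def .
    qed
    finally show ?thesis .
  qed
  have int: "integrable (?W \<Otimes>\<^sub>M ?Y) (case_prod q)"
  proof (rule Bochner_Integration.integrable_bound)
    have 1: "integrable ?W (\<lambda>w. K * (1 + \<bar>w\<bar>)\<^sup>2)"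
      using coeff_energy_square_integrable[OF lF, of K] by (subst integrable_distr_eq) auto
    have 2: "integrable ?Y (\<lambda>y. 1 + \<bar>y\<bar>)" using iY by (subst integrable_distr_eq) auto
    show "integrable (?W \<Otimes>\<^sub>M ?Y) (\<lambda>z. (K * (1 + \<bar>fst z\<bar>)\<^sup>2) * (1 + \<bar>snd z\<bar>))"
      by (rule integral_pair_product(1)[OF W.prob_space_axioms Y.prob_space_axioms 1 2])
    show "AE z in ?W \<Otimes>\<^sub>M ?Y. norm (case_prod q z) \<le> norm ((K * (1 + \<bar>fst z\<bar>)\<^sup>2) * (1 + \<bar>snd z\<bar>))"
    proof (rule AE_I2)
      fix z :: "real \<times> real"
      have "\<bar>case_prod q z\<bar> \<le> (K * (1 + \<bar>fst z\<bar>)\<^sup>2) * (1 + \<bar>snd z\<bar>)" using qb[of "fst z" "snd z"] by (simp add: split_def)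
      then show "norm (case_prod q z) \<le> norm ((K * (1 + \<bar>fst z\<bar>)\<^sup>2) * (1 + \<bar>snd z\<bar>))"
        unfolding real_norm_def by linarith
    qed
  qed simp
  have "integrable M (\<lambda>\<omega>. case_prod q (coeff_energy l \<omega>, Y \<omega>))"
    using int unfolding law by (subst (asm) integrable_distr_eq) auto
  then show "integrable M (\<lambda>\<omega>. gamma_generator F F' (coeff_energy l \<omega>) (energy \<omega> - coeff_energy l \<omega>))"
    unfolding Y by (simp add: q_def)
  have "(\<integral>w. q w y \<partial>?W) = 0" for y
  proof -
    have "(\<integral>w. q w y \<partial>?W) = (\<integral>\<omega>. q (coeff_energy l \<omega>) y \<partial>M)" using mq2 by (intro integral_distr) auto
    also have "\<dots> = (\<integral>z. q ((fst z)\<^sup>2 + (snd z)\<^sup>2) y \<partial>(coord_normal \<Otimes>\<^sub>M coord_normal))"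
      by (rule coeff_energy_integral(1)[OF lF mq2])
    also have "\<dots> = 0" unfolding q_def by (rule coord_normal_gamma_generator[OF F cont B])
    finally show ?thesis .
  qed
  then have "integral\<^sup>L (?W \<Otimes>\<^sub>M ?Y) (case_prod q) = 0" using P.integral_snd[OF int] by simp
  then have "(\<integral>\<omega>. case_prod q (coeff_energy l \<omega>, Y \<omega>) \<partial>M) = 0"
    unfolding law by (subst (asm) integral_distr) auto
  then show "(\<integral>\<omega>. gamma_generator F F' (coeff_energy l \<omega>) (energy \<omega> - coeff_energy l \<omega>) \<partial>M) = 0"
    unfolding Y by (simp add: q_def)
qed

text \<open>Adding up the identities of the coefficients gives the Stein identity of the Gamma law of shape
  \<open>m\<close>.\<close>

lemma energy_stein:
  assumes F: "\<And>t. (F has_real_derivative F' t) (at t)" and cont: "continuous_on UNIV F'" and B: "\<And>t. \<bar>F' t\<bar> \<le> B"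
  shows "integrable M (\<lambda>\<omega>. (energy \<omega> - m) * F (energy \<omega>) - energy \<omega> * F' (energy \<omega>))"
    and "(\<integral>\<omega>. (energy \<omega> - m) * F (energy \<omega>) - energy \<omega> * F' (energy \<omega>) \<partial>M) = 0"
proof -
  have eq: "(energy \<omega> - m) * F (energy \<omega>) - energy \<omega> * F' (energy \<omega>) =
      (\<Sum>l\<in>half. gamma_generator F F' (coeff_energy l \<omega>) (energy \<omega> - coeff_energy l \<omega>))" for \<omega>
  proof -
    have "(\<Sum>l\<in>half. gamma_generator F F' (coeff_energy l \<omega>) (energy \<omega> - coeff_energy l \<omega>)) =
      (\<Sum>l\<in>half. (coeff_energy l \<omega> - 1) * F (energy \<omega>) - coeff_energy l \<omega> * F' (energy \<omega>))"
      by (simp add: gamma_generator_def)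
    also have "\<dots> = (energy \<omega> - m) * F (energy \<omega>) - energy \<omega> * F' (energy \<omega>)"
      unfolding sum_subtractf sum_distrib_right[symmetric] by (simp add: sum_subtractf energy_def)
    finally show ?thesis by simp
  qed
  show "integrable M (\<lambda>\<omega>. (energy \<omega> - m) * F (energy \<omega>) - energy \<omega> * F' (energy \<omega>))"
    unfolding eq by (intro Bochner_Integration.integrable_sum coeff_gamma_generator(1)[OF _ F cont B])
  show "(\<integral>\<omega>. (energy \<omega> - m) * F (energy \<omega>) - energy \<omega> * F' (energy \<omega>) \<partial>M) = 0"
    unfolding eq using coeff_gamma_generator[OF _ F cont B]
    by (subst Bochner_Integration.integral_sum) auto
qed

lemma energy_mean: "(\<integral>\<omega>. energy \<omega> \<partial>M) = m"
  using energy_stein(2)[of "\<lambda>_. 1" "\<lambda>_. 0" 0] energy_integrable prob_space by simp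

lemma energy_variance: "integrable M (\<lambda>\<omega>. (energy \<omega> - m)\<^sup>2)" "(\<integral>\<omega>. (energy \<omega> - m)\<^sup>2 \<partial>M) = m"
proof -
  note s = energy_stein[of "\<lambda>t. t - m" "\<lambda>_. 1" 1]
  have i: "integrable M (\<lambda>\<omega>. (energy \<omega> - m) * (energy \<omega> - m) - energy \<omega> * 1)"
    and z: "(\<integral>\<omega>. (energy \<omega> - m) * (energy \<omega> - m) - energy \<omega> * 1 \<partial>M) = 0"
    by (rule s; auto intro!: derivative_eq_intros)+
  have "integrable M (\<lambda>\<omega>. ((energy \<omega> - m) * (energy \<omega> - m) - energy \<omega> * 1) + energy \<omega>)"
    by (rule Bochner_Integration.integrable_add[OF i energy_integrable])
  then show j: "integrable M (\<lambda>\<omega>. (energy \<omega> - m)\<^sup>2)" by (simp add: power2_eq_square)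
  then show "(\<integral>\<omega>. (energy \<omega> - m)\<^sup>2 \<partial>M) = m"
    using z energy_integrable energy_mean by (simp add: power2_eq_square)
qed

text \<open>The energy enters the Leray measure with a negative coefficient, hence the sign.\<close>

definition normalized_energy :: "'w \<Rightarrow> real" where
  "normalized_energy \<omega> = (m - energy \<omega>) / sqrt m"

text \<open>For \<open>F t = f ((m - t) / sqrt m)\<close>, with \<open>f\<close> a solution of Stein's equation, the Stein identity of the
  energy says that the difference of the means is that of \<open>(1 - energy / m) * f'\<close>; the first factor has
  variance \<open>1 / m\<close>.\<close>

lemma normalized_energy_wasserstein:
  assumes lip: "\<And>x y. \<bar>h x - h y\<bar> \<le> \<bar>x - y\<bar>"
  shows "\<bar>(\<integral>\<omega>. h (normalized_energy \<omega>) \<partial>M) - (\<integral>t. h t \<partial>std_normal_distribution)\<bar> \<le> 2 / sqrt m"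
proof -
  define \<mu> where "\<mu> = (\<integral>t. h t \<partial>std_normal_distribution)"
  obtain f f' where f: "\<And>x. (f has_real_derivative f' x) (at x)" and cont: "continuous_on UNIV f'"
    and f2: "\<And>x. \<bar>f' x\<bar> \<le> 2" and eq: "\<And>x. f' x - x * f x = h x - \<mu>"
    using stein_solution[OF lip] unfolding \<mu>_def by blast
  define s where "s = sqrt m"
  have s: "s > 0" "m = s * s" unfolding s_def using m_pos by auto
  note [measurable] = borel_measurable_lipschitz[OF lip]
  have [measurable]: "f' \<in> borel_measurable borel" by (rule borel_measurable_continuous_onI[OF cont])
  have [measurable]: "normalized_energy \<in> borel_measurable M" unfolding normalized_energy_def[abs_def] by measurable
  have iN: "integrable M normalized_energy" unfolding normalized_energy_def[abs_def] using energy_integrable by simp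
  note ih = integrable_lipschitz[OF lip iN]
  define F where "F t = f ((m - t) / sqrt m)" for t
  define F' where "F' t = - f' ((m - t) / sqrt m) / sqrt m" for t
  have dF: "(F has_real_derivative F' t) (at t)" for t
  proof -
    have "((\<lambda>t. (m - t) / s) has_real_derivative (- 1 / s)) (at t)"
      using s(1) by (auto intro!: derivative_eq_intros)
    from DERIV_chain2[OF f this] show ?thesis unfolding F_def[abs_def] F'_def s_def by simp
  qed
  have cF: "continuous_on UNIV F'"
    unfolding F'_def using m_pos by (intro continuous_intros continuous_on_compose2[OF cont]) auto
  have bF: "\<bar>F' t\<bar> \<le> 2 / sqrt m" for t
    using f2[of "(m - t) / sqrt m"] by (simp add: F'_def abs_divide divide_right_mono)
  note st = energy_stein[OF dF cF bF]
  have e1: "(energy \<omega> - m) * F (energy \<omega>) - energy \<omega> * F' (energy \<omega>) =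
      sqrt m * ((h (normalized_energy \<omega>) - \<mu>) - (1 - energy \<omega> / m) * f' (normalized_energy \<omega>))" for \<omega>
  proof -
    let ?w = "normalized_energy \<omega>"
    have F1: "F (energy \<omega>) = f ?w" "F' (energy \<omega>) = - f' ?w / s" by (simp_all add: F_def F'_def normalized_energy_def s_def)
    have w: "?w = (s * s - energy \<omega>) / s" unfolding normalized_energy_def s_def[symmetric] unfolding s(2) ..
    have "(s * s - X) / s = W \<Longrightarrow> (X - s * s) * u - X * (- v / s) = s * ((v - W * u) - (1 - X / (s * s)) * v)" for X u v W
    proof -
      assume "(s * s - X) / s = W"
      then have 1: "X - s * s = - (s * W)" using s(1) by (simp add: field_simps)
      have 2: "X * (- v / s) = - (s * (X / (s * s)) * v)" using s(1) by simp
      show ?thesis unfolding 1 2 by (simp only: left_diff_distrib right_diff_distrib mult_1) (simp add: mult_ac)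
    qed
    from this[OF w[symmetric]] show ?thesis unfolding F1 eq[symmetric] s_def[symmetric] unfolding s(2) .
  qed
  let ?d = "\<lambda>\<omega>. (1 - energy \<omega> / m) * f' (normalized_energy \<omega>)"
  have id: "integrable M ?d"
  proof (rule Bochner_Integration.integrable_bound)
    show "integrable M (\<lambda>\<omega>. 2 * (1 - energy \<omega> / m))" using energy_integrable by simp
    show "AE \<omega> in M. norm (?d \<omega>) \<le> norm (2 * (1 - energy \<omega> / m))"
    proof (rule AE_I2)
      fix \<omega> show "norm (?d \<omega>) \<le> norm (2 * (1 - energy \<omega> / m))"
        using mult_left_mono[OF f2[of "normalized_energy \<omega>"], of "\<bar>1 - energy \<omega> / m\<bar>"]
        unfolding real_norm_def abs_mult by (simp only: abs_numeral abs_ge_zero mult.commute)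
    qed
  qed measurable
  have "(\<integral>\<omega>. sqrt m * ((h (normalized_energy \<omega>) - \<mu>) - ?d \<omega>) \<partial>M) = 0"
    using st(2) unfolding e1 .
  then have "(\<integral>\<omega>. (h (normalized_energy \<omega>) - \<mu>) - ?d \<omega> \<partial>M) = 0"
    using s(1) unfolding s_def[symmetric] by simp
  then have "(\<integral>\<omega>. h (normalized_energy \<omega>) \<partial>M) - \<mu> = (\<integral>\<omega>. ?d \<omega> \<partial>M)"
    using ih id prob_space by simp
  also have "\<bar>\<dots>\<bar> \<le> (\<integral>\<omega>. \<bar>?d \<omega>\<bar> \<partial>M)" by (rule integral_abs_bound)
  also have "\<dots> \<le> (\<integral>\<omega>. (energy \<omega> - m)\<^sup>2 / (m * sqrt m) + 1 / sqrt m \<partial>M)"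
  proof (rule integral_mono)
    show "integrable M (\<lambda>\<omega>. (energy \<omega> - m)\<^sup>2 / (m * sqrt m) + 1 / sqrt m)" using energy_variance(1) by simp
    fix \<omega>
    define u where "u = \<bar>energy \<omega> - s * s\<bar> / s"
    have u: "0 \<le> u" using s(1) by (simp add: u_def)
    have "1 - X / (s * s) = - ((X - s * s) / s) / s" for X using s(1) by (simp add: field_simps)
    then have "\<bar>1 - energy \<omega> / (s * s)\<bar> = u / s" unfolding u_def using s(1) by (simp add: abs_divide)
    then have "\<bar>(1 - energy \<omega> / (s * s)) * f' (normalized_energy \<omega>)\<bar> \<le> u / s * 2"
      unfolding abs_mult using f2[of "normalized_energy \<omega>"] s(1) u by (intro mult_mono) auto
    also have "\<dots> = (u * 2) / s" by simp
    also have "\<dots> \<le> (u\<^sup>2 + 1) / s"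
    proof (rule divide_right_mono)
      show "u * 2 \<le> u\<^sup>2 + 1" using zero_le_power2[of "u - 1"] by (simp add: power2_diff)
    qed (use s(1) in simp)
    also have "\<dots> = (energy \<omega> - s * s)\<^sup>2 / (s * s * s) + 1 / s"
      using s(1) by (simp add: u_def power_divide add_divide_distrib power2_eq_square[of s])
    finally show "\<bar>?d \<omega>\<bar> \<le> (energy \<omega> - m)\<^sup>2 / (m * sqrt m) + 1 / sqrt m"
      unfolding s_def[symmetric] unfolding s(2) .
  qed (use id in simp)
  also have "\<dots> = m / (m * sqrt m) + 1 / sqrt m"
    using energy_variance prob_space by simp
  also have "\<dots> = 2 / sqrt m"
    unfolding s_def[symmetric] unfolding s(2) using s(1) by (simp add: field_simps)
  finally show "\<bar>(\<integral>\<omega>. h (normalized_energy \<omega>) \<partial>M) - (\<integral>t. h t \<partial>std_normal_distribution)\<bar> \<le> 2 / sqrt m"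
    unfolding \<mu>_def .
qed

end

section \<open>Normalisation and conclusion\<close>

lemma (in prob_space) mean_abs_le_of_second_moment:
  fixes D :: "'a \<Rightarrow> real"
  assumes D: "integrable M (\<lambda>\<omega>. (D \<omega>)\<^sup>2)" "integrable M D" and t: "0 < t" and le: "(\<integral>\<omega>. (D \<omega>)\<^sup>2 \<partial>M) \<le> t\<^sup>2"
  shows "(\<integral>\<omega>. \<bar>D \<omega>\<bar> \<partial>M) \<le> t"
proof -
  have "(\<integral>\<omega>. \<bar>D \<omega>\<bar> \<partial>M) \<le> (\<integral>\<omega>. ((D \<omega>)\<^sup>2 / t + t) / 2 \<partial>M)"
  proof (rule integral_mono)
    fix \<omega>
    have "0 \<le> (\<bar>D \<omega>\<bar> - t)\<^sup>2 / t" using t by simp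
    also have "(\<bar>D \<omega>\<bar> - t)\<^sup>2 / t = (D \<omega>)\<^sup>2 / t + t - 2 * \<bar>D \<omega>\<bar>"
      using t by (simp add: power2_diff diff_divide_distrib add_divide_distrib power2_eq_square[of t])
    finally show "\<bar>D \<omega>\<bar> \<le> ((D \<omega>)\<^sup>2 / t + t) / 2" by simp
  qed (use D in simp_all)
  also have "\<dots> = ((\<integral>\<omega>. (D \<omega>)\<^sup>2 \<partial>M) / t + t) / 2" using D prob_space by simp
  also have "\<dots> \<le> (t\<^sup>2 / t + t) / 2" using le t by (simp add: divide_right_mono)
  also have "\<dots> = t" using t by (simp add: power2_eq_square)
  finally show ?thesis .
qed

text \<open>Normalising is stable: a variable close in \<open>L\<^sup>2\<close> to a multiple of a normalised one has
  nearly the same standard deviation, by Cauchy--Schwarz. If the variance vanishes, the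
  normalised variable is \<open>0\<close> and the residual is as large as the main term.\<close>

lemma (in prob_space) normalized_near:
  fixes Z V :: "'a \<Rightarrow> real"
  assumes [measurable]: "Z \<in> borel_measurable M"
    and V: "integrable M V" "integrable M (\<lambda>\<omega>. (V \<omega>)\<^sup>2)" "(\<integral>\<omega>. V \<omega> \<partial>M) = 0" "(\<integral>\<omega>. (V \<omega>)\<^sup>2 \<partial>M) = 1"
    and \<beta>: "0 < \<beta>" and \<rho>: "0 < \<rho>"
    and close: "(\<integral>\<^sup>+\<omega>. ennreal ((Z \<omega> - c - \<beta> * V \<omega>)\<^sup>2) \<partial>M) \<le> ennreal \<rho>"
  shows "integrable M (normalized M Z)"
    and "(\<integral>\<omega>. \<bar>normalized M Z \<omega> - V \<omega>\<bar> \<partial>M) \<le> 2 * sqrt \<rho> / \<beta>"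
proof -
  note mV[measurable] = borel_measurable_integrable[OF V(1)]
  define R where "R \<omega> = Z \<omega> - c - \<beta> * V \<omega>" for \<omega>
  have mR[measurable]: "R \<in> borel_measurable M" unfolding R_def[abs_def] by measurable
  have R2: "integrable M (\<lambda>\<omega>. (R \<omega>)\<^sup>2)"
    using close order.strict_trans1[OF close ennreal_less_top]
    by (intro integrableI_nonneg) (auto simp: R_def)
  have R2le: "(\<integral>\<omega>. (R \<omega>)\<^sup>2 \<partial>M) \<le> \<rho>"
  proof -
    have "ennreal (\<integral>\<omega>. (R \<omega>)\<^sup>2 \<partial>M) = (\<integral>\<^sup>+\<omega>. ennreal ((R \<omega>)\<^sup>2) \<partial>M)"
      using R2 by (intro nn_integral_eq_integral[symmetric]) auto
    also have "\<dots> \<le> ennreal \<rho>" using close by (simp add: R_def)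
    finally show ?thesis using \<rho> by (subst (asm) ennreal_le_iff) auto
  qed
  have integrable_prod: "integrable M (\<lambda>\<omega>. f \<omega> * g \<omega>)"
    if [measurable]: "f \<in> borel_measurable M" "g \<in> borel_measurable M"
      and sq: "integrable M (\<lambda>\<omega>. (f \<omega>)\<^sup>2)" "integrable M (\<lambda>\<omega>. (g \<omega>)\<^sup>2)" for f g :: "'a \<Rightarrow> real"
  proof (rule Bochner_Integration.integrable_bound)
    show "integrable M (\<lambda>\<omega>. (f \<omega>)\<^sup>2 + (g \<omega>)\<^sup>2)" using sq by simp
    show "AE \<omega> in M. norm (f \<omega> * g \<omega>) \<le> norm ((f \<omega>)\<^sup>2 + (g \<omega>)\<^sup>2)"
    proof (rule AE_I2)
      fix \<omega>
      have "\<bar>f \<omega> * g \<omega>\<bar> \<le> ((f \<omega>)\<^sup>2 + (g \<omega>)\<^sup>2) / 2" by (rule abs_mult_le_mean_squares)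
      then show "norm (f \<omega> * g \<omega>) \<le> norm ((f \<omega>)\<^sup>2 + (g \<omega>)\<^sup>2)" by simp
    qed
  qed measurable
  have iR: "integrable M R" using integrable_prod[OF mR, of "\<lambda>_. 1"] R2 by simp
  have Zeq: "Z \<omega> = c + R \<omega> + \<beta> * V \<omega>" for \<omega> by (simp add: R_def)
  have iZ: "integrable M Z" unfolding Zeq[abs_def] using iR V(1) by simp
  define r where "r = (\<integral>\<omega>. R \<omega> \<partial>M)"
  have EZ: "(\<integral>\<omega>. Z \<omega> \<partial>M) = c + r" unfolding Zeq[abs_def] r_def using iR V(1,3) prob_space by simp
  define Y where "Y \<omega> = Z \<omega> - expectation Z" for \<omega>
  define Q where "Q \<omega> = R \<omega> - r" for \<omega>
  have Yeq: "Y \<omega> = Q \<omega> + \<beta> * V \<omega>" for \<omega> by (simp add: Y_def Q_def EZ Zeq)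
  have mQ[measurable]: "Q \<in> borel_measurable M" and mY[measurable]: "Y \<in> borel_measurable M"
    unfolding Q_def[abs_def] Y_def[abs_def] by measurable
  have Q2eq: "(Q \<omega>)\<^sup>2 = (R \<omega>)\<^sup>2 - 2 * r * R \<omega> + r\<^sup>2" for \<omega> by (simp add: Q_def power2_diff)
  have Q2: "integrable M (\<lambda>\<omega>. (Q \<omega>)\<^sup>2)" unfolding Q2eq using R2 iR by simp
  have "(\<integral>\<omega>. (Q \<omega>)\<^sup>2 \<partial>M) = (\<integral>\<omega>. (R \<omega>)\<^sup>2 \<partial>M) - r\<^sup>2"
    unfolding Q2eq using R2 iR prob_space by (simp add: r_def[symmetric] power2_eq_square)
  then have Q2le: "(\<integral>\<omega>. (Q \<omega>)\<^sup>2 \<partial>M) \<le> \<rho>" using R2le zero_le_power2[of r] by linarith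
  have QV: "integrable M (\<lambda>\<omega>. Q \<omega> * V \<omega>)" by (rule integrable_prod[OF mQ mV Q2 V(2)])
  have Y2eq: "(Y \<omega>)\<^sup>2 = (Q \<omega>)\<^sup>2 + 2 * \<beta> * (Q \<omega> * V \<omega>) + \<beta>\<^sup>2 * (V \<omega>)\<^sup>2" for \<omega>
    unfolding Yeq by (simp add: power2_sum power_mult_distrib)
  have Y2: "integrable M (\<lambda>\<omega>. (Y \<omega>)\<^sup>2)" unfolding Y2eq using Q2 QV V(2) by simp
  have YV: "integrable M (\<lambda>\<omega>. Y \<omega> * V \<omega>)" by (rule integrable_prod[OF mY mV Y2 V(2)])
  define \<sigma> where "\<sigma> = sqrt (\<integral>\<omega>. (Y \<omega>)\<^sup>2 \<partial>M)"
  have \<sigma>0: "0 \<le> \<sigma>" by (simp add: \<sigma>_def)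
  have \<sigma>2: "\<sigma>\<^sup>2 = (\<integral>\<omega>. (Y \<omega>)\<^sup>2 \<partial>M)" by (simp add: \<sigma>_def)
  have nz: "normalized M Z \<omega> = Y \<omega> / \<sigma>" for \<omega>
    by (simp add: normalized_def Y_def \<sigma>_def)
  have iY: "integrable M Y" unfolding Y_def[abs_def] using iZ by simp
  show inz: "integrable M (normalized M Z)" unfolding nz[abs_def] using iY by simp
  have Qsq: "(Q \<omega>)\<^sup>2 = (Y \<omega>)\<^sup>2 - 2 * \<beta> * (Y \<omega> * V \<omega>) + \<beta>\<^sup>2 * (V \<omega>)\<^sup>2" for \<omega>
  proof -
    have "Q \<omega> = Y \<omega> - \<beta> * V \<omega>" using Yeq[of \<omega>] by simp
    then show ?thesis by (simp add: power2_diff power_mult_distrib)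
  qed
  have EQ2: "(\<integral>\<omega>. (Q \<omega>)\<^sup>2 \<partial>M) = \<sigma>\<^sup>2 - 2 * \<beta> * (\<integral>\<omega>. Y \<omega> * V \<omega> \<partial>M) + \<beta>\<^sup>2"
    unfolding Qsq \<sigma>2 using Y2 YV V(2,4) by simp
  define D where "D \<omega> = normalized M Z \<omega> - V \<omega>" for \<omega>
  have D2: "integrable M (\<lambda>\<omega>. (D \<omega>)\<^sup>2) \<and> (\<integral>\<omega>. (D \<omega>)\<^sup>2 \<partial>M) \<le> 4 * \<rho> / \<beta>\<^sup>2"
  proof (cases "\<sigma> = 0")
    case True
    have "AE \<omega> in M. (Y \<omega>)\<^sup>2 = 0"
      using integral_nonneg_eq_0_iff_AE[OF Y2] \<sigma>2 True by simp
    then have "(\<integral>\<omega>. Y \<omega> * V \<omega> \<partial>M) = (\<integral>\<omega>. 0 \<partial>M)"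
      by (intro integral_cong_AE) (auto elim!: eventually_mono)
    then have "\<beta>\<^sup>2 \<le> \<rho>" using EQ2 Q2le True by simp
    then have "1 \<le> 4 * \<rho> / \<beta>\<^sup>2" using \<beta> \<rho> by (simp add: le_divide_eq)
    moreover have "(D \<omega>)\<^sup>2 = (V \<omega>)\<^sup>2" for \<omega> by (simp add: D_def nz True)
    ultimately show ?thesis using V(2,4) by simp
  next
    case False
    then have \<sigma>: "0 < \<sigma>" using \<sigma>0 by simp
    define \<kappa> where "\<kappa> = (\<integral>\<omega>. Y \<omega> * V \<omega> \<partial>M)"
    have Deq: "(D \<omega>)\<^sup>2 = 1 / \<sigma>\<^sup>2 * (Y \<omega>)\<^sup>2 - 2 / \<sigma> * (Y \<omega> * V \<omega>) + (V \<omega>)\<^sup>2" for \<omega>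
      by (simp add: D_def nz power2_diff power_divide)
    have iD: "integrable M (\<lambda>\<omega>. (D \<omega>)\<^sup>2)" unfolding Deq using Y2 YV V(2) by simp
    have ED: "(\<integral>\<omega>. (D \<omega>)\<^sup>2 \<partial>M) = 2 - 2 / \<sigma> * \<kappa>"
      unfolding Deq using Y2 YV V(2,4) \<sigma> by (simp add: \<sigma>2[symmetric] \<kappa>_def[symmetric])
    have "0 \<le> (\<integral>\<omega>. (D \<omega>)\<^sup>2 \<partial>M)" by simp
    then have cs: "\<kappa> \<le> \<sigma>" unfolding ED using \<sigma> by (simp add: field_simps)
    have q: "\<sigma>\<^sup>2 - 2 * \<beta> * \<kappa> + \<beta>\<^sup>2 \<le> \<rho>" using Q2le unfolding EQ2 \<kappa>_def .
    have mk: "- \<sigma> \<le> \<kappa>"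
    proof -
      have "(Y \<omega> / \<sigma> + V \<omega>)\<^sup>2 = 1 / \<sigma>\<^sup>2 * (Y \<omega>)\<^sup>2 + 2 / \<sigma> * (Y \<omega> * V \<omega>) + (V \<omega>)\<^sup>2" for \<omega>
        by (simp add: power2_sum power_divide)
      then have E: "(\<integral>\<omega>. (Y \<omega> / \<sigma> + V \<omega>)\<^sup>2 \<partial>M) = 2 + 2 / \<sigma> * \<kappa>"
        using Y2 YV V(2,4) \<sigma> by (simp add: \<sigma>2[symmetric] \<kappa>_def[symmetric])
      have "0 \<le> 2 + 2 / \<sigma> * \<kappa>" unfolding E[symmetric] by simp
      then show ?thesis using \<sigma> by (simp add: field_simps)
    qed
    have "\<beta>\<^sup>2 * (2 - 2 / \<sigma> * \<kappa>) \<le> 4 * \<rho>"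
    proof -
      \<comment> \<open>The correlation coefficient of \<open>Y\<close> and \<open>V\<close>.\<close>
      define \<theta> where "\<theta> = \<kappa> / \<sigma>"
      have \<theta>: "- 1 \<le> \<theta>" "\<theta> \<le> 1" "\<kappa> = \<sigma> * \<theta>"
        using cs mk \<sigma> by (simp_all add: \<theta>_def le_divide_eq divide_le_eq)
      have "2 * \<beta> * \<kappa> \<le> 2 * \<beta> * \<sigma>" using cs \<beta> by (intro mult_left_mono) auto
      then have "(\<beta> - \<sigma>)\<^sup>2 \<le> \<rho>" using q by (simp add: power2_diff)
      moreover have "\<beta>\<^sup>2 * (2 - 2 * \<theta>) = 2 * (\<beta> - \<sigma>)\<^sup>2 + 2 * (\<sigma>\<^sup>2 - 2 * \<beta> * \<kappa> + \<beta>\<^sup>2)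
          - (2 * ((1 + \<theta>) * (\<beta> - \<sigma>)\<^sup>2) + 2 * ((1 - \<theta>) * \<sigma>\<^sup>2))"
        unfolding \<theta>(3) by (simp add: power2_eq_square algebra_simps)
      moreover have "0 \<le> (1 + \<theta>) * (\<beta> - \<sigma>)\<^sup>2" "0 \<le> (1 - \<theta>) * \<sigma>\<^sup>2" using \<theta>(1,2) by simp_all
      moreover have "L \<le> 4 * \<rho>" if "P \<le> \<rho>" "L = 2 * P + 2 * W - (2 * A + 2 * B)" "0 \<le> A" "0 \<le> B" "W \<le> \<rho>"
        for L P W A B :: real using that by linarith
      ultimately have "\<beta>\<^sup>2 * (2 - 2 * \<theta>) \<le> 4 * \<rho>" using q by blast
      then show ?thesis by (simp add: \<theta>_def)
    qed
    then have "2 - 2 / \<sigma> * \<kappa> \<le> 4 * \<rho> / \<beta>\<^sup>2" using \<beta> by (simp add: le_divide_eq mult.commute)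
    then show ?thesis using iD ED by simp
  qed
  have iDD: "integrable M D" unfolding D_def[abs_def] using inz V(1) by simp
  have "(\<integral>\<omega>. \<bar>D \<omega>\<bar> \<partial>M) \<le> 2 * sqrt \<rho> / \<beta>"
  proof (rule mean_abs_le_of_second_moment[OF _ iDD])
    show "(\<integral>\<omega>. (D \<omega>)\<^sup>2 \<partial>M) \<le> (2 * sqrt \<rho> / \<beta>)\<^sup>2"
      using D2 \<rho> by (simp add: power_divide power_mult_distrib)
  qed (use D2 \<beta> \<rho> in simp_all)
  then show "(\<integral>\<omega>. \<bar>normalized M Z \<omega> - V \<omega>\<bar> \<partial>M) \<le> 2 * sqrt \<rho> / \<beta>" by (simp add: D_def)
qed

context arithmetic_wave
begin

text \<open>The residual costs the term with \<open>K\<close>, its size being of order \<open>N powr (- 1 / 2)\<close> relative to the main term,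
  and the deviation of the energy from normality the term 2.\<close>

lemma leray_lipschitz_bound:
  assumes leray: "is_leray_measure M T Z" and K: "0 < K"
    and singular: "(\<integral>\<^sup>+x. ennreal (wave_cov n x ^ 4 / sqrt (1 - (wave_cov n x)\<^sup>2)) \<partial>torus_measure) \<le> ennreal (K / N\<^sup>2)"
    and lip: "\<And>x y. \<bar>h x - h y\<bar> \<le> \<bar>x - y\<bar>"
  shows "\<bar>(\<integral>x. h x \<partial>distr M borel (normalized M Z)) - (\<integral>t. h t \<partial>std_normal_distribution)\<bar>
    \<le> sqrt 2 * (2 * sqrt (3 * K) / peak + 2) * N powr (- 1 / 2)"
proof -
  have mZ[measurable]: "Z \<in> borel_measurable M" using leray by (simp add: is_leray_measure_def)
  let ?V = normalized_energy
  define s where "s = sqrt m"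
  have s: "s > 0" "m = s * s" unfolding s_def using m_pos by auto
  have Veq: "?V \<omega> = (m - energy \<omega>) / s" for \<omega> by (simp add: normalized_energy_def s_def)
  have V1: "integrable M ?V" "(\<integral>\<omega>. ?V \<omega> \<partial>M) = 0"
    unfolding Veq[abs_def] using energy_integrable energy_mean prob_space by simp_all
  have V2eq: "(?V \<omega>)\<^sup>2 = (energy \<omega> - m)\<^sup>2 / m" for \<omega>
    unfolding Veq power_divide using s by (simp add: power2_commute power2_eq_square[of s])
  have V2: "integrable M (\<lambda>\<omega>. (?V \<omega>)\<^sup>2)" "(\<integral>\<omega>. (?V \<omega>)\<^sup>2 \<partial>M) = 1"
    unfolding V2eq using energy_variance m_pos by (auto simp: card_gt_0_iff)
  define \<beta> where "\<beta> = peak / (2 * s)"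
  have \<beta>: "0 < \<beta>" using peak_pos s by (simp add: \<beta>_def)
  define \<rho> where "\<rho> = 3 * (K / N\<^sup>2)"
  have \<rho>: "0 < \<rho>" using K N_pos by (simp add: \<rho>_def)
  have Req: "Z \<omega> - peak - \<beta> * ?V \<omega> = Z \<omega> - peak + peak / 2 * (energy \<omega> / m - 1)" for \<omega>
    unfolding Veq \<beta>_def s(2) using s(1) by (simp add: field_simps)
  have close: "(\<integral>\<^sup>+\<omega>. ennreal ((Z \<omega> - peak - \<beta> * ?V \<omega>)\<^sup>2) \<partial>M) \<le> ennreal \<rho>"
    unfolding Req \<rho>_def by (rule leray_residual_second_moment[OF leray _ singular]) (use K in simp)
  note near = normalized_near[OF mZ V1(1) V2(1) V1(2) V2(2) \<beta> \<rho> close]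
  note [measurable] = borel_measurable_lipschitz[OF lip]
  have mN[measurable]: "normalized M Z \<in> borel_measurable M" using borel_measurable_integrable[OF near(1)] .
  note ihV = integrable_lipschitz[OF lip V1(1)]
  note ihN = integrable_lipschitz[OF lip near(1)]
  have "\<bar>(\<integral>\<omega>. h (normalized M Z \<omega>) \<partial>M) - (\<integral>\<omega>. h (?V \<omega>) \<partial>M)\<bar> = \<bar>\<integral>\<omega>. h (normalized M Z \<omega>) - h (?V \<omega>) \<partial>M\<bar>"
    using ihN ihV by simp
  also have "\<dots> \<le> (\<integral>\<omega>. \<bar>h (normalized M Z \<omega>) - h (?V \<omega>)\<bar> \<partial>M)" by (rule integral_abs_bound)
  also have "\<dots> \<le> (\<integral>\<omega>. \<bar>normalized M Z \<omega> - ?V \<omega>\<bar> \<partial>M)"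
    by (intro integral_mono lip) (use ihN ihV near(1) V1(1) in simp_all)
  also have "\<dots> \<le> 2 * sqrt \<rho> / \<beta>" by (rule near(2))
  also have "\<dots> = (2 * sqrt (3 * K) / peak) / s"
  proof -
    have N: "N = 2 * (s * s)" using N_half s(2) by simp
    have "\<rho> = 3 * K / (2 * (s * s))\<^sup>2" unfolding \<rho>_def N by simp
    then have "sqrt \<rho> = sqrt (3 * K) / (2 * (s * s))"
      using s(1) by (simp only: real_sqrt_divide real_sqrt_abs abs_of_pos mult_pos_pos zero_less_numeral)
    then show ?thesis unfolding \<beta>_def using s(1) peak_pos by (simp add: field_simps)
  qed
  finally have 1: "\<bar>(\<integral>\<omega>. h (normalized M Z \<omega>) \<partial>M) - (\<integral>\<omega>. h (?V \<omega>) \<partial>M)\<bar> \<le> (2 * sqrt (3 * K) / peak) / s" .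
  have 2: "\<bar>(\<integral>\<omega>. h (?V \<omega>) \<partial>M) - (\<integral>t. h t \<partial>std_normal_distribution)\<bar> \<le> 2 / s"
    unfolding s_def by (rule normalized_energy_wasserstein[OF lip])
  have 3: "(\<integral>x. h x \<partial>distr M borel (normalized M Z)) = (\<integral>\<omega>. h (normalized M Z \<omega>) \<partial>M)"
    by (rule integral_distr) measurable
  have "1 / s = sqrt 2 * N powr (- 1 / 2)"
  proof -
    have "N powr (- 1 / 2) = 1 / sqrt N" using powr_minus_divide[of N "1/2"] powr_half_sqrt[of N] by simp
    moreover have "sqrt N = sqrt 2 * s" unfolding N_half s_def by (rule real_sqrt_mult)
    ultimately show ?thesis by simp
  qed
  then have "sqrt 2 * (2 * sqrt (3 * K) / peak + 2) * N powr (- 1 / 2) = (2 * sqrt (3 * K) / peak + 2) * (1 / s)"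
    by (simp only: mult_ac)
  then have "sqrt 2 * (2 * sqrt (3 * K) / peak + 2) * N powr (- 1 / 2) = (2 * sqrt (3 * K) / peak) / s + 2 / s"
    by (simp add: add_divide_distrib)
  then show ?thesis unfolding 3 using 1 2 by linarith
qed

end

text \<open>This makes continuous step functions, which suffice to test weak convergence, admissible in the
  supremum that defines the Wasserstein distance.\<close>

lemma scaled_cts_step_lipschitz:
  assumes "x < y" shows "\<bar>(y - x) * cts_step x y s - (y - x) * cts_step x y t\<bar> \<le> \<bar>s - t\<bar>"
proof -
  have "(y - x) * cts_step x y u = min (y - x) (max 0 (y - u))" for u
    using assms by (auto simp: cts_step_def min_def max_def)
  then show ?thesis by (auto simp: min_def max_def abs_if)
qed

theorem theorem1:
  fixes M :: "'w measure"
    and a :: "int \<times> int \<Rightarrow> 'w \<Rightarrow> complex"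
    and Z :: "nat \<Rightarrow> 'w \<Rightarrow> real"
  assumes "prob_space M"
    and "\<And>n. n \<in> sums_of_two_squares \<Longrightarrow> wave_coefficients M n a"
    and "\<And>n. n \<in> sums_of_two_squares \<Longrightarrow> is_leray_measure M (arith_random_wave n a) (Z n)"
  shows "(\<exists>C>0. \<forall>n\<in>sums_of_two_squares.
             wasserstein1 (distr M borel (normalized M (Z n))) std_normal_distribution
               \<le> ereal (C * real (card (Freq n)) powr (- 1 / 2)))
         \<and> (\<forall>s :: nat \<Rightarrow> nat.
             range s \<subseteq> sums_of_two_squares \<and> filterlim (\<lambda>j. card (Freq (s j))) at_top sequentially
             \<longrightarrow> weak_conv_m (\<lambda>j. distr M borel (normalized M (Z (s j)))) std_normal_distribution)"
proof -
  interpret prob_space M by fact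
  obtain K0 where K0: "K0 \<ge> 0" and sing0: "\<And>n. n \<in> sums_of_two_squares \<Longrightarrow>
    (\<integral>\<^sup>+x. ennreal (wave_cov n x ^ 4 / sqrt (1 - (wave_cov n x)\<^sup>2)) \<partial>torus_measure)
      \<le> ennreal (K0 / (real (card (Freq n)))\<^sup>2)"
    using wave_cov_singular_integral by blast
  define K where "K = K0 + 1"
  have K: "0 < K" using K0 by (simp add: K_def)
  define C where "C = sqrt 2 * (2 * sqrt (3 * K) / peak + 2)"
  have C: "0 < C"
    unfolding C_def using K peak_pos by (intro mult_pos_pos add_pos_pos divide_pos_pos) auto
  have bound: "\<bar>(\<integral>x. h x \<partial>distr M borel (normalized M (Z n))) - (\<integral>t. h t \<partial>std_normal_distribution)\<bar>
      \<le> C * real (card (Freq n)) powr (- 1 / 2)"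
    if n: "n \<in> sums_of_two_squares" and lip: "\<And>x y. \<bar>h x - h y\<bar> \<le> \<bar>x - y\<bar>" for n h
  proof -
    interpret arithmetic_wave M n a using n assms(2) by unfold_locales auto
    have "(\<integral>\<^sup>+x. ennreal (wave_cov n x ^ 4 / sqrt (1 - (wave_cov n x)\<^sup>2)) \<partial>torus_measure) \<le> ennreal (K / N\<^sup>2)"
      using sing0[OF n] by (rule order.trans) (auto simp: K_def intro!: ennreal_leI divide_right_mono)
    from leray_lipschitz_bound[OF assms(3)[OF n] K this lip] show ?thesis unfolding C_def .
  qed
  have "wasserstein1 (distr M borel (normalized M (Z n))) std_normal_distribution
      \<le> ereal (C * real (card (Freq n)) powr (- 1 / 2))" if n: "n \<in> sums_of_two_squares" for n
    unfolding wasserstein1_def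
  proof (rule SUP_least)
    fix h :: "real \<Rightarrow> real" assume "h \<in> {h. 1-lipschitz_on UNIV h}"
    then have "\<bar>h x - h y\<bar> \<le> \<bar>x - y\<bar>" for x y by (auto simp: lipschitz_on_def dist_real_def)
    from bound[OF n this]
    show "ereal \<bar>(\<integral>x. h x \<partial>distr M borel (normalized M (Z n))) - (\<integral>x. h x \<partial>std_normal_distribution)\<bar>
      \<le> ereal (C * real (card (Freq n)) powr (- 1 / 2))" by (simp only: ereal_less_eq)
  qed
  moreover have "weak_conv_m (\<lambda>j. distr M borel (normalized M (Z (s j)))) std_normal_distribution"
    if s: "range s \<subseteq> sums_of_two_squares" and lim: "filterlim (\<lambda>j. card (Freq (s j))) at_top sequentially" for s :: "nat \<Rightarrow> nat"
  proof (rule integral_cts_step_conv_imp_weak_conv)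
    fix j
    have "Z (s j) \<in> borel_measurable M" using assms(3)[of "s j"] s by (auto simp: is_leray_measure_def)
    then have "normalized M (Z (s j)) \<in> borel_measurable M" unfolding normalized_def[abs_def] by measurable
    then show "real_distribution (distr M borel (normalized M (Z (s j))))" by simp
  next
    show "real_distribution std_normal_distribution" by (rule real_dist_normal_dist)
  next
    fix x y :: real assume xy: "x < y"
    define e where "e j = C * real (card (Freq (s j))) powr (- 1 / 2) / (y - x)" for j
    have "filterlim (\<lambda>j. real (card (Freq (s j)))) at_top sequentially"
      by (rule filterlim_compose[OF filterlim_real_sequentially lim])
    then have "(\<lambda>j. real (card (Freq (s j))) powr (- 1 / 2)) \<longlonglongrightarrow> 0" by (intro tendsto_neg_powr) auto
    then have "(\<lambda>j. C * real (card (Freq (s j))) powr (- 1 / 2) / (y - x)) \<longlonglongrightarrow> C * 0 / (y - x)"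
      using xy by (intro tendsto_intros) auto
    then have e0: "e \<longlonglongrightarrow> 0" by (simp add: e_def[abs_def])
    have "\<bar>(\<integral>t. cts_step x y t \<partial>distr M borel (normalized M (Z (s j)))) - (\<integral>t. cts_step x y t \<partial>std_normal_distribution)\<bar> \<le> e j" for j
    proof -
      have "s j \<in> sums_of_two_squares" using s by auto
      from bound[OF this scaled_cts_step_lipschitz[OF xy]]
      have "\<bar>(y - x) * ((\<integral>t. cts_step x y t \<partial>distr M borel (normalized M (Z (s j)))) - (\<integral>t. cts_step x y t \<partial>std_normal_distribution))\<bar>
        \<le> C * real (card (Freq (s j))) powr (- 1 / 2)" by (simp add: right_diff_distrib)
      then show ?thesis using xy by (simp add: e_def abs_mult le_divide_eq mult.commute)
    qed
    then have "(\<lambda>j. (\<integral>t. cts_step x y t \<partial>distr M borel (normalized M (Z (s j)))) - (\<integral>t. cts_step x y t \<partial>std_normal_distribution)) \<longlonglongrightarrow> 0"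
      using e0 by (intro Lim_null_comparison[OF always_eventually e0]) auto
    then show "(\<lambda>j. integral\<^sup>L (distr M borel (normalized M (Z (s j)))) (cts_step x y)) \<longlonglongrightarrow> integral\<^sup>L std_normal_distribution (cts_step x y)"
      by (rule LIM_zero_cancel)
  qed
  ultimately show ?thesis using C by blast
qed

end
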